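(* Let $M^6$ be a $6$-manifold with a nearly Kähler structure $(F,\Psi_+,\Psi_-)$, and let $f:N^5\to M^6$ be an oriented hypersurface, with unit normal vector field $\mathbb{N}$, which is totally geodesic with respect to the metric of the nearly Kähler structure. Then the induced $SU(2)$-structure on $N^5$ defined by $$\eta=-\mathbb{N}\lrcorner F,\quad \omega_1=f^*F,\quad \omega_2=\mathbb{N}\lrcorner\Psi_-,\quad \omega_3=-\mathbb{N}\lrcorner\Psi_+$$ (all forms restricted to $N^5$) satisfies $$d\eta=-2\omega_3,\qquad d\omega_1=3\eta\wedge\omega_2,\qquad d\omega_2=-3\eta\wedge\omega_1 .$$
   Context: An $SU(3)$-structure on a $6$-manifold is a triple $(F,\Psi_+,\Psi_-)$ of a $2$-form and two $3$-forms such that locally there is a coframe $e^1,\dots,e^6$ with $F=e^{12}+e^{34}+e^{56}$ and $\Psi_++i\Psi_-=(e^1+ie^2)\wedge(e^3+ie^4)\wedge(e^5+ie^6)$, where $e^{ij}=e^i\wedge e^j$; its metric $g$ is the one for which this coframe is orthonormal. It is nearly Kähler if $dF=3\Psi_+$ and $d\Psi_-=-2F\wedge F$. An $SU(2)$-structure on a $5$-manifold is a quadruplet $(\eta,\omega_1,\omega_2,\omega_3)$ of a $1$-form $\eta$ and $2$-forms $\omega_i$ with $\omega_i\wedge\omega_j=\delta_{ij}v$ for some $4$-form $v$ with $v\wedge\eta$ nowhere zero, and such that $X\lrcorner\omega_1=Y\lrcorner\omega_2$ implies $\omega_3(X,Y)\ge 0$. The symbol $\lrcorner$ denotes contraction.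 *)

theory Defs
  imports "HOL-Analysis.Analysis"
begin

section \<open>Smooth functions between open subsets of Euclidean spaces\<close>

fun Ck_on :: "nat \<Rightarrow> 'a::euclidean_space set \<Rightarrow> ('a \<Rightarrow> 'b::real_normed_vector) \<Rightarrow> bool" where
  "Ck_on 0 S f \<longleftrightarrow> continuous_on S f"
| "Ck_on (Suc k) S f \<longleftrightarrow>
     (\<forall>x\<in>S. f differentiable (at x)) \<and> (\<forall>v. Ck_on k S (\<lambda>x. frechet_derivative f (at x) v))"

text \<open>Only used for open sets \<open>S\<close>.\<close>
definition smooth_on :: "'a::euclidean_space set \<Rightarrow> ('a \<Rightarrow> 'b::real_normed_vector) \<Rightarrow> bool" where
  "smooth_on S f \<longleftrightarrow> (\<forall>k. Ck_on k S f)"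


section \<open>Smooth manifolds\<close>

text \<open>A chart is a pair of its domain and its coordinate map. A manifold is represented by a smooth
  atlas (not necessarily maximal); its underlying space is the union of the chart domains, an open
  subset of a Hausdorff, second countable space. Its dimension is that of the model space \<open>'e\<close>.\<close>

type_synonym ('p, 'e) chart = "'p set \<times> ('p \<Rightarrow> 'e)"

definition carrier :: "('p, 'e) chart set \<Rightarrow> 'p set" where
  "carrier M = (\<Union>c\<in>M. fst c)"

definition coord_inv :: "('p, 'e) chart \<Rightarrow> 'e \<Rightarrow> 'p" where
  "coord_inv c = inv_into (fst c) (snd c)"

definition smooth_manifold ::
    "('p::{t2_space, second_countable_topology}, 'e::euclidean_space) chart set \<Rightarrow> bool" where
  "smooth_manifold M \<longleftrightarrow>
     (\<forall>c\<in>M. open (fst c) \<and> open (snd c ` fst c) \<and>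
            homeomorphism (fst c) (snd c ` fst c) (snd c) (coord_inv c)) \<and>
     (\<forall>c\<in>M. \<forall>c'\<in>M. smooth_on (snd c ` (fst c \<inter> fst c')) (snd c' \<circ> coord_inv c))"

text \<open>Some chart around a point, for notions that do not depend on the chart.\<close>
definition chart_at :: "('p, 'e) chart set \<Rightarrow> 'p \<Rightarrow> ('p, 'e) chart" where
  "chart_at M p = (SOME c. c \<in> M \<and> p \<in> fst c)"


section \<open>Tangent vectors\<close>

text \<open>A tangent vector at \<open>p\<close> is the family of its coordinate vectors in all charts around \<open>p\<close>,
  related by the differentials of the transition maps; the entries at the other charts are \<open>0\<close>.\<close>

type_synonym ('p, 'e) tvec = "('p, 'e) chart \<Rightarrow> 'e"

definition transition_deriv ::
    "('p, 'e::euclidean_space) chart \<Rightarrow> ('p, 'e) chart \<Rightarrow> 'p \<Rightarrow> 'e \<Rightarrow> 'e" where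
  "transition_deriv c c' p = frechet_derivative (snd c' \<circ> coord_inv c) (at (snd c p))"

definition tangent_space ::
    "('p, 'e::euclidean_space) chart set \<Rightarrow> 'p \<Rightarrow> ('p, 'e) tvec set" where
  "tangent_space M p =
     {X. (\<forall>c\<in>M. \<forall>c'\<in>M. p \<in> fst c \<inter> fst c' \<longrightarrow> X c' = transition_deriv c c' p (X c)) \<and>
         (\<forall>c. \<not> (c \<in> M \<and> p \<in> fst c) \<longrightarrow> X c = 0)}"

text \<open>The tangent vector at \<open>p\<close> with coordinate vector \<open>u\<close> in the chart \<open>c\<close>.\<close>
definition tvec_of ::
    "('p, 'e::euclidean_space) chart set \<Rightarrow> ('p, 'e) chart \<Rightarrow> 'p \<Rightarrow> 'e \<Rightarrow> ('p, 'e) tvec" where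
  "tvec_of M c p u = (\<lambda>c'. if c' \<in> M \<and> p \<in> fst c' then transition_deriv c c' p u else 0)"


section \<open>Smooth maps\<close>

definition smooth_map ::
    "('q::topological_space, 'd::euclidean_space) chart set \<Rightarrow>
     ('p::topological_space, 'e::euclidean_space) chart set \<Rightarrow> ('q \<Rightarrow> 'p) \<Rightarrow> bool" where
  "smooth_map N M f \<longleftrightarrow>
     f ` carrier N \<subseteq> carrier M \<and> continuous_on (carrier N) f \<and>
     (\<forall>c\<in>N. \<forall>c'\<in>M. smooth_on (snd c ` (fst c \<inter> f -` fst c')) (snd c' \<circ> f \<circ> coord_inv c))"

definition pushforward ::
    "('q, 'd::euclidean_space) chart set \<Rightarrow> ('p, 'e::euclidean_space) chart set \<Rightarrow>
     ('q \<Rightarrow> 'p) \<Rightarrow> 'q \<Rightarrow> ('q, 'd) tvec \<Rightarrow> ('p, 'e) tvec" where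
  "pushforward N M f p X =
     (let c = chart_at N p in
      (\<lambda>c'. if c' \<in> M \<and> f p \<in> fst c'
            then frechet_derivative (snd c' \<circ> f \<circ> coord_inv c) (at (snd c p)) (X c) else 0))"

definition immersion ::
    "('q::topological_space, 'd::euclidean_space) chart set \<Rightarrow>
     ('p::topological_space, 'e::euclidean_space) chart set \<Rightarrow> ('q \<Rightarrow> 'p) \<Rightarrow> bool" where
  "immersion N M f \<longleftrightarrow> smooth_map N M f \<and>
     (\<forall>p\<in>carrier N. inj_on (pushforward N M f p) (tangent_space N p))"


section \<open>Differential forms\<close>

text \<open>A (real or complex valued) form of degree \<open>k\<close> assigns to each point \<open>p\<close> a function of lists
  of \<open>k\<close> tangent vectors at \<open>p\<close>. Values at other arguments are irrelevant; accordingly forms are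
  compared by \<open>form_eq\<close>. The wedge product and the exterior derivative are normalised so that
  \<open>(\<alpha> \<and> \<beta>)(X,Y) = \<alpha>(X) \<beta>(Y) - \<alpha>(Y) \<beta>(X)\<close> and
  \<open>d\<alpha>(X,Y) = X(\<alpha>(Y)) - Y(\<alpha>(X)) - \<alpha>([X,Y])\<close> for 1-forms.\<close>

type_synonym ('p, 'e, 'b) dform = "'p \<Rightarrow> ('p, 'e) tvec list \<Rightarrow> 'b"

definition form_eq ::
    "('p, 'e::euclidean_space) chart set \<Rightarrow> 'p set \<Rightarrow> nat \<Rightarrow>
     ('p, 'e, 'b) dform \<Rightarrow> ('p, 'e, 'b) dform \<Rightarrow> bool" where
  "form_eq M U k \<alpha> \<beta> \<longleftrightarrow>
     (\<forall>p\<in>U. \<forall>vs. length vs = k \<and> set vs \<subseteq> tangent_space M p \<longrightarrow> \<alpha> p vs = \<beta> p vs)"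

definition alternating_multilinear :: "nat \<Rightarrow> ('e::real_vector list \<Rightarrow> real) \<Rightarrow> bool" where
  "alternating_multilinear k a \<longleftrightarrow>
     (\<forall>us i. length us = k \<and> i < k \<longrightarrow> linear (\<lambda>w. a (us[i := w]))) \<and>
     (\<forall>us i j. length us = k \<and> i < j \<and> j < k \<and> us ! i = us ! j \<longrightarrow> a us = 0)"

text \<open>A form expressed in the coordinates of the chart \<open>c\<close>.\<close>
definition local_form ::
    "('p, 'e::euclidean_space) chart set \<Rightarrow> ('p, 'e) chart \<Rightarrow> ('p, 'e, 'b) dform \<Rightarrow>
     'e \<Rightarrow> 'e list \<Rightarrow> 'b" where
  "local_form M c \<alpha> x us = \<alpha> (coord_inv c x) (map (tvec_of M c (coord_inv c x)) us)"

definition smooth_form_on ::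
    "('p, 'e::euclidean_space) chart set \<Rightarrow> 'p set \<Rightarrow> nat \<Rightarrow> ('p, 'e, real) dform \<Rightarrow> bool" where
  "smooth_form_on M U k \<alpha> \<longleftrightarrow>
     (\<forall>c\<in>M. (\<forall>x\<in>snd c ` (fst c \<inter> U). alternating_multilinear k (local_form M c \<alpha> x)) \<and>
            (\<forall>us. length us = k \<longrightarrow>
                  smooth_on (snd c ` (fst c \<inter> U)) (\<lambda>x. local_form M c \<alpha> x us)))"

definition wedge ::
    "nat \<Rightarrow> nat \<Rightarrow> ('p, 'e, 'b::real_normed_field) dform \<Rightarrow> ('p, 'e, 'b) dform \<Rightarrow>
     ('p, 'e, 'b) dform" where
  "wedge k l \<alpha> \<beta> p vs =
     (\<Sum>\<sigma> | \<sigma> permutes {..<k + l}.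
        of_int (sign \<sigma>) * \<alpha> p (map (\<lambda>i. vs ! \<sigma> i) [0..<k]) * \<beta> p (map (\<lambda>i. vs ! \<sigma> i) [k..<k + l]))
     / (fact k * fact l)"

definition scale_form ::
    "real \<Rightarrow> ('p, 'e, real) dform \<Rightarrow> ('p, 'e, real) dform" (infixr "\<odot>" 75) where
  "(r \<odot> \<alpha>) p vs = r * \<alpha> p vs"

definition complex_form ::
    "('p, 'e, real) dform \<Rightarrow> ('p, 'e, real) dform \<Rightarrow> ('p, 'e, complex) dform" where
  "complex_form \<alpha> \<beta> p vs = complex_of_real (\<alpha> p vs) + \<i> * complex_of_real (\<beta> p vs)"

definition local_ext_deriv ::
    "('e::euclidean_space \<Rightarrow> 'e list \<Rightarrow> real) \<Rightarrow> 'e \<Rightarrow> 'e list \<Rightarrow> real" where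
  "local_ext_deriv a x us =
     (\<Sum>i<length us. (-1) ^ i *
        frechet_derivative (\<lambda>y. a y (take i us @ drop (Suc i) us)) (at x) (us ! i))"

definition ext_deriv ::
    "('p, 'e::euclidean_space) chart set \<Rightarrow> ('p, 'e, real) dform \<Rightarrow> ('p, 'e, real) dform" where
  "ext_deriv M \<alpha> p vs =
     (let c = chart_at M p in
      local_ext_deriv (local_form M c \<alpha>) (snd c p) (map (\<lambda>X. X c) vs))"

definition pullback ::
    "('q, 'd::euclidean_space) chart set \<Rightarrow> ('p, 'e::euclidean_space) chart set \<Rightarrow> ('q \<Rightarrow> 'p) \<Rightarrow>
     ('p, 'e, real) dform \<Rightarrow> ('q, 'd, real) dform" where
  "pullback N M f \<alpha> p vs = \<alpha> (f p) (map (pushforward N M f p) vs)"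

text \<open>For a vector field \<open>\<nu>\<close> along \<open>f\<close>, the contraction of \<open>\<alpha>\<close> with \<open>\<nu>\<close>, restricted to \<open>N\<close>.\<close>
definition contract_along ::
    "('q, 'd::euclidean_space) chart set \<Rightarrow> ('p, 'e::euclidean_space) chart set \<Rightarrow> ('q \<Rightarrow> 'p) \<Rightarrow>
     ('q \<Rightarrow> ('p, 'e) tvec) \<Rightarrow> ('p, 'e, real) dform \<Rightarrow> ('q, 'd, real) dform" where
  "contract_along N M f \<nu> \<alpha> p vs = \<alpha> (f p) (\<nu> p # map (pushforward N M f p) vs)"


section \<open>SU(3)-structures and nearly Kaehler structures\<close>

text \<open>A smooth coframe on \<open>U\<close>, indexed by \<open>1, \<dots>, 6\<close>.\<close>
definition coframe_on ::
    "('p, real^6) chart set \<Rightarrow> 'p set \<Rightarrow> (nat \<Rightarrow> ('p, real^6, real) dform) \<Rightarrow> bool" where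
  "coframe_on M U e \<longleftrightarrow>
     (\<forall>i\<in>{1..6}. smooth_form_on M U 1 (e i)) \<and>
     (\<forall>p\<in>U. \<forall>a. (\<forall>X\<in>tangent_space M p. (\<Sum>i=1..6. a i * e i p [X]) = 0) \<longrightarrow> (\<forall>i\<in>{1..6}. a i = 0))"

definition SU3_coframe ::
    "('p::topological_space, real^6) chart set \<Rightarrow> ('p, real^6, real) dform \<Rightarrow>
     ('p, real^6, real) dform \<Rightarrow> ('p, real^6, real) dform \<Rightarrow> 'p set \<Rightarrow>
     (nat \<Rightarrow> ('p, real^6, real) dform) \<Rightarrow> bool" where
  "SU3_coframe M F \<Psi>p \<Psi>m U e \<longleftrightarrow>
     open U \<and> U \<subseteq> carrier M \<and> coframe_on M U e \<and>
     form_eq M U 2 F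
       (\<lambda>p vs. wedge 1 1 (e 1) (e 2) p vs + wedge 1 1 (e 3) (e 4) p vs + wedge 1 1 (e 5) (e 6) p vs) \<and>
     form_eq M U 3 (complex_form \<Psi>p \<Psi>m)
       (wedge 2 1 (wedge 1 1 (complex_form (e 1) (e 2)) (complex_form (e 3) (e 4)))
                  (complex_form (e 5) (e 6)))"

definition SU3_structure ::
    "('p::topological_space, real^6) chart set \<Rightarrow> ('p, real^6, real) dform \<Rightarrow>
     ('p, real^6, real) dform \<Rightarrow> ('p, real^6, real) dform \<Rightarrow> bool" where
  "SU3_structure M F \<Psi>p \<Psi>m \<longleftrightarrow>
     smooth_form_on M (carrier M) 2 F \<and> smooth_form_on M (carrier M) 3 \<Psi>p \<and>
     smooth_form_on M (carrier M) 3 \<Psi>m \<and>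
     (\<forall>p\<in>carrier M. \<exists>U e. p \<in> U \<and> SU3_coframe M F \<Psi>p \<Psi>m U e)"

type_synonym ('p, 'e) metric = "'p \<Rightarrow> ('p, 'e) tvec \<Rightarrow> ('p, 'e) tvec \<Rightarrow> real"

text \<open>The metric for which the adapted coframes are orthonormal. Any two adapted coframes
  differ at each point by an element of \<open>SU(3) \<subseteq> SO(6)\<close>, so \<open>g\<close> exists, is unique and is smooth.\<close>
definition SU3_metric ::
    "('p::topological_space, real^6) chart set \<Rightarrow> ('p, real^6, real) dform \<Rightarrow>
     ('p, real^6, real) dform \<Rightarrow> ('p, real^6, real) dform \<Rightarrow> ('p, real^6) metric \<Rightarrow> bool" where
  "SU3_metric M F \<Psi>p \<Psi>m g \<longleftrightarrow>
     (\<forall>U e p. SU3_coframe M F \<Psi>p \<Psi>m U e \<and> p \<in> U \<longrightarrow>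
        (\<forall>X\<in>tangent_space M p. \<forall>Y\<in>tangent_space M p.
           g p X Y = (\<Sum>i=1..6. e i p [X] * e i p [Y])))"

definition nearly_Kaehler ::
    "('p::topological_space, real^6) chart set \<Rightarrow> ('p, real^6, real) dform \<Rightarrow>
     ('p, real^6, real) dform \<Rightarrow> ('p, real^6, real) dform \<Rightarrow> bool" where
  "nearly_Kaehler M F \<Psi>p \<Psi>m \<longleftrightarrow>
     SU3_structure M F \<Psi>p \<Psi>m \<and>
     form_eq M (carrier M) 3 (ext_deriv M F) (3 \<odot> \<Psi>p) \<and>
     form_eq M (carrier M) 4 (ext_deriv M \<Psi>m) ((-2) \<odot> wedge 2 2 F F)"


section \<open>SU(2)-structures\<close>

definition SU2_structure ::
    "('q, real^5) chart set \<Rightarrow> ('q, real^5, real) dform \<Rightarrow> ('q, real^5, real) dform \<Rightarrow>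
     ('q, real^5, real) dform \<Rightarrow> ('q, real^5, real) dform \<Rightarrow> bool" where
  "SU2_structure N \<eta> \<omega>1 \<omega>2 \<omega>3 \<longleftrightarrow>
     smooth_form_on N (carrier N) 1 \<eta> \<and>
     (\<forall>\<omega>\<in>{\<omega>1, \<omega>2, \<omega>3}. smooth_form_on N (carrier N) 2 \<omega>) \<and>
     (\<exists>v. smooth_form_on N (carrier N) 4 v \<and>
          (\<forall>i<3. \<forall>j<3. form_eq N (carrier N) 4
             (wedge 2 2 ([\<omega>1, \<omega>2, \<omega>3] ! i) ([\<omega>1, \<omega>2, \<omega>3] ! j))
             ((if i = j then 1 else 0) \<odot> v)) \<and>
          (\<forall>p\<in>carrier N. \<exists>vs. length vs = 5 \<and> set vs \<subseteq> tangent_space N p \<and>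
             wedge 4 1 v \<eta> p vs \<noteq> 0)) \<and>
     (\<forall>p\<in>carrier N. \<forall>X\<in>tangent_space N p. \<forall>Y\<in>tangent_space N p.
        (\<forall>Z\<in>tangent_space N p. \<omega>1 p [X, Z] = \<omega>2 p [Y, Z]) \<longrightarrow> \<omega>3 p [X, Y] \<ge> 0)"


section \<open>Totally geodesic hypersurfaces\<close>

definition local_metric ::
    "('p, 'e::euclidean_space) chart set \<Rightarrow> ('p, 'e) metric \<Rightarrow> ('p, 'e) chart \<Rightarrow>
     'e \<Rightarrow> 'e \<Rightarrow> 'e \<Rightarrow> real" where
  "local_metric M g c x a b =
     g (coord_inv c x) (tvec_of M c (coord_inv c x) a) (tvec_of M c (coord_inv c x) b)"

text \<open>The Christoffel symbols of the Levi-Civita connection, as the vector valued bilinear map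
  \<open>\<Gamma>(a,b)\<close> that is the covariant derivative of the constant field \<open>b\<close> in direction \<open>a\<close>
  (Koszul formula for constant fields).\<close>
definition christoffel ::
    "('e::euclidean_space \<Rightarrow> 'e \<Rightarrow> 'e \<Rightarrow> real) \<Rightarrow> 'e \<Rightarrow> 'e \<Rightarrow> 'e \<Rightarrow> 'e" where
  "christoffel h x a b =
     (THE w. \<forall>z. 2 * h x w z =
        frechet_derivative (\<lambda>y. h y b z) (at x) a + frechet_derivative (\<lambda>y. h y a z) (at x) b
        - frechet_derivative (\<lambda>y. h y a b) (at x) z)"

text \<open>The coordinates in the chart \<open>c'\<close> of \<open>M\<close> of the covariant derivative, in the direction \<open>u\<close>,
  of the vector field along \<open>f\<close> which is the push-forward of the field that is constant equal
  to \<open>w\<close> in the chart \<open>c\<close> of \<open>N\<close>.\<close>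
definition covariant_deriv_push ::
    "('p, 'e::euclidean_space) chart set \<Rightarrow> ('p, 'e) metric \<Rightarrow> ('q \<Rightarrow> 'p) \<Rightarrow>
     ('q, 'd::euclidean_space) chart \<Rightarrow> ('p, 'e) chart \<Rightarrow> 'q \<Rightarrow> 'd \<Rightarrow> 'd \<Rightarrow> 'e" where
  "covariant_deriv_push M g f c c' p u w =
     (let F = snd c' \<circ> f \<circ> coord_inv c; x = snd c p in
      frechet_derivative (\<lambda>y. frechet_derivative F (at y) w) (at x) u +
      christoffel (local_metric M g c') (F x)
        (frechet_derivative F (at x) u) (frechet_derivative F (at x) w))"

definition second_fundamental_form ::
    "('p, 'e::euclidean_space) chart set \<Rightarrow> ('p, 'e) metric \<Rightarrow> ('q \<Rightarrow> 'p) \<Rightarrow>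
     ('q \<Rightarrow> ('p, 'e) tvec) \<Rightarrow> ('q, 'd::euclidean_space) chart \<Rightarrow> ('p, 'e) chart \<Rightarrow>
     'q \<Rightarrow> 'd \<Rightarrow> 'd \<Rightarrow> real" where
  "second_fundamental_form M g f \<nu> c c' p u w =
     g (f p) (tvec_of M c' (f p) (covariant_deriv_push M g f c c' p u w)) (\<nu> p)"

text \<open>An immersed hypersurface with a smooth unit normal vector field \<open>\<nu>\<close>; as \<open>M\<close> is
  oriented whenever it carries an SU(3)-structure, the choice of \<open>\<nu>\<close> is that of an orientation
  of \<open>N\<close>.\<close>
definition oriented_hypersurface ::
    "('q::topological_space, real^5) chart set \<Rightarrow> ('p::topological_space, real^6) chart set \<Rightarrow>
     ('p, real^6) metric \<Rightarrow> ('q \<Rightarrow> 'p) \<Rightarrow> ('q \<Rightarrow> ('p, real^6) tvec) \<Rightarrow> bool" where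
  "oriented_hypersurface N M g f \<nu> \<longleftrightarrow>
     immersion N M f \<and>
     (\<forall>p\<in>carrier N. \<nu> p \<in> tangent_space M (f p)) \<and>
     (\<forall>c\<in>N. \<forall>c'\<in>M. smooth_on (snd c ` (fst c \<inter> f -` fst c')) (\<lambda>x. \<nu> (coord_inv c x) c')) \<and>
     (\<forall>p\<in>carrier N. g (f p) (\<nu> p) (\<nu> p) = 1 \<and>
        (\<forall>X\<in>tangent_space N p. g (f p) (\<nu> p) (pushforward N M f p X) = 0))"

text \<open>Vanishing of the second fundamental form at a point does not depend on the charts.\<close>
definition totally_geodesic ::
    "('q, real^5) chart set \<Rightarrow> ('p, real^6) chart set \<Rightarrow>
     ('p, real^6) metric \<Rightarrow> ('q \<Rightarrow> 'p) \<Rightarrow> ('q \<Rightarrow> ('p, real^6) tvec) \<Rightarrow> bool" where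
  "totally_geodesic N M g f \<nu> \<longleftrightarrow>
     (\<forall>c\<in>N. \<forall>c'\<in>M. \<forall>p\<in>fst c \<inter> f -` fst c'. \<forall>u w.
        second_fundamental_form M g f \<nu> c c' p u w = 0)"

end

theory Submission
  imports Defs
begin

text \<open>Let \<open>\<nabla>\<close> be the Levi-Civita connection of \<open>g\<close> and \<open>\<nu>\<close> the unit normal. The theorem rests on two facts.

  The first is that a nearly Kaehler structure satisfies \<open>\<nabla>\<^sub>X F = X \<rfloor> \<Psi>\<^sub>+\<close> and
  \<open>\<nabla>\<^sub>X \<Psi>\<^sub>- = - 1/2 X \<rfloor> (F \<and> F)\<close>. In an adapted coframe, which identifies every tangent space with
  \<open>\<complex>\<^sup>3\<close>, the connection is a skew endomorphism \<open>K(X)\<close> depending linearly on \<open>X\<close>. The derivatives of \<open>F\<close> and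
  \<open>\<Psi>\<^sub>+ + i \<Psi>\<^sub>-\<close> only see \<open>K(X)\<close> modulo \<open>su(3)\<close>, that is, a vector \<open>q(X)\<close> in \<open>\<complex>\<^sup>3\<close> (the complex antilinear
  part of \<open>K(X)\<close>) and a real number \<open>t(X)\<close> (the trace of the complex linear part): 42 real numbers for the
  six basis vectors \<open>X\<close>. The equations \<open>dF = 3 \<Psi>\<^sub>+\<close> and \<open>d\<Psi>\<^sub>- = - 2 F \<and> F\<close>, together with the consequence
  \<open>d\<Psi>\<^sub>+ = 0\<close> of the former, are linear equations for these numbers with the unique solution
  \<open>q(X) = - i/2 X\<^sup>*\<close> (complex conjugate) and \<open>t = 0\<close>: this is \<open>intrinsic_torsion\<close>, and
  \<open>nearly_Kaehler_covariant_derivatives\<close> draws the conclusion. The step to \<open>d\<Psi>\<^sub>+ = 0\<close> differentiates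
  \<open>dF = 3 \<Psi>\<^sub>+\<close>, so this equation is needed on a neighbourhood in one fixed chart, whereas \<open>ext_deriv\<close> uses
  another chart at every point; \<open>ext_deriv_2_in_chart\<close> bridges the gap.

  The second is that total geodesy makes \<open>\<nu>\<close> parallel along the hypersurface, while the covariant derivative of
  a pushed-forward coordinate field in the direction of another one is symmetric in the two. In a frame this is
  \<open>totally_geodesic_frame_derivatives\<close>. Hence in the alternating sums that compute \<open>d\<eta>\<close> and \<open>d\<omega>\<^sub>2\<close> only
  \<open>\<nabla>F\<close> and \<open>\<nabla>\<Psi>\<^sub>-\<close> survive (\<open>hypersurface_structure_equations\<close>):
  \<open>d\<eta>(X,Y) = - (\<nabla>\<^sub>X F)(\<nu>,Y) + (\<nabla>\<^sub>Y F)(\<nu>,X) = 2 \<Psi>\<^sub>+(\<nu>,X,Y) = - 2 \<omega>\<^sub>3(X,Y)\<close>, and the three terms of \<open>d\<omega>\<^sub>2\<close> add up to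
  \<open>3/2 \<nu> \<rfloor> (F \<and> F) = - 3 \<eta> \<and> \<omega>\<^sub>1\<close>. The remaining equation is easier: exterior derivatives commute with
  pullback, so \<open>d\<omega>\<^sub>1 = 3 f\<^sup>* \<Psi>\<^sub>+\<close>, and \<open>\<Psi>\<^sub>+\<close> restricts to \<open>\<eta> \<and> \<omega>\<^sub>2\<close> on the hyperplane orthogonal to \<open>\<nu>\<close>.

  This last identity and the algebraic conditions of an SU(2)-structure are pointwise. As \<open>SU(3)\<close> acts
  transitively on unit vectors (\<open>SU3_transitive\<close>), they need only be checked for \<open>\<nu> = e\<^sub>6\<close>, where
  \<open>\<eta> = e\<^sup>5\<close>, \<open>\<omega>\<^sub>1 = e\<^sup>1\<^sup>2 + e\<^sup>3\<^sup>4\<close>, \<open>\<omega>\<^sub>2 = e\<^sup>1\<^sup>3 - e\<^sup>2\<^sup>4\<close> and \<open>\<omega>\<^sub>3 = e\<^sup>1\<^sup>4 + e\<^sup>2\<^sup>3\<close>.\<close>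

section \<open>Smooth functions\<close>

lemma has_derivative_frechet:
  "f differentiable (at x) \<Longrightarrow> (f has_derivative frechet_derivative f (at x)) (at x)"
  by (simp add: frechet_derivative_works)

lemma frechet_derivativeI:
  "(f has_derivative D) (at x) \<Longrightarrow> frechet_derivative f (at x) = D"
  by (metis frechet_derivative_at)

lemma frechet_derivative_cong_open:
  assumes "open S" "x \<in> S" "\<And>y. y \<in> S \<Longrightarrow> f y = g y"
  shows "frechet_derivative f (at x) = frechet_derivative g (at x)"
proof -
  have "(f has_derivative D) (at x) \<longleftrightarrow> (g has_derivative D) (at x)" for D
    using assms has_derivative_transform_within_open[of f D x UNIV S g]
      has_derivative_transform_within_open[of g D x UNIV S f] by auto
  then show ?thesis by (simp add: frechet_derivative_def)
qed

lemma differentiable_cong_open: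
  assumes "open S" "x \<in> S" "\<And>y. y \<in> S \<Longrightarrow> f y = g y"
  shows "f differentiable (at x) \<longleftrightarrow> g differentiable (at x)"
proof -
  have "(f has_derivative D) (at x) \<longleftrightarrow> (g has_derivative D) (at x)" for D
    using assms has_derivative_transform_within_open[of f D x UNIV S g]
      has_derivative_transform_within_open[of g D x UNIV S f] by auto
  then show ?thesis by (simp add: differentiable_def)
qed

lemma Ck_on_cong:
  assumes "open S" "\<And>x. x \<in> S \<Longrightarrow> f x = g x"
  shows "Ck_on k S f \<longleftrightarrow> Ck_on k S g"
  using assms(2)
proof (induction k arbitrary: f g)
  case 0
  then show ?case by (simp cong: continuous_on_cong)
next
  case (Suc k)
  have "f differentiable (at x) \<longleftrightarrow> g differentiable (at x)" if "x \<in> S" for x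
    using differentiable_cong_open[OF assms(1) that] Suc.prems by blast
  moreover have "Ck_on k S (\<lambda>x. frechet_derivative f (at x) v) \<longleftrightarrow>
      Ck_on k S (\<lambda>x. frechet_derivative g (at x) v)" for v
    by (rule Suc.IH) (metis frechet_derivative_cong_open[OF assms(1)] Suc.prems)
  ultimately show ?case by simp
qed

lemma Ck_on_subset: "Ck_on k S f \<Longrightarrow> T \<subseteq> S \<Longrightarrow> Ck_on k T f"
  by (induction k arbitrary: f) (auto intro: continuous_on_subset)

lemma Ck_on_imp_continuous: "Ck_on k S f \<Longrightarrow> continuous_on S f"
  by (cases k) (auto simp: continuous_at_imp_continuous_on differentiable_imp_continuous_within)

lemma Ck_on_SucD: "Ck_on (Suc k) S f \<Longrightarrow> Ck_on k S f"
proof (induction k arbitrary: f)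
  case 0
  then show ?case using Ck_on_imp_continuous by (metis Ck_on.simps(1))
next
  case (Suc k)
  then show ?case by (metis Ck_on.simps(2))
qed

lemma Ck_on_local:
  assumes "\<And>x. x \<in> S \<Longrightarrow> \<exists>T. open T \<and> x \<in> T \<and> Ck_on k T f"
  shows "Ck_on k S f"
  using assms
proof (induction k arbitrary: f)
  case 0
  then show ?case
    by (metis Ck_on.simps(1) continuous_at_imp_continuous_on continuous_on_eq_continuous_at)
next
  case (Suc k)
  then show ?case by simp metis
qed

lemma Ck_on_const: "Ck_on k S (\<lambda>x. c)"
  by (induction k arbitrary: c) auto

lemma Ck_on_bounded_linear:
  assumes "bounded_linear L" "open S" "Ck_on k S f"
  shows "Ck_on k S (\<lambda>x. L (f x))"
  using assms(3)
proof (induction k arbitrary: f)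
  case 0
  then show ?case using assms(1) by (simp add: bounded_linear.continuous_on)
next
  case (Suc k)
  have D: "((\<lambda>x. L (f x)) has_derivative (\<lambda>v. L (frechet_derivative f (at x) v))) (at x)"
    if "x \<in> S" for x
    using Suc.prems that by (intro bounded_linear.has_derivative[OF assms(1)] has_derivative_frechet) simp
  have "Ck_on k S (\<lambda>x. frechet_derivative (\<lambda>x. L (f x)) (at x) v)" for v
    using Ck_on_cong[OF assms(2), of "\<lambda>x. frechet_derivative (\<lambda>x. L (f x)) (at x) v"]
      frechet_derivativeI[OF D] Suc.IH Suc.prems by simp
  then show ?case using D unfolding Ck_on.simps differentiable_def by blast
qed

lemma Ck_on_add:
  assumes "open S" "Ck_on k S f" "Ck_on k S g"
  shows "Ck_on k S (\<lambda>x. f x + g x)"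
  using assms(2,3)
proof (induction k arbitrary: f g)
  case 0
  then show ?case by (simp add: continuous_on_add)
next
  case (Suc k)
  have D: "((\<lambda>x. f x + g x) has_derivative
      (\<lambda>v. frechet_derivative f (at x) v + frechet_derivative g (at x) v)) (at x)"
    if "x \<in> S" for x
    using Suc.prems that by (intro has_derivative_add has_derivative_frechet) simp_all
  have "Ck_on k S (\<lambda>x. frechet_derivative (\<lambda>x. f x + g x) (at x) v)" for v
    using Ck_on_cong[OF assms(1), of "\<lambda>x. frechet_derivative (\<lambda>x. f x + g x) (at x) v"]
      frechet_derivativeI[OF D] Suc.IH Suc.prems by simp
  then show ?case using D unfolding Ck_on.simps differentiable_def by blast
qed

lemma (in bounded_bilinear) Ck_on:
  assumes "open S" "Ck_on k S f" "Ck_on k S g"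
  shows "Ck_on k S (\<lambda>x. prod (f x) (g x))"
  using assms(2,3)
proof (induction k arbitrary: f g)
  case 0
  then show ?case by (simp add: continuous_on)
next
  case (Suc k)
  have D: "((\<lambda>x. prod (f x) (g x)) has_derivative
      (\<lambda>v. prod (f x) (frechet_derivative g (at x) v) + prod (frechet_derivative f (at x) v) (g x))) (at x)"
    if "x \<in> S" for x
    using Suc.prems that by (intro FDERIV has_derivative_frechet) simp_all
  have "Ck_on k S (\<lambda>x. frechet_derivative (\<lambda>x. prod (f x) (g x)) (at x) v)" for v
    using Ck_on_cong[OF assms(1), of "\<lambda>x. frechet_derivative (\<lambda>x. prod (f x) (g x)) (at x) v"]
      frechet_derivativeI[OF D] Suc.IH Suc.prems Ck_on_SucD[OF Suc.prems(1)] Ck_on_SucD[OF Suc.prems(2)]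
    by (simp add: Ck_on_add[OF assms(1)])
  then show ?case using D unfolding Ck_on.simps differentiable_def by blast
qed

lemma Ck_on_sum:
  assumes "open S" "\<And>i. i \<in> I \<Longrightarrow> Ck_on k S (f i)"
  shows "Ck_on k S (\<lambda>x. \<Sum>i\<in>I. f i x)"
  using assms(2)
  by (induction I rule: infinite_finite_induct) (simp_all add: Ck_on_const Ck_on_add[OF assms(1)])

lemma linear_Basis_expansion:
  fixes x :: "'a::euclidean_space"
  assumes "linear L"
  shows "L x = (\<Sum>b\<in>Basis. (x \<bullet> b) *\<^sub>R L b)"
proof -
  have "L x = L (\<Sum>b\<in>Basis. (x \<bullet> b) *\<^sub>R b)" by (simp add: euclidean_representation)
  also have "\<dots> = (\<Sum>b\<in>Basis. (x \<bullet> b) *\<^sub>R L b)"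
    by (simp add: linear_sum[OF assms] linear_scale[OF assms])
  finally show ?thesis .
qed

text \<open>The chain rule writes a directional derivative of the composite as a sum, over the standard basis, of products of
  functions to which the induction hypothesis applies.\<close>

lemma Ck_on_compose:
  fixes f :: "'a::euclidean_space \<Rightarrow> 'b::euclidean_space" and g :: "'b \<Rightarrow> 'c::real_normed_vector"
  assumes "open S" "Ck_on k S f" "Ck_on k T g" "f ` S \<subseteq> T"
  shows "Ck_on k S (\<lambda>x. g (f x))"
  using assms(2,3)
proof (induction k arbitrary: g)
  case 0
  then show ?case using assms(4) continuous_on_compose2 by auto
next
  case (Suc k)
  have D: "((\<lambda>x. g (f x)) has_derivative
      (\<lambda>v. frechet_derivative g (at (f x)) (frechet_derivative f (at x) v))) (at x)"
    if "x \<in> S" for x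
    by (rule has_derivative_compose[where g = g]; rule has_derivative_frechet)
      (use Suc.prems that assms(4) in auto)
  have E: "frechet_derivative (\<lambda>x. g (f x)) (at x) v =
      (\<Sum>b\<in>Basis. (frechet_derivative f (at x) v \<bullet> b) *\<^sub>R frechet_derivative g (at (f x)) b)"
    if "x \<in> S" for x v
  proof -
    have "linear (frechet_derivative g (at (f x)))"
      using Suc.prems that assms(4) by (auto intro!: linear_frechet_derivative)
    then show ?thesis
      unfolding frechet_derivativeI[OF D[OF that]] by (rule linear_Basis_expansion)
  qed
  have "Ck_on k S (\<lambda>x. (frechet_derivative f (at x) v \<bullet> b) *\<^sub>R frechet_derivative g (at (f x)) b)" for v b
    using Suc.prems Suc.IH[OF Ck_on_SucD[OF Suc.prems(1)], of "\<lambda>y. frechet_derivative g (at y) b"]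
    by (intro bounded_bilinear.Ck_on[OF bounded_bilinear_scaleR] assms(1)
        Ck_on_bounded_linear[OF bounded_linear_inner_left]) auto
  then have "Ck_on k S (\<lambda>x. \<Sum>b\<in>Basis. (frechet_derivative f (at x) v \<bullet> b) *\<^sub>R frechet_derivative g (at (f x)) b)" for v
    by (rule Ck_on_sum[OF assms(1)])
  then have "Ck_on k S (\<lambda>x. frechet_derivative (\<lambda>x. g (f x)) (at x) v)" for v
    using Ck_on_cong[OF assms(1), of "\<lambda>x. frechet_derivative (\<lambda>x. g (f x)) (at x) v"] E by simp
  then show ?case using D unfolding Ck_on.simps differentiable_def by blast
qed

lemma smooth_on_cong:
  "open S \<Longrightarrow> (\<And>x. x \<in> S \<Longrightarrow> f x = g x) \<Longrightarrow> smooth_on S f \<longleftrightarrow> smooth_on S g"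
  unfolding smooth_on_def using Ck_on_cong by blast

lemma smooth_on_subset: "smooth_on S f \<Longrightarrow> T \<subseteq> S \<Longrightarrow> smooth_on T f"
  unfolding smooth_on_def using Ck_on_subset by blast

lemma smooth_on_local:
  assumes "\<And>x. x \<in> S \<Longrightarrow> \<exists>T. open T \<and> x \<in> T \<and> smooth_on T f"
  shows "smooth_on S f"
  unfolding smooth_on_def using assms[unfolded smooth_on_def] by (intro allI Ck_on_local) blast

lemma smooth_on_add:
  "open S \<Longrightarrow> smooth_on S f \<Longrightarrow> smooth_on S g \<Longrightarrow> smooth_on S (\<lambda>x. f x + g x)"
  by (simp add: smooth_on_def Ck_on_add)

lemma smooth_on_mult:
  fixes f g :: "'a::euclidean_space \<Rightarrow> real"
  shows "open S \<Longrightarrow> smooth_on S f \<Longrightarrow> smooth_on S g \<Longrightarrow> smooth_on S (\<lambda>x. f x * g x)"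
  by (simp add: smooth_on_def bounded_bilinear.Ck_on[OF bounded_bilinear_mult])

lemma smooth_on_bounded_linear:
  "bounded_linear L \<Longrightarrow> open S \<Longrightarrow> smooth_on S f \<Longrightarrow> smooth_on S (\<lambda>x. L (f x))"
  by (simp add: smooth_on_def Ck_on_bounded_linear)

lemma smooth_on_minus: "open S \<Longrightarrow> smooth_on S f \<Longrightarrow> smooth_on S (\<lambda>x. - f x)"
  by (rule smooth_on_bounded_linear[OF bounded_linear_minus[OF bounded_linear_ident]])

lemma smooth_on_diff:
  "open S \<Longrightarrow> smooth_on S f \<Longrightarrow> smooth_on S g \<Longrightarrow> smooth_on S (\<lambda>x. f x - g x)"
  using smooth_on_add[of S f "\<lambda>x. - g x"] smooth_on_minus[of S g] by simp

lemma smooth_on_sum: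
  "open S \<Longrightarrow> (\<And>i. i \<in> I \<Longrightarrow> smooth_on S (f i)) \<Longrightarrow> smooth_on S (\<lambda>x. \<Sum>i\<in>I. f i x)"
  by (simp add: smooth_on_def Ck_on_sum)

lemma smooth_on_compose:
  fixes f :: "'a::euclidean_space \<Rightarrow> 'b::euclidean_space"
  shows "open S \<Longrightarrow> smooth_on S f \<Longrightarrow> smooth_on T g \<Longrightarrow> f ` S \<subseteq> T \<Longrightarrow> smooth_on S (\<lambda>x. g (f x))"
  unfolding smooth_on_def by (metis Ck_on_compose)

lemma smooth_on_differentiable: "smooth_on S f \<Longrightarrow> x \<in> S \<Longrightarrow> f differentiable (at x)"
  by (metis Ck_on.simps(2) smooth_on_def)

lemma smooth_on_deriv: "smooth_on S f \<Longrightarrow> smooth_on S (\<lambda>x. frechet_derivative f (at x) v)"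
  by (metis Ck_on.simps(2) smooth_on_def)

lemma smooth_on_continuous_on: "smooth_on S f \<Longrightarrow> continuous_on S f"
  by (metis Ck_on.simps(1) smooth_on_def)

lemma smooth_on_has_derivative:
  "smooth_on S f \<Longrightarrow> x \<in> S \<Longrightarrow> (f has_derivative frechet_derivative f (at x)) (at x)"
  by (simp add: has_derivative_frechet smooth_on_differentiable)

lemma smooth_on_scaleR:
  "open S \<Longrightarrow> smooth_on S f \<Longrightarrow> smooth_on S g \<Longrightarrow> smooth_on S (\<lambda>x. f x *\<^sub>R g x)"
  by (simp add: smooth_on_def bounded_bilinear.Ck_on[OF bounded_bilinear_scaleR])

text \<open>The frame components of the normal and of the tangent vectors of a hypersurface have this shape.\<close>

lemma smooth_on_linear_field:
  fixes \<theta> :: "'b::euclidean_space \<Rightarrow> 'e::euclidean_space \<Rightarrow> 'c::real_normed_vector"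
    and \<phi> :: "'d::euclidean_space \<Rightarrow> 'b"
  assumes "open W" "smooth_on W \<phi>" "\<phi> ` W \<subseteq> V" "smooth_on W n"
    and "\<And>y. y \<in> V \<Longrightarrow> linear (\<theta> y)" "\<And>a. smooth_on V (\<lambda>y. \<theta> y a)"
  shows "smooth_on W (\<lambda>y. \<theta> (\<phi> y) (n y))"
proof -
  have "smooth_on W (\<lambda>y. \<Sum>b\<in>Basis. (n y \<bullet> b) *\<^sub>R \<theta> (\<phi> y) b)"
    by (intro smooth_on_sum smooth_on_scaleR assms(1) smooth_on_bounded_linear[OF bounded_linear_inner_left]
        assms(4) smooth_on_compose[OF assms(1,2) assms(6) assms(3)])
  moreover have "(\<Sum>b\<in>Basis. (n y \<bullet> b) *\<^sub>R \<theta> (\<phi> y) b) = \<theta> (\<phi> y) (n y)" if "y \<in> W" for y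
    by (rule linear_Basis_expansion[symmetric], rule assms(5)) (use assms(3) that in blast)
  ultimately show ?thesis
    using smooth_on_cong[OF assms(1), of "\<lambda>y. \<theta> (\<phi> y) (n y)" "\<lambda>y. \<Sum>b\<in>Basis. (n y \<bullet> b) *\<^sub>R \<theta> (\<phi> y) b"] by simp
qed

section \<open>Symmetry of second derivatives\<close>

text \<open>The mean value theorem is applied twice: to the difference in the direction \<open>v\<close> as a function of the step along \<open>u\<close>,
  and to the resulting difference of derivatives along \<open>u\<close>. The quotient is symmetric in \<open>u\<close> and \<open>v\<close>, which is the
  reason why second derivatives are symmetric.\<close>

lemma second_difference_quotient:
  fixes f :: "'a::euclidean_space \<Rightarrow> real"
  assumes "open S" "smooth_on S f" "x \<in> S" "e > 0"
  shows "\<forall>\<^sub>F t in at_right 0. \<bar>(f (x + t *\<^sub>R u + t *\<^sub>R v) - f (x + t *\<^sub>R u) - f (x + t *\<^sub>R v) + f x) / t\<^sup>2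
     - frechet_derivative (\<lambda>y. frechet_derivative f (at y) u) (at x) v\<bar> < e"
proof -
  define fu where "fu y = frechet_derivative f (at y) u" for y
  define fuv where "fuv y = frechet_derivative fu (at y) v" for y
  have sfu: "smooth_on S fu" unfolding fu_def by (rule smooth_on_deriv[OF assms(2)])
  have sfuv: "smooth_on S fuv" unfolding fuv_def by (rule smooth_on_deriv[OF sfu])
  \<comment> \<open>The step size has to keep all points in \<open>S\<close> (\<open>d1\<close>) and the mixed derivative close to its value at \<open>x\<close> (\<open>d2\<close>).\<close>
  obtain d1 where d1: "d1 > 0" "ball x d1 \<subseteq> S" using assms open_contains_ball by blast
  have "isCont fuv x" using smooth_on_continuous_on[OF sfuv] assms(1,3) continuous_on_eq_continuous_at by blast
  then obtain d2 where d2: "d2 > 0" "\<And>y. dist y x < d2 \<Longrightarrow> \<bar>fuv y - fuv x\<bar> < e"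
    unfolding continuous_at_eps_delta using assms(4) by (metis dist_real_def)
  define d where "d = min d1 d2"
  define r where "r = d / (1 + norm u + norm v)"
  have pos: "1 + norm u + norm v > 0" using norm_ge_zero[of u] norm_ge_zero[of v] by linarith
  have r: "r > 0" using d1 d2 pos by (simp add: r_def d_def)
  have near: "dist (x + a *\<^sub>R u + b *\<^sub>R v) x < d" if "0 \<le> a" "a < r" "0 \<le> b" "b < r" for a b
  proof -
    have "dist (x + a *\<^sub>R u + b *\<^sub>R v) x = norm (a *\<^sub>R u + b *\<^sub>R v)"
      by (simp add: dist_norm algebra_simps)
    also have "\<dots> \<le> a * norm u + b * norm v"
      using norm_triangle_ineq[of "a *\<^sub>R u" "b *\<^sub>R v"] that by simp
    also have "\<dots> \<le> r * norm u + r * norm v"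
      using that by (intro add_mono mult_right_mono) auto
    also have "\<dots> < r * (1 + norm u + norm v)" using r by (simp add: algebra_simps)
    also have "\<dots> = d" using pos by (simp add: r_def)
    finally show ?thesis .
  qed
  have inS: "x + a *\<^sub>R u + b *\<^sub>R v \<in> S" if "0 \<le> a" "a < r" "0 \<le> b" "b < r" for a b
    using near[OF that] d1(2) by (auto simp: d_def dist_commute)
  have key: "\<bar>(f (x + t *\<^sub>R u + t *\<^sub>R v) - f (x + t *\<^sub>R u) - f (x + t *\<^sub>R v) + f x) / t\<^sup>2 - fuv x\<bar> < e"
    if t: "0 < t" "t < r" for t
  proof -
    define \<psi> where "\<psi> s = f (x + s *\<^sub>R u + t *\<^sub>R v) - f (x + s *\<^sub>R u)" for s
    have d\<psi>: "(\<psi> has_field_derivative (fu (x + s *\<^sub>R u + t *\<^sub>R v) - fu (x + s *\<^sub>R u))) (at s)"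
      if "0 \<le> s" "s \<le> t" for s
    proof -
      have a: "((\<lambda>s. f (x + s *\<^sub>R u + b *\<^sub>R v)) has_derivative
          (\<lambda>h. frechet_derivative f (at (x + s *\<^sub>R u + b *\<^sub>R v)) (h *\<^sub>R u))) (at s)"
        if b: "0 \<le> b" "b < r" for b
        by (rule has_derivative_compose[where g=f], (auto intro!: derivative_eq_intros)[1])
           (rule smooth_on_has_derivative[OF assms(2)], rule inS, use b t \<open>0 \<le> s\<close> \<open>s \<le> t\<close> in auto)
      have l: "linear (frechet_derivative f (at (x + s *\<^sub>R u + b *\<^sub>R v)))" if b: "0 \<le> b" "b < r" for b
        by (rule linear_frechet_derivative, rule smooth_on_differentiable[OF assms(2)], rule inS,
          use b t \<open>0 \<le> s\<close> \<open>s \<le> t\<close> in auto)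
      have "(*) (fu (x + s *\<^sub>R u + t *\<^sub>R v) - fu (x + s *\<^sub>R u)) =
          (\<lambda>h. h * fu (x + s *\<^sub>R u + t *\<^sub>R v) - h * fu (x + s *\<^sub>R u))"
        by (simp add: fun_eq_iff algebra_simps)
      then show ?thesis
        using has_derivative_diff[OF a[of t] a[of 0]] t l[of t] l[of 0]
        unfolding \<psi>_def has_field_derivative_def fu_def by (simp add: linear_scale)
    qed
    obtain s where s: "0 < s" "s < t" "\<psi> t - \<psi> 0 = t * (fu (x + s *\<^sub>R u + t *\<^sub>R v) - fu (x + s *\<^sub>R u))"
      using MVT2[OF t(1) d\<psi>] by auto
    have d2': "((\<lambda>b. fu (x + s *\<^sub>R u + b *\<^sub>R v)) has_field_derivative fuv (x + s *\<^sub>R u + b *\<^sub>R v)) (at b)"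
      if "0 \<le> b" "b \<le> t" for b
    proof -
      have m: "x + s *\<^sub>R u + b *\<^sub>R v \<in> S" by (rule inS) (use s t that in auto)
      have a: "((\<lambda>b. fu (x + s *\<^sub>R u + b *\<^sub>R v)) has_derivative
          (\<lambda>h. frechet_derivative fu (at (x + s *\<^sub>R u + b *\<^sub>R v)) (h *\<^sub>R v))) (at b)"
        by (rule has_derivative_compose[where g=fu], (auto intro!: derivative_eq_intros)[1])
           (rule smooth_on_has_derivative[OF sfu m])
      have l: "linear (frechet_derivative fu (at (x + s *\<^sub>R u + b *\<^sub>R v)))"
        by (rule linear_frechet_derivative, rule smooth_on_differentiable[OF sfu m])
      have "(*) (fuv (x + s *\<^sub>R u + b *\<^sub>R v)) = (\<lambda>h. h * fuv (x + s *\<^sub>R u + b *\<^sub>R v))"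
        by (simp add: fun_eq_iff)
      then show ?thesis using a l unfolding has_field_derivative_def fuv_def by (simp add: linear_scale)
    qed
    obtain b where b: "0 < b" "b < t" "fu (x + s *\<^sub>R u + t *\<^sub>R v) - fu (x + s *\<^sub>R u) = t * fuv (x + s *\<^sub>R u + b *\<^sub>R v)"
      using MVT2[OF t(1) d2'] by auto
    have "f (x + t *\<^sub>R u + t *\<^sub>R v) - f (x + t *\<^sub>R u) - f (x + t *\<^sub>R v) + f x = \<psi> t - \<psi> 0"
      by (simp add: \<psi>_def)
    also have "\<dots> / t\<^sup>2 = fuv (x + s *\<^sub>R u + b *\<^sub>R v)"
      using s(3) b(3) t(1) by (simp add: power2_eq_square)
    finally show ?thesis
      using d2(2)[of "x + s *\<^sub>R u + b *\<^sub>R v"] near[of s b] s b t by (simp add: d_def)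
  qed
  have "\<forall>\<^sub>F t in at_right 0. t \<in> {0<..<r}" using r by (rule eventually_at_right_real)
  then show ?thesis
    unfolding fuv_def[symmetric] fu_def[symmetric]
    by (rule eventually_mono) (use key in auto)
qed

lemma second_derivative_symmetric_real:
  fixes f :: "'a::euclidean_space \<Rightarrow> real"
  assumes "open S" "smooth_on S f" "x \<in> S"
  shows "frechet_derivative (\<lambda>y. frechet_derivative f (at y) u) (at x) v =
         frechet_derivative (\<lambda>y. frechet_derivative f (at y) v) (at x) u" (is "?a = ?b")
proof (rule ccontr)
  assume "?a \<noteq> ?b"
  then have e: "\<bar>?a - ?b\<bar> / 2 > 0" by simp
  have "\<forall>\<^sub>F t :: real in at_right 0. False"
    using second_difference_quotient[OF assms e, of u v] second_difference_quotient[OF assms e, of v u]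
  proof eventually_elim
    case (elim t)
    have c: "f (x + t *\<^sub>R v + t *\<^sub>R u) - f (x + t *\<^sub>R v) - f (x + t *\<^sub>R u) + f x =
      f (x + t *\<^sub>R u + t *\<^sub>R v) - f (x + t *\<^sub>R u) - f (x + t *\<^sub>R v) + f x"
      by (simp add: algebra_simps)
    show ?case using elim unfolding c by argo
  qed
  then show False by simp
qed

lemma second_derivative_symmetric:
  fixes f :: "'a::euclidean_space \<Rightarrow> 'b::euclidean_space"
  assumes "open S" "smooth_on S f" "x \<in> S"
  shows "frechet_derivative (\<lambda>y. frechet_derivative f (at y) u) (at x) v =
         frechet_derivative (\<lambda>y. frechet_derivative f (at y) v) (at x) u"
proof (rule euclidean_eqI)
  fix b :: 'b assume "b \<in> Basis"
  have s: "smooth_on S (\<lambda>y. f y \<bullet> b)"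
    by (rule smooth_on_bounded_linear[OF bounded_linear_inner_left assms(1,2)])
  have comp: "frechet_derivative (\<lambda>y. g y \<bullet> b) (at y) w = frechet_derivative g (at y) w \<bullet> b"
    if "smooth_on S g" "y \<in> S" for g :: "'a \<Rightarrow> 'b" and y w
    using frechet_derivativeI[OF bounded_linear.has_derivative[OF bounded_linear_inner_left
        smooth_on_has_derivative[OF that]]] by metis
  have two: "frechet_derivative (\<lambda>y. frechet_derivative (\<lambda>y. f y \<bullet> b) (at y) u) (at x) v =
      frechet_derivative (\<lambda>y. frechet_derivative f (at y) u) (at x) v \<bullet> b" for u v
  proof -
    have "frechet_derivative (\<lambda>y. frechet_derivative (\<lambda>y. f y \<bullet> b) (at y) u) (at x) =
        frechet_derivative (\<lambda>y. frechet_derivative f (at y) u \<bullet> b) (at x)"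
      by (rule frechet_derivative_cong_open[OF assms(1,3)]) (rule comp[OF assms(2)])
    then show ?thesis using comp[OF smooth_on_deriv[OF assms(2)] assms(3)] by simp
  qed
  show "frechet_derivative (\<lambda>y. frechet_derivative f (at y) u) (at x) v \<bullet> b =
      frechet_derivative (\<lambda>y. frechet_derivative f (at y) v) (at x) u \<bullet> b"
    using second_derivative_symmetric_real[OF assms(1) s assms(3), of u v] by (simp add: two)
qed

section \<open>Exterior derivatives in coordinates\<close>

lemma local_ext_deriv_1:
  "local_ext_deriv a x [u, v] =
     frechet_derivative (\<lambda>y. a y [v]) (at x) u - frechet_derivative (\<lambda>y. a y [u]) (at x) v"
  by (simp add: local_ext_deriv_def numeral_2_eq_2)

lemma local_ext_deriv_2:
  "local_ext_deriv a x [u, v, w] =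
     frechet_derivative (\<lambda>y. a y [v, w]) (at x) u - frechet_derivative (\<lambda>y. a y [u, w]) (at x) v
     + frechet_derivative (\<lambda>y. a y [u, v]) (at x) w"
  by (simp add: local_ext_deriv_def numeral_3_eq_3 numeral_2_eq_2)

lemma local_ext_deriv_3:
  "local_ext_deriv a x [u, v, w, z] =
     frechet_derivative (\<lambda>y. a y [v, w, z]) (at x) u - frechet_derivative (\<lambda>y. a y [u, w, z]) (at x) v
     + frechet_derivative (\<lambda>y. a y [u, v, z]) (at x) w - frechet_derivative (\<lambda>y. a y [u, v, w]) (at x) z"
  by (simp add: local_ext_deriv_def numeral_3_eq_3 numeral_2_eq_2)

lemma length_Suc0_conv: "length xs = Suc 0 \<longleftrightarrow> (\<exists>x. xs = [x])"
  by (cases xs) auto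

lemma length_2_conv: "length xs = 2 \<longleftrightarrow> (\<exists>x y. xs = [x, y])"
  by (simp add: numeral_2_eq_2 length_Suc_conv, blast)

lemma length_3_conv: "length xs = 3 \<longleftrightarrow> (\<exists>x y z. xs = [x, y, z])"
  by (simp add: numeral_3_eq_3 length_Suc_conv, blast)

lemma length_4_conv: "length xs = 4 \<longleftrightarrow> (\<exists>x y z w. xs = [x, y, z, w])"
  by (simp add: eval_nat_numeral length_Suc_conv, blast)

lemma alternating_multilinear_1_iff:
  "alternating_multilinear 1 a \<longleftrightarrow> linear (\<lambda>w. a [w])"
  by (auto simp: alternating_multilinear_def length_Suc0_conv)

lemma alternating_multilinear_linear:
  assumes "alternating_multilinear k a" "length xs + length ys + 1 = k"
  shows "linear (\<lambda>w. a (xs @ w # ys))"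
proof -
  have "length (xs @ 0 # ys) = k \<and> length xs < k" using assms(2) by simp
  then have "linear (\<lambda>w. a ((xs @ 0 # ys)[length xs := w]))"
    using assms(1) unfolding alternating_multilinear_def by blast
  then show ?thesis by simp
qed

lemma alternating_multilinear_2_linear:
  assumes "alternating_multilinear 2 a"
  shows "linear (\<lambda>v. a [v, w])" "linear (\<lambda>v. a [w, v])"
  using alternating_multilinear_linear[OF assms, of "[]" "[w]"]
    alternating_multilinear_linear[OF assms, of "[w]" "[]"] by simp_all

lemma alternating_multilinear_2_swap:
  assumes "alternating_multilinear 2 a"
  shows "a [v, w] = - a [w, v]"
proof -
  have "a [x, x] = 0" for x
  proof -
    have "length [x, x] = 2 \<and> (0::nat) < 1 \<and> (1::nat) < 2 \<and> [x, x] ! 0 = [x, x] ! 1" by simp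
    then show ?thesis using assms unfolding alternating_multilinear_def by blast
  qed
  from this[of "v + w"] this[of v] this[of w] show ?thesis
    by (simp add: linear_add[OF alternating_multilinear_2_linear(1)[OF assms]]
        linear_add[OF alternating_multilinear_2_linear(2)[OF assms]])
qed

lemma alternating_multilinear_2I:
  assumes "\<And>w. linear (\<lambda>v. a [v, w])" "\<And>v. linear (\<lambda>w. a [v, w])" "\<And>v. a [v, v] = 0"
  shows "alternating_multilinear 2 a"
  unfolding alternating_multilinear_def
proof (intro conjI allI impI)
  fix us :: "'a list" and i :: nat
  assume us: "length us = 2 \<and> i < 2"
  then obtain x y where xy: "us = [x, y]" unfolding length_2_conv by blast
  have "i = 0 \<or> i = 1" using us by auto
  then show "linear (\<lambda>w. a (us[i := w]))" using assms(1,2) xy by auto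
next
  fix us :: "'a list" and i j :: nat
  assume us: "length us = 2 \<and> i < j \<and> j < 2 \<and> us ! i = us ! j"
  then obtain x y where xy: "us = [x, y]" unfolding length_2_conv by blast
  have i: "i = 0" and j: "j = 1" using us by auto
  have "x = y" using us unfolding i j xy by simp
  then show "a us = 0" using assms(3) xy by simp
qed

text \<open>A Leibniz rule in which only the derivatives of the field at fixed arguments are known. Expanding the
  argument in a basis reduces it to the rule for products.\<close>

lemma has_derivative_linear_form_field:
  fixes L :: "'b::euclidean_space \<Rightarrow> 'e::euclidean_space \<Rightarrow> 'c::real_normed_vector"
    and \<phi> :: "'d::euclidean_space \<Rightarrow> 'b"
  assumes T: "open T" "\<phi> x \<in> T" and lin: "\<And>y. y \<in> T \<Longrightarrow> linear (L y)"
    and DL: "\<And>a. ((\<lambda>y. L y a) has_derivative DL a) (at (\<phi> x))"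
    and D\<phi>: "(\<phi> has_derivative \<phi>') (at x)" and DV: "(V has_derivative V') (at x)"
  shows "((\<lambda>y. L (\<phi> y) (V y)) has_derivative (\<lambda>u. DL (V x) (\<phi>' u) + L (\<phi> x) (V' u))) (at x)"
proof -
  have DL_exp: "DL a = (\<lambda>u. \<Sum>b\<in>Basis. (a \<bullet> b) *\<^sub>R DL b u)" for a
  proof -
    have "((\<lambda>y. \<Sum>b\<in>Basis. (a \<bullet> b) *\<^sub>R L y b) has_derivative (\<lambda>u. \<Sum>b\<in>Basis. (a \<bullet> b) *\<^sub>R DL b u)) (at (\<phi> x))"
      by (intro has_derivative_sum has_derivative_scaleR_right DL)
    then have "((\<lambda>y. L y a) has_derivative (\<lambda>u. \<Sum>b\<in>Basis. (a \<bullet> b) *\<^sub>R DL b u)) (at (\<phi> x))"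
      by (rule has_derivative_transform_within_open[OF _ T])
         (metis lin linear_Basis_expansion)
    then show ?thesis using DL has_derivative_unique by blast
  qed
  have C: "((\<lambda>y. L (\<phi> y) b) has_derivative (\<lambda>u. DL b (\<phi>' u))) (at x)" for b
    by (rule has_derivative_compose[OF D\<phi> DL])
  have "((\<lambda>y. \<Sum>b\<in>Basis. (V y \<bullet> b) *\<^sub>R L (\<phi> y) b) has_derivative
      (\<lambda>u. \<Sum>b\<in>Basis. (V x \<bullet> b) *\<^sub>R DL b (\<phi>' u) + (V' u \<bullet> b) *\<^sub>R L (\<phi> x) b)) (at x)"
    by (intro has_derivative_sum has_derivative_scaleR C
        bounded_linear.has_derivative[OF bounded_linear_inner_left DV])
  moreover have "(\<lambda>u. \<Sum>b\<in>Basis. (V x \<bullet> b) *\<^sub>R DL b (\<phi>' u) + (V' u \<bullet> b) *\<^sub>R L (\<phi> x) b) =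
      (\<lambda>u. DL (V x) (\<phi>' u) + L (\<phi> x) (V' u))"
  proof
    fix u
    have "DL (V x) (\<phi>' u) = (\<Sum>b\<in>Basis. (V x \<bullet> b) *\<^sub>R DL b (\<phi>' u))" by (subst DL_exp) (rule refl)
    moreover have "L (\<phi> x) (V' u) = (\<Sum>b\<in>Basis. (V' u \<bullet> b) *\<^sub>R L (\<phi> x) b)"
      by (subst linear_Basis_expansion[OF lin[OF T(2)]]) simp
    ultimately show "(\<Sum>b\<in>Basis. (V x \<bullet> b) *\<^sub>R DL b (\<phi>' u) + (V' u \<bullet> b) *\<^sub>R L (\<phi> x) b) =
        DL (V x) (\<phi>' u) + L (\<phi> x) (V' u)"
      by (simp only: sum.distrib)
  qed
  ultimately have D: "((\<lambda>y. \<Sum>b\<in>Basis. (V y \<bullet> b) *\<^sub>R L (\<phi> y) b) has_derivative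
      (\<lambda>u. DL (V x) (\<phi>' u) + L (\<phi> x) (V' u))) (at x)"
    by simp
  obtain U where U: "open U" "x \<in> U" "\<And>y. y \<in> U \<Longrightarrow> \<phi> y \<in> T"
    using has_derivative_continuous[OF D\<phi>] T by (metis continuous_at_open)
  have "(\<Sum>b\<in>Basis. (V y \<bullet> b) *\<^sub>R L (\<phi> y) b) = L (\<phi> y) (V y)" if "y \<in> U" for y
    by (subst (2) linear_Basis_expansion[OF lin[OF U(3)[OF that]]]) simp
  then show ?thesis by (rule has_derivative_transform_within_open[OF D U(1,2)])
qed

lemma has_derivative_bilinear_form_field:
  fixes A :: "'b::euclidean_space \<Rightarrow> 'e::euclidean_space \<Rightarrow> 'e \<Rightarrow> real"
    and \<phi> :: "'d::euclidean_space \<Rightarrow> 'b"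
  assumes T: "open T" "\<phi> x \<in> T"
    and lin: "\<And>y w. y \<in> T \<Longrightarrow> linear (\<lambda>v. A y v w)" "\<And>y v. y \<in> T \<Longrightarrow> linear (A y v)"
    and DA: "\<And>a b. ((\<lambda>y. A y a b) has_derivative DA a b) (at (\<phi> x))"
    and D\<phi>: "(\<phi> has_derivative \<phi>') (at x)" and DV: "(V has_derivative V') (at x)"
    and DW: "(W has_derivative W') (at x)"
  shows "((\<lambda>y. A (\<phi> y) (V y) (W y)) has_derivative
    (\<lambda>u. DA (V x) (W x) (\<phi>' u) + A (\<phi> x) (V' u) (W x) + A (\<phi> x) (V x) (W' u))) (at x)"
proof -
  obtain U where U: "open U" "x \<in> U" "\<And>y. y \<in> U \<Longrightarrow> \<phi> y \<in> T"
    using has_derivative_continuous[OF D\<phi>] T by (metis continuous_at_open)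
  have 1: "((\<lambda>y. A (\<phi> y) (V y) w) has_derivative (\<lambda>u. DA (V x) w (\<phi>' u) + A (\<phi> x) (V' u) w)) (at x)" for w
    by (rule has_derivative_linear_form_field[where L = "\<lambda>y v. A y v w" and DL = "\<lambda>v. DA v w" and T = T])
      (use T lin(1) DA D\<phi> DV in auto)
  have "((\<lambda>y. A (\<phi> ((\<lambda>y. y) y)) (V ((\<lambda>y. y) y)) (W y)) has_derivative
      (\<lambda>u. (\<lambda>w u. DA (V x) w (\<phi>' u) + A (\<phi> x) (V' u) w) (W x) ((\<lambda>u. u) u) + A (\<phi> ((\<lambda>y. y) x)) (V ((\<lambda>y. y) x)) (W' u))) (at x)"
    by (rule has_derivative_linear_form_field[where L = "\<lambda>y w. A (\<phi> y) (V y) w" and \<phi> = "\<lambda>y. y" and T = U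
        and DL = "\<lambda>w u. DA (V x) w (\<phi>' u) + A (\<phi> x) (V' u) w" and \<phi>' = "\<lambda>u. u"])
      (use U lin(2) 1 DW in auto)
  then show ?thesis .
qed

text \<open>Exterior derivatives commute with pullback. The terms with a second derivative of \<open>\<phi>\<close> cancel, because that
  derivative is symmetric while the form is alternating.\<close>

lemma local_ext_deriv_pullback_2:
  fixes A :: "'b::euclidean_space \<Rightarrow> 'b list \<Rightarrow> real" and \<phi> :: "'d::euclidean_space \<Rightarrow> 'b"
  assumes T: "open T" and S: "open S" and \<phi>: "smooth_on S \<phi>" "\<phi> ` S \<subseteq> T"
    and alt: "\<And>y. y \<in> T \<Longrightarrow> alternating_multilinear 2 (A y)"
    and sm: "\<And>a b. smooth_on T (\<lambda>y. A y [a, b])"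
    and B: "\<And>y a b. y \<in> S \<Longrightarrow>
      B y [a, b] = A (\<phi> y) [frechet_derivative \<phi> (at y) a, frechet_derivative \<phi> (at y) b]"
    and x: "x \<in> S"
  shows "local_ext_deriv B x [u, v, w] =
    local_ext_deriv A (\<phi> x) (map (frechet_derivative \<phi> (at x)) [u, v, w])"
proof -
  define D where "D = frechet_derivative \<phi> (at x)"
  define H where "H a = frechet_derivative (\<lambda>y. frechet_derivative \<phi> (at y) a) (at x)" for a
  have Tx: "\<phi> x \<in> T" using \<phi>(2) x by blast
  have H_sym: "H a b = H b a" for a b
    unfolding H_def by (rule second_derivative_symmetric[OF S \<phi>(1) x])
  have D\<phi>: "(\<phi> has_derivative D) (at x)"
    unfolding D_def by (rule smooth_on_has_derivative[OF \<phi>(1) x])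
  have DH: "((\<lambda>y. frechet_derivative \<phi> (at y) a) has_derivative H a) (at x)" for a
    unfolding H_def by (rule smooth_on_has_derivative[OF smooth_on_deriv[OF \<phi>(1)] x])
  have DB: "frechet_derivative (\<lambda>y. B y [a, b]) (at x) c =
      frechet_derivative (\<lambda>y. A y [D a, D b]) (at (\<phi> x)) (D c) + A (\<phi> x) [H a c, D b] + A (\<phi> x) [D a, H b c]"
    for a b c
  proof -
    have "((\<lambda>y. A (\<phi> y) [frechet_derivative \<phi> (at y) a, frechet_derivative \<phi> (at y) b]) has_derivative
      (\<lambda>c. frechet_derivative (\<lambda>y. A y [D a, D b]) (at (\<phi> x)) (D c) + A (\<phi> x) [H a c, D b] + A (\<phi> x) [D a, H b c])) (at x)"
      using has_derivative_bilinear_form_field[where A = "\<lambda>y a b. A y [a, b]", OF T Tx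
          alternating_multilinear_2_linear[OF alt] smooth_on_has_derivative[OF sm Tx] D\<phi> DH DH]
      by (simp add: D_def)
    then have "((\<lambda>y. B y [a, b]) has_derivative
      (\<lambda>c. frechet_derivative (\<lambda>y. A y [D a, D b]) (at (\<phi> x)) (D c) + A (\<phi> x) [H a c, D b] + A (\<phi> x) [D a, H b c])) (at x)"
      by (rule has_derivative_transform_within_open[OF _ S x]) (simp add: B)
    from frechet_derivativeI[OF this] show ?thesis by simp
  qed
  have sw: "A (\<phi> x) [a, b] = - A (\<phi> x) [b, a]" for a b
    by (rule alternating_multilinear_2_swap[OF alt[OF Tx]])
  show ?thesis
    unfolding local_ext_deriv_2 DB list.map D_def[symmetric]
    using sw[of "D v" "H w u"] sw[of "D u" "H v w"] sw[of "D u" "H w v"] sw[of "H w u" "D v"]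
      H_sym[of v u] H_sym[of w u] H_sym[of w v] by simp
qed

text \<open>\<open>d \<circ> d = 0\<close> on 2-forms, again by the symmetry of second derivatives.\<close>

lemma local_ext_deriv_local_ext_deriv_2:
  fixes A :: "'e::euclidean_space \<Rightarrow> 'e list \<Rightarrow> real"
  assumes "open V" "x \<in> V" and sm: "\<And>a b. smooth_on V (\<lambda>y. A y [a, b])"
  shows "local_ext_deriv (\<lambda>y. local_ext_deriv A y) x [u, v, w, z] = 0"
proof -
  define H where "H a b c d = frechet_derivative (\<lambda>y. frechet_derivative (\<lambda>y. A y [a, b]) (at y) c) (at x) d" for a b c d
  have sym: "H a b c d = H a b d c" for a b c d
    unfolding H_def by (rule second_derivative_symmetric[OF assms(1) sm assms(2)])
  have D: "((\<lambda>y. frechet_derivative (\<lambda>y. A y [a, b]) (at y) c) has_derivative H a b c) (at x)" for a b c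
    unfolding H_def by (rule smooth_on_has_derivative[OF smooth_on_deriv[OF sm] assms(2)])
  have "((\<lambda>y. local_ext_deriv A y [a, b, c]) has_derivative (\<lambda>d. H b c a d - H a c b d + H a b c d)) (at x)" for a b c
    unfolding local_ext_deriv_2 by (intro has_derivative_add has_derivative_diff D)
  note E = frechet_derivativeI[OF this]
  show ?thesis
    unfolding local_ext_deriv_3 E
    using sym[of w z v u] sym[of v z w u] sym[of v w z u] sym[of u z w v] sym[of u w z v] sym[of u v z w]
    by simp
qed

section \<open>Charts and tangent vectors\<close>

lemma chart_at_in:
  assumes "p \<in> carrier M"
  shows "chart_at M p \<in> M" "p \<in> fst (chart_at M p)"
proof -
  have "\<exists>c. c \<in> M \<and> p \<in> fst c" using assms by (auto simp: carrier_def)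
  from someI_ex[OF this] show "chart_at M p \<in> M" "p \<in> fst (chart_at M p)"
    by (auto simp: chart_at_def)
qed

context
  fixes M :: "('p::{t2_space, second_countable_topology}, 'e::euclidean_space) chart set"
  assumes M: "smooth_manifold M"
begin

lemma chart_homeomorphism:
  "c \<in> M \<Longrightarrow> homeomorphism (fst c) (snd c ` fst c) (snd c) (coord_inv c)"
  using M by (auto simp: smooth_manifold_def)

lemma open_chart: "c \<in> M \<Longrightarrow> open (fst c)"
  using M by (auto simp: smooth_manifold_def)

lemma coord_inv_coord [simp]: "c \<in> M \<Longrightarrow> q \<in> fst c \<Longrightarrow> coord_inv c (snd c q) = q"
  using chart_homeomorphism by (auto simp: homeomorphism_def)

lemma coord_coord_inv: "c \<in> M \<Longrightarrow> x \<in> snd c ` fst c \<Longrightarrow> snd c (coord_inv c x) = x"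
  using chart_homeomorphism by (auto simp: homeomorphism_def)

lemma open_chart_image:
  assumes "c \<in> M" "open (fst c \<inter> T)"
  shows "open (snd c ` (fst c \<inter> T))"
proof -
  have "openin (top_of_set (fst c)) (fst c \<inter> T)"
    by (metis assms(2) inf_le1 openin_open_eq open_chart[OF assms(1)])
  then have "openin (top_of_set (snd c ` fst c)) (snd c ` (fst c \<inter> T))"
    by (rule homeomorphism_imp_open_map[OF chart_homeomorphism[OF assms(1)]])
  moreover have "open (snd c ` fst c)" using M assms(1) by (auto simp: smooth_manifold_def)
  ultimately show ?thesis using openin_open_eq by blast
qed

lemma smooth_map_id: "smooth_map M M (\<lambda>q. q)"
  using M by (auto simp: smooth_map_def smooth_manifold_def comp_def)

end

section \<open>Smooth maps in charts\<close>

locale smooth_map_between =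
  fixes N :: "('q::{t2_space, second_countable_topology}, 'd::euclidean_space) chart set"
    and M :: "('p::{t2_space, second_countable_topology}, 'e::euclidean_space) chart set"
    and f :: "'q \<Rightarrow> 'p"
  assumes N: "smooth_manifold N" and M: "smooth_manifold M" and f: "smooth_map N M f"
begin

lemma open_preimage:
  assumes "c \<in> N" "open T"
  shows "open (fst c \<inter> f -` T)"
proof -
  have "continuous_on (fst c) f"
    using f assms(1) by (auto simp: smooth_map_def carrier_def intro: continuous_on_subset)
  then show ?thesis using open_chart[OF N assms(1)] assms(2) by (metis continuous_on_open_vimage Int_commute)
qed

lemma open_coord_preimage:
  assumes "c \<in> N" "open T"
  shows "open (snd c ` (fst c \<inter> f -` T))"
  using open_chart_image[OF N assms(1) open_preimage[OF assms]] by simp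

abbreviation coord_rep where "coord_rep c c' \<equiv> snd c' \<circ> f \<circ> coord_inv c"

lemma smooth_coord_rep:
  "c \<in> N \<Longrightarrow> c' \<in> M \<Longrightarrow> smooth_on (snd c ` (fst c \<inter> f -` fst c')) (coord_rep c c')"
  using f by (auto simp: smooth_map_def)

lemma coord_rep_has_derivative:
  assumes "c \<in> N" "c' \<in> M" "p \<in> fst c" "f p \<in> fst c'"
  shows "(coord_rep c c' has_derivative frechet_derivative (coord_rep c c') (at (snd c p))) (at (snd c p))"
  using smooth_on_has_derivative[OF smooth_coord_rep] assms by auto

end

lemma smooth_map_between_id: "smooth_manifold M \<Longrightarrow> smooth_map_between M M (\<lambda>q. q)"
  by (simp add: smooth_map_between_def smooth_map_id)

context
  fixes M :: "('p::{t2_space, second_countable_topology}, 'e::euclidean_space) chart set"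
  assumes M: "smooth_manifold M"
begin

interpretation i: smooth_map_between M M "\<lambda>q. q"
  by (rule smooth_map_between_id[OF M])

lemma transition_has_derivative:
  assumes "c \<in> M" "c' \<in> M" "p \<in> fst c" "p \<in> fst c'"
  shows "(snd c' \<circ> coord_inv c has_derivative transition_deriv c c' p) (at (snd c p))"
  using i.coord_rep_has_derivative[OF assms] by (simp add: transition_deriv_def comp_def)

lemma transition_deriv_self:
  assumes "c \<in> M" "p \<in> fst c"
  shows "transition_deriv c c p = (\<lambda>v. v)"
proof -
  have "((\<lambda>x. x) has_derivative transition_deriv c c p) (at (snd c p))"
    by (rule has_derivative_transform_within_open[OF transition_has_derivative[OF assms(1,1,2,2)]
        open_chart_image[OF M assms(1), of UNIV]])
      (use assms open_chart[OF M] coord_coord_inv[OF M] in auto)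
  then show ?thesis using has_derivative_ident has_derivative_unique by blast
qed

end

text \<open>Both sides are the derivative of one composite of coordinate maps around \<open>p\<close>. For the identity map this is
  the cocycle condition for the transition maps.\<close>

lemma (in smooth_map_between) coord_rep_change:
  assumes "c \<in> N" "d \<in> N" "c' \<in> M" "d' \<in> M" "p \<in> fst c" "p \<in> fst d" "f p \<in> fst c'" "f p \<in> fst d'"
  shows "frechet_derivative (coord_rep d d') (at (snd d p)) (transition_deriv c d p u) =
    transition_deriv c' d' (f p) (frechet_derivative (coord_rep c c') (at (snd c p)) u)"
proof -
  have ci: "coord_inv c (snd c p) = p" by (rule coord_inv_coord[OF N assms(1,5)])
  have 1: "(coord_rep d d' \<circ> (snd d \<circ> coord_inv c) has_derivative
      frechet_derivative (coord_rep d d') (at (snd d p)) \<circ> transition_deriv c d p) (at (snd c p))"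
    using diff_chain_at[OF transition_has_derivative[OF N, of c d p] ] coord_rep_has_derivative[of d d' p] assms
    by (simp add: ci)
  have 2: "((snd d' \<circ> coord_inv c') \<circ> coord_rep c c' has_derivative
      transition_deriv c' d' (f p) \<circ> frechet_derivative (coord_rep c c') (at (snd c p))) (at (snd c p))"
    using diff_chain_at[OF coord_rep_has_derivative[of c c' p]] transition_has_derivative[OF M, of c' d' "f p"] assms
    by (simp add: ci)
  define S where "S = snd c ` (fst c \<inter> (f -` fst c' \<inter> fst d))"
  have S: "open S" "snd c p \<in> S"
    unfolding S_def
    using open_chart_image[OF N assms(1), of "f -` fst c' \<inter> fst d"] open_preimage[OF assms(1), of "fst c'"]
      open_chart[OF M assms(3)] open_chart[OF N assms(2)] assms
    by (auto simp: Int_assoc[symmetric])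
  have "(coord_rep d d' \<circ> (snd d \<circ> coord_inv c) has_derivative
      transition_deriv c' d' (f p) \<circ> frechet_derivative (coord_rep c c') (at (snd c p))) (at (snd c p))"
    by (rule has_derivative_transform_within_open[OF 2 S])
      (use coord_inv_coord[OF N assms(1)] coord_inv_coord[OF N assms(2)] coord_inv_coord[OF M assms(3)]
        in \<open>auto simp: S_def\<close>)
  from has_derivative_unique[OF 1 this] show ?thesis by (simp add: fun_eq_iff)
qed

context
  fixes M :: "('p::{t2_space, second_countable_topology}, 'e::euclidean_space) chart set"
  assumes M: "smooth_manifold M"
begin

interpretation i: smooth_map_between M M "\<lambda>q. q"
  by (rule smooth_map_between_id[OF M])

lemma transition_deriv_cocycle:
  assumes "c \<in> M" "d \<in> M" "e \<in> M" "p \<in> fst c" "p \<in> fst d" "p \<in> fst e"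
  shows "transition_deriv d e p (transition_deriv c d p u) = transition_deriv c e p u"
  using i.coord_rep_change[of c d c e p u] assms transition_deriv_self[OF M]
  by (simp add: transition_deriv_def comp_def)

lemma tvec_of_in_tangent_space:
  assumes "c \<in> M" "p \<in> fst c"
  shows "tvec_of M c p u \<in> tangent_space M p"
proof -
  have "transition_deriv d e p (transition_deriv c d p u) = transition_deriv c e p u"
    if "d \<in> M" "e \<in> M" "p \<in> fst d" "p \<in> fst e" for d e
    by (rule transition_deriv_cocycle) fact+
  then show ?thesis
    unfolding tangent_space_def tvec_of_def
    by (intro CollectI conjI ballI allI impI) (auto simp del: split_paired_All split_paired_Ex)
qed

lemma tvec_of_coord [simp]:
  assumes "c \<in> M" "p \<in> fst c"
  shows "tvec_of M c p u c = u"
  by (simp add: tvec_of_def transition_deriv_self[OF M assms] assms)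

lemma tangent_vector_eq_tvec_of:
  assumes "c \<in> M" "p \<in> fst c" "X \<in> tangent_space M p"
  shows "X = tvec_of M c p (X c)"
proof
  fix c'
  show "X c' = tvec_of M c p (X c) c'"
  proof (cases "c' \<in> M \<and> p \<in> fst c'")
    case True
    then have "X c' = transition_deriv c c' p (X c)"
      using assms unfolding tangent_space_def by blast
    then show ?thesis unfolding tvec_of_def if_P[OF True] .
  next
    case False
    then have "X c' = 0" using assms unfolding tangent_space_def by blast
    then show ?thesis unfolding tvec_of_def if_not_P[OF False] .
  qed
qed

lemma form_eq_local_form:
  assumes "c \<in> M" "p \<in> fst c" "set vs \<subseteq> tangent_space M p"
  shows "\<alpha> p vs = local_form M c \<alpha> (snd c p) (map (\<lambda>X. X c) vs)"
proof -
  have "map (tvec_of M c p) (map (\<lambda>X. X c) vs) = vs"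
    unfolding map_map comp_def
    by (rule map_idI, rule tangent_vector_eq_tvec_of[OF assms(1,2), symmetric]) (use assms(3) in blast)
  then show ?thesis unfolding local_form_def coord_inv_coord[OF M assms(1,2)] by (simp only:)
qed

lemma local_form_at:
  assumes "c \<in> M" "p \<in> fst c"
  shows "local_form M c \<alpha> (snd c p) us = \<alpha> p (map (tvec_of M c p) us)"
  by (simp add: local_form_def coord_inv_coord[OF M assms])

end

context smooth_map_between
begin

text \<open>The push-forward is defined with a chart chosen at \<open>p\<close>; \<open>coord_rep_change\<close> makes it computable in all charts.
  This matters because a chart fixed on a neighbourhood is needed to differentiate.\<close>

lemma pushforward_eq:
  assumes "c \<in> N" "c' \<in> M" "p \<in> fst c" "f p \<in> fst c'" "X \<in> tangent_space N p"
  shows "pushforward N M f p X =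
    tvec_of M c' (f p) (frechet_derivative (coord_rep c c') (at (snd c p)) (X c))"
proof
  fix d' :: "('p, 'e) chart"
  define d where "d = chart_at N p"
  have p: "p \<in> carrier N" using assms by (auto simp: carrier_def)
  have d: "d \<in> N" "p \<in> fst d" using chart_at_in[OF p] by (auto simp: d_def)
  have X: "X d = transition_deriv c d p (X c)"
    using assms d unfolding tangent_space_def by blast
  show "pushforward N M f p X d' =
      tvec_of M c' (f p) (frechet_derivative (coord_rep c c') (at (snd c p)) (X c)) d'"
    using coord_rep_change[of c d c' d' p "X c"] assms d
    by (auto simp: pushforward_def Let_def d_def[symmetric] X tvec_of_def)
qed

lemma pushforward_tvec_of:
  assumes "c \<in> N" "c' \<in> M" "p \<in> fst c" "f p \<in> fst c'"
  shows "pushforward N M f p (tvec_of N c p u) =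
    tvec_of M c' (f p) (frechet_derivative (coord_rep c c') (at (snd c p)) u)"
  unfolding pushforward_eq[OF assms tvec_of_in_tangent_space[OF N assms(1,3)]] tvec_of_coord[OF N assms(1,3)]
  by (rule refl)

lemma map_pushforward_tvec_of:
  assumes "c \<in> N" "c' \<in> M" "p \<in> fst c" "f p \<in> fst c'"
  shows "map (pushforward N M f p) (map (tvec_of N c p) us) =
    map (tvec_of M c' (f p)) (map (frechet_derivative (coord_rep c c') (at (snd c p))) us)"
  by (simp add: pushforward_tvec_of[OF assms])

lemma local_form_pullback:
  assumes "c \<in> N" "c' \<in> M" "x \<in> snd c ` (fst c \<inter> f -` fst c')"
  shows "local_form N c (pullback N M f \<alpha>) x us =
    local_form M c' \<alpha> (coord_rep c c' x) (map (frechet_derivative (coord_rep c c') (at x)) us)"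
proof -
  obtain p where p: "p \<in> fst c" "f p \<in> fst c'" "x = snd c p" using assms by auto
  have "coord_inv c (snd c p) = p" by (rule coord_inv_coord[OF N assms(1) p(1)])
  then show ?thesis
    unfolding p(3) local_form_at[OF N assms(1) p(1)] pullback_def
      map_pushforward_tvec_of[OF assms(1,2) p(1,2)] comp_apply
    by (simp only: local_form_at[OF M assms(2) p(2)])
qed

lemma local_form_contract_along:
  assumes "c \<in> N" "c' \<in> M" "x \<in> snd c ` (fst c \<inter> f -` fst c')"
    and \<nu>: "\<And>p. p \<in> carrier N \<Longrightarrow> \<nu> p \<in> tangent_space M (f p)"
  shows "local_form N c (contract_along N M f \<nu> \<alpha>) x us =
    local_form M c' \<alpha> (coord_rep c c' x)
      (\<nu> (coord_inv c x) c' # map (frechet_derivative (coord_rep c c') (at x)) us)"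
proof -
  obtain p where p: "p \<in> fst c" "f p \<in> fst c'" "x = snd c p" using assms by auto
  have ci: "coord_inv c (snd c p) = p" by (rule coord_inv_coord[OF N assms(1) p(1)])
  have "\<nu> p = tvec_of M c' (f p) (\<nu> p c')"
    by (rule tangent_vector_eq_tvec_of[OF M assms(2) p(2)], rule \<nu>)
       (use assms p in \<open>auto simp: carrier_def\<close>)
  then show ?thesis
    unfolding p(3) local_form_at[OF N assms(1) p(1)] contract_along_def
      map_pushforward_tvec_of[OF assms(1,2) p(1,2)] comp_apply ci
    by (simp only: local_form_at[OF M assms(2) p(2)] list.map)
qed

lemma local_ext_deriv_pullback:
  assumes "c \<in> N" "c' \<in> M" "p \<in> fst c" "f p \<in> fst c'"
    and "smooth_form_on M (carrier M) 2 \<alpha>"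
  shows "local_ext_deriv (local_form N c (pullback N M f \<alpha>)) (snd c p) [u, v, w] =
    local_ext_deriv (local_form M c' \<alpha>) (snd c' (f p))
      (map (frechet_derivative (coord_rep c c') (at (snd c p))) [u, v, w])"
proof -
  have Tc: "fst c' \<inter> carrier M = fst c'" using assms(2) by (auto simp: carrier_def)
  have "local_ext_deriv (local_form N c (pullback N M f \<alpha>)) (snd c p) [u, v, w] =
    local_ext_deriv (local_form M c' \<alpha>) (coord_rep c c' (snd c p))
      (map (frechet_derivative (coord_rep c c') (at (snd c p))) [u, v, w])"
  proof (rule local_ext_deriv_pullback_2[where S = "snd c ` (fst c \<inter> f -` fst c')" and T = "snd c' ` fst c'"])
    show "open (snd c' ` fst c')"
      using open_chart_image[OF M assms(2), of UNIV] open_chart[OF M assms(2)] by simp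
    show "open (snd c ` (fst c \<inter> f -` fst c'))"
      by (rule open_coord_preimage[OF assms(1) open_chart[OF M assms(2)]])
    show "smooth_on (snd c ` (fst c \<inter> f -` fst c')) (coord_rep c c')"
      by (rule smooth_coord_rep[OF assms(1,2)])
    show "coord_rep c c' ` snd c ` (fst c \<inter> f -` fst c') \<subseteq> snd c' ` fst c'"
      using coord_inv_coord[OF N assms(1)] by auto
    show "alternating_multilinear 2 (local_form M c' \<alpha> y)" if "y \<in> snd c' ` fst c'" for y
      using assms(2,5) that Tc unfolding smooth_form_on_def by metis
    show "smooth_on (snd c' ` fst c') (\<lambda>y. local_form M c' \<alpha> y [a, b])" for a b
      using assms(2,5) Tc unfolding smooth_form_on_def by (metis length_2_conv)
    show "local_form N c (pullback N M f \<alpha>) y [a, b] = local_form M c' \<alpha> (coord_rep c c' y)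
        [frechet_derivative (coord_rep c c') (at y) a, frechet_derivative (coord_rep c c') (at y) b]"
      if "y \<in> snd c ` (fst c \<inter> f -` fst c')" for y a b
      using local_form_pullback[OF assms(1,2) that, of \<alpha> "[a, b]"] by simp
    show "snd c p \<in> snd c ` (fst c \<inter> f -` fst c')" using assms by blast
  qed
  then show ?thesis using coord_inv_coord[OF N assms(1,3)] by simp
qed

end

text \<open>Passing to the chart chosen at \<open>q\<close> is a pullback along the identity, and exterior derivatives commute with pullbacks.\<close>

lemma ext_deriv_2_in_chart:
  assumes M: "smooth_manifold M" and "c \<in> M" "q \<in> fst c" "smooth_form_on M (carrier M) 2 \<alpha>"
  shows "local_ext_deriv (local_form M c \<alpha>) (snd c q) [u, v, w] =
    ext_deriv M \<alpha> q (map (tvec_of M c q) [u, v, w])"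
proof -
  interpret i: smooth_map_between M M "\<lambda>q. q" by (rule smooth_map_between_id[OF M])
  define d where "d = chart_at M q"
  have d: "d \<in> M" "q \<in> fst d" using chart_at_in[of q M] assms by (auto simp: d_def carrier_def)
  have T: "open (snd c ` (fst c \<inter> fst d))"
    by (rule open_chart_image[OF M assms(2) open_Int]) (rule open_chart[OF M], fact)+
  have eq: "local_form M c (pullback M M (\<lambda>q. q) \<alpha>) y us = local_form M c \<alpha> y us"
    if "y \<in> snd c ` (fst c \<inter> fst d)" for y us
  proof -
    from that obtain p where p: "p \<in> fst c" "y = snd c p" by auto
    have "frechet_derivative (snd c \<circ> (\<lambda>q. q) \<circ> coord_inv c) (at (snd c p)) = (\<lambda>v. v)"
      using transition_deriv_self[OF M assms(2) p(1)] by (simp add: transition_deriv_def comp_def)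
    then have "map (pushforward M M (\<lambda>q. q) p) (map (tvec_of M c p) us) = map (tvec_of M c p) us"
      using i.map_pushforward_tvec_of[OF assms(2,2) p(1,1), of us] by (simp only: list.map_ident)
    then show ?thesis
      unfolding p(2) local_form_at[OF M assms(2) p(1)] pullback_def by (simp only:)
  qed
  have cq: "snd c q \<in> snd c ` (fst c \<inter> fst d)" using assms d by auto
  have fd_eq: "frechet_derivative (\<lambda>y. local_form M c \<alpha> y us) (at (snd c q)) =
      frechet_derivative (\<lambda>y. local_form M c (pullback M M (\<lambda>q. q) \<alpha>) y us) (at (snd c q))" for us
    by (rule frechet_derivative_cong_open[OF T cq]) (simp only: eq)
  have "local_ext_deriv (local_form M c \<alpha>) (snd c q) [u, v, w] =
      local_ext_deriv (local_form M c (pullback M M (\<lambda>q. q) \<alpha>)) (snd c q) [u, v, w]"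
    unfolding local_ext_deriv_2 by (simp only: fd_eq)
  also have "\<dots> = local_ext_deriv (local_form M d \<alpha>) (snd d q)
      (map (transition_deriv c d q) [u, v, w])"
    using i.local_ext_deriv_pullback[OF assms(2) d(1) assms(3) d(2) assms(4), of u v w]
    by (simp only: transition_deriv_def comp_def)
  also have "map (transition_deriv c d q) [u, v, w] = map (\<lambda>X. X d) (map (tvec_of M c q) [u, v, w])"
    using d by (simp add: tvec_of_def)
  finally show ?thesis
    by (simp only: ext_deriv_def Let_def d_def[symmetric])
qed

section \<open>Wedge products of forms of low degree\<close>

text \<open>The sum over the six shuffles in the wedge product of two 2-forms.\<close>

definition wedge22 :: "('a \<Rightarrow> 'a \<Rightarrow> real) \<Rightarrow> ('a \<Rightarrow> 'a \<Rightarrow> real) \<Rightarrow> 'a \<Rightarrow> 'a \<Rightarrow> 'a \<Rightarrow> 'a \<Rightarrow> real" where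
  "wedge22 \<alpha> \<beta> x y z w =
     \<alpha> x y * \<beta> z w - \<alpha> x z * \<beta> y w + \<alpha> x w * \<beta> y z + \<alpha> y z * \<beta> x w - \<alpha> y w * \<beta> x z + \<alpha> z w * \<beta> x y"

lemma wedge22_commute: "wedge22 \<beta> \<alpha> x y z w = wedge22 \<alpha> \<beta> x y z w"
  by (simp add: wedge22_def)

lemma wedge22_uminus:
  "wedge22 (\<lambda>u v. - \<alpha> u v) \<beta> x y z w = - wedge22 \<alpha> \<beta> x y z w"
  "wedge22 \<alpha> (\<lambda>u v. - \<beta> u v) x y z w = - wedge22 \<alpha> \<beta> x y z w"
  by (simp_all add: wedge22_def)

lemma wedge22_comp:
  "wedge22 (\<lambda>u v. \<alpha> (h u) (h v)) (\<lambda>u v. \<beta> (h u) (h v)) x y z w = wedge22 \<alpha> \<beta> (h x) (h y) (h z) (h w)"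
  by (simp add: wedge22_def)

lemma alternating_multilinear_wedge22:
  assumes f: "\<And>w. linear (\<lambda>v. f v w)" "\<And>v. linear (f v)" "\<And>v w. f w v = - f v w"
    and a: "\<And>x y z w. a [x, y, z, w] = wedge22 f f x y z w"
  shows "alternating_multilinear 4 a"
  unfolding alternating_multilinear_def
proof (intro conjI allI impI)
  have 0: "f v v = 0" for v using f(3)[of v v] by simp
  note l = linear_add[OF f(1)] linear_add[OF f(2)] linear_scale[OF f(1)] linear_scale[OF f(2)]
  {
    fix us :: "'a list" and i :: nat
    assume us: "length us = 4 \<and> i < 4"
    then obtain x y z w where xy: "us = [x, y, z, w]" unfolding length_4_conv by blast
    have l1: "linear (\<lambda>t. wedge22 f f t y z w)"
      by (rule linearI) (simp_all add: wedge22_def l algebra_simps)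
    have l2: "linear (\<lambda>t. wedge22 f f x t z w)"
      by (rule linearI) (simp_all add: wedge22_def l algebra_simps)
    have l3: "linear (\<lambda>t. wedge22 f f x y t w)"
      by (rule linearI) (simp_all add: wedge22_def l algebra_simps)
    have l4: "linear (\<lambda>t. wedge22 f f x y z t)"
      by (rule linearI) (simp_all add: wedge22_def l algebra_simps)
    have "i = 0 \<or> i = 1 \<or> i = 2 \<or> i = 3" using conjunct2[OF us] by arith
    then show "linear (\<lambda>w. a (us[i := w]))"
      using l1 l2 l3 l4 by (elim disjE) (simp_all add: xy a eval_nat_numeral)
  next
    fix us :: "'a list" and i j :: nat
    assume us: "length us = 4 \<and> i < j \<and> j < 4 \<and> us ! i = us ! j"
    then obtain x y z w where xy: "us = [x, y, z, w]" unfolding length_4_conv by blast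
    have "i = 0 \<and> j = 1 \<or> i = 0 \<and> j = 2 \<or> i = 0 \<and> j = 3 \<or> i = 1 \<and> j = 2 \<or> i = 1 \<and> j = 3 \<or> i = 2 \<and> j = 3"
      using conjunct1[OF conjunct2[OF us]] conjunct1[OF conjunct2[OF conjunct2[OF us]]] by arith
    then have "x = y \<or> x = z \<or> x = w \<or> y = z \<or> y = w \<or> z = w"
      using us unfolding xy by (elim disjE conjE) (simp_all add: eval_nat_numeral)
    then have "wedge22 f f x y z w = 0"
      unfolding wedge22_def
      using f(3)[of x y] f(3)[of x z] f(3)[of x w] f(3)[of y z] f(3)[of y w] f(3)[of z w]
      by (elim disjE) (simp_all add: 0)
    then show "a us = 0" by (simp add: xy a)
  }
qed

lemma permutes_lessThan_Suc_fixed: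
  "{\<sigma>. \<sigma> permutes {..<Suc n} \<and> \<sigma> n = n} = {\<sigma>. \<sigma> permutes {..<n}}"
proof (intro Collect_cong iffI conjI)
  fix \<sigma> :: "nat \<Rightarrow> nat"
  assume \<sigma>: "\<sigma> permutes {..<Suc n} \<and> \<sigma> n = n"
  then show "\<sigma> permutes {..<n}"
    by (elim conjE) (erule permutes_superset, auto simp: less_Suc_eq)
next
  fix \<sigma> :: "nat \<Rightarrow> nat"
  assume \<sigma>: "\<sigma> permutes {..<n}"
  then show "\<sigma> permutes {..<Suc n}" by (rule permutes_subset) auto
  show "\<sigma> n = n" by (rule permutes_not_in[OF \<sigma>]) simp
qed

lemma wedge_1_1:
  "wedge 1 1 \<alpha> \<beta> p [X, Y] = \<alpha> p [X] * \<beta> p [Y] - \<alpha> p [Y] * \<beta> p [X]"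
proof -
  have s: "{..<1 + 1 :: nat} = insert 0 {1}" by auto
  show ?thesis
    unfolding wedge_def s
    by (simp add: sum_over_permutations_insert permutes_sing sign_compose sign_swap_id
        permutation_swap_id sign_id Transposition.transpose_def eval_nat_numeral upt_rec)
qed

lemma wedge_2_1:
  assumes "\<And>V W. V \<in> {X, Y, Z} \<Longrightarrow> W \<in> {X, Y, Z} \<Longrightarrow> \<alpha> p [W, V] = - \<alpha> p [V, W]"
  shows "wedge 2 1 \<alpha> \<beta> p [X, Y, Z] =
    \<alpha> p [X, Y] * \<beta> p [Z] - \<alpha> p [X, Z] * \<beta> p [Y] + \<alpha> p [Y, Z] * \<beta> p [X]"
proof -
  have s: "{..<2 + 1 :: nat} = insert 0 (insert 1 {2})" by auto
  have sw: "\<alpha> p [Y, X] = - \<alpha> p [X, Y]" "\<alpha> p [Z, X] = - \<alpha> p [X, Z]" "\<alpha> p [Z, Y] = - \<alpha> p [Y, Z]"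
    by (rule assms; simp)+
  show ?thesis
    unfolding wedge_def s
    by (simp add: sum_over_permutations_insert permutes_sing sign_compose sign_swap_id
        permutation_swap_id permutation_compose sign_id Transposition.transpose_def eval_nat_numeral upt_rec sw)
qed

lemma wedge_1_2:
  assumes "\<And>V W. V \<in> {X, Y, Z} \<Longrightarrow> W \<in> {X, Y, Z} \<Longrightarrow> \<beta> p [W, V] = - \<beta> p [V, W]"
  shows "wedge 1 2 \<alpha> \<beta> p [X, Y, Z] =
    \<alpha> p [X] * \<beta> p [Y, Z] - \<alpha> p [Y] * \<beta> p [X, Z] + \<alpha> p [Z] * \<beta> p [X, Y]"
proof -
  have s: "{..<1 + 2 :: nat} = insert 0 (insert 1 {2})" by auto
  have sw: "\<beta> p [Y, X] = - \<beta> p [X, Y]" "\<beta> p [Z, X] = - \<beta> p [X, Z]" "\<beta> p [Z, Y] = - \<beta> p [Y, Z]"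
    by (rule assms; simp)+
  show ?thesis
    unfolding wedge_def s
    by (simp add: sum_over_permutations_insert permutes_sing sign_compose sign_swap_id
        permutation_swap_id permutation_compose sign_id Transposition.transpose_def eval_nat_numeral upt_rec sw)
qed

lemma sum_permutes_4:
  fixes G :: "nat \<Rightarrow> nat \<Rightarrow> nat \<Rightarrow> nat \<Rightarrow> 'b::ring_1"
  shows "(\<Sum>\<sigma> | \<sigma> permutes {..<4}. of_int (sign \<sigma>) * G (\<sigma> 0) (\<sigma> 1) (\<sigma> 2) (\<sigma> 3)) =
    G 0 1 2 3 - G 0 1 3 2 - G 0 2 1 3 + G 0 2 3 1 + G 0 3 1 2 - G 0 3 2 1
    - G 1 0 2 3 + G 1 0 3 2 + G 1 2 0 3 - G 1 2 3 0 - G 1 3 0 2 + G 1 3 2 0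
    + G 2 0 1 3 - G 2 0 3 1 - G 2 1 0 3 + G 2 1 3 0 + G 2 3 0 1 - G 2 3 1 0
    - G 3 0 1 2 + G 3 0 2 1 + G 3 1 0 2 - G 3 1 2 0 - G 3 2 0 1 + G 3 2 1 0"
proof -
  have s: "{..<4 :: nat} = insert 0 (insert 1 (insert 2 {3}))" by auto
  have f: "finite {1, 2, 3::nat}" "0 \<notin> {1, 2, 3::nat}" "finite {2, 3::nat}" "1 \<notin> {2, 3::nat}"
    "finite {3::nat}" "2 \<notin> {3::nat}" by simp_all
  show ?thesis
    unfolding s sum_over_permutations_insert[OF f(1,2)] sum_over_permutations_insert[OF f(3,4)]
      sum_over_permutations_insert[OF f(5,6)] permutes_sing
    by (simp add: sign_compose sign_swap_id permutation_swap_id permutation_compose sign_id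
       Transposition.transpose_def)
qed

lemma wedge_2_2:
  fixes \<alpha> \<beta> :: "('p, 'e, real) dform"
  assumes "\<And>V W. V \<in> {X, Y, Z, T} \<Longrightarrow> W \<in> {X, Y, Z, T} \<Longrightarrow> \<alpha> p [W, V] = - \<alpha> p [V, W]"
    and "\<And>V W. V \<in> {X, Y, Z, T} \<Longrightarrow> W \<in> {X, Y, Z, T} \<Longrightarrow> \<beta> p [W, V] = - \<beta> p [V, W]"
  shows "wedge 2 2 \<alpha> \<beta> p [X, Y, Z, T] = wedge22 (\<lambda>V W. \<alpha> p [V, W]) (\<lambda>V W. \<beta> p [V, W]) X Y Z T"
proof -
  let ?vs = "[X, Y, Z, T]"
  have sw: "\<alpha> p [Y, X] = - \<alpha> p [X, Y]" "\<alpha> p [Z, X] = - \<alpha> p [X, Z]" "\<alpha> p [Z, Y] = - \<alpha> p [Y, Z]"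
    "\<alpha> p [T, X] = - \<alpha> p [X, T]" "\<alpha> p [T, Y] = - \<alpha> p [Y, T]" "\<alpha> p [T, Z] = - \<alpha> p [Z, T]"
    by (rule assms; simp)+
  have sw': "\<beta> p [Y, X] = - \<beta> p [X, Y]" "\<beta> p [Z, X] = - \<beta> p [X, Z]" "\<beta> p [Z, Y] = - \<beta> p [Y, Z]"
    "\<beta> p [T, X] = - \<beta> p [X, T]" "\<beta> p [T, Y] = - \<beta> p [Y, T]" "\<beta> p [T, Z] = - \<beta> p [Z, T]"
    by (rule assms; simp)+
  have l: "map h [0..<2] = [h 0, h 1]" "map h [2..<2 + 2] = [h 2, h 3]" for h :: "nat \<Rightarrow> 'c"
    by (simp_all add: eval_nat_numeral upt_rec)
  have "wedge 2 2 \<alpha> \<beta> p ?vs = (\<Sum>\<sigma> | \<sigma> permutes {..<4}.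
      of_int (sign \<sigma>) * (\<alpha> p [?vs ! \<sigma> 0, ?vs ! \<sigma> 1] * \<beta> p [?vs ! \<sigma> 2, ?vs ! \<sigma> 3])) / (fact 2 * fact 2)"
    unfolding wedge_def l by (simp add: mult.assoc)
  also have "(\<Sum>\<sigma> | \<sigma> permutes {..<4}. of_int (sign \<sigma>) *
      (\<alpha> p [?vs ! \<sigma> 0, ?vs ! \<sigma> 1] * \<beta> p [?vs ! \<sigma> 2, ?vs ! \<sigma> 3])) =
      4 * wedge22 (\<lambda>V W. \<alpha> p [V, W]) (\<lambda>V W. \<beta> p [V, W]) X Y Z T"
  proof -
    have n: "?vs ! 0 = X" "?vs ! 1 = Y" "?vs ! 2 = Z" "?vs ! 3 = T" by simp_all
    show ?thesis
      by (subst sum_permutes_4[where G = "\<lambda>i j k l. \<alpha> p [?vs ! i, ?vs ! j] * \<beta> p [?vs ! k, ?vs ! l]"])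
        (simp only: n sw sw' wedge22_def, algebra)
  qed
  finally show ?thesis by (simp add: fact_2)
qed

text \<open>The square of a 2-form is alternating; transpositions suffice, and those of non-neighbours are composed of
  those of neighbours.\<close>

lemma wedge22_self_permutes:
  fixes x :: "nat \<Rightarrow> 'a"
  assumes "\<And>v w. f w v = - f v w" "\<sigma> permutes {..<4}"
  shows "wedge22 f f (x (\<sigma> 0)) (x (\<sigma> 1)) (x (\<sigma> 2)) (x (\<sigma> 3)) =
    of_int (sign \<sigma>) * wedge22 f f (x 0) (x 1) (x 2) (x 3)"
proof -
  have sw01: "wedge22 f f b a c d = - wedge22 f f a b c d" for a b c d
    by (simp add: wedge22_def assms(1)[of a b])
  have sw12: "wedge22 f f a c b d = - wedge22 f f a b c d" for a b c d
    by (simp add: wedge22_def assms(1)[of b c])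
  have sw23: "wedge22 f f a b d c = - wedge22 f f a b c d" for a b c d
    by (simp add: wedge22_def assms(1)[of c d])
  have far: "wedge22 f f c b a d = - wedge22 f f a b c d" "wedge22 f f a d c b = - wedge22 f f a b c d"
    "wedge22 f f d b c a = - wedge22 f f a b c d" for a b c d
  proof -
    show 1: "wedge22 f f c b a d = - wedge22 f f a b c d" for c b a d
      by (metis sw01 sw12)
    show "wedge22 f f a d c b = - wedge22 f f a b c d" by (metis sw12 sw23)
    show "wedge22 f f d b c a = - wedge22 f f a b c d" by (metis 1 sw23)
  qed
  have tr: "wedge22 f f (y (Transposition.transpose a b 0)) (y (Transposition.transpose a b 1)) (y (Transposition.transpose a b 2)) (y (Transposition.transpose a b 3)) =
      - wedge22 f f (y 0) (y 1) (y 2) (y 3)" if "a < b" "b < 4" for a b and y :: "nat \<Rightarrow> 'a"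
  proof -
    have "a = 0 \<and> b = 1 \<or> a = 0 \<and> b = 2 \<or> a = 0 \<and> b = 3 \<or> a = 1 \<and> b = 2 \<or> a = 1 \<and> b = 3 \<or> a = 2 \<and> b = 3"
      using that by arith
    then show ?thesis
      using sw01[of "y 1" "y 0" "y 2" "y 3"] sw12[of "y 0" "y 2" "y 1" "y 3"] sw23[of "y 0" "y 1" "y 3" "y 2"]
        far(1)[of "y 2" "y 1" "y 0" "y 3"] far(2)[of "y 0" "y 3" "y 2" "y 1"] far(3)[of "y 3" "y 1" "y 2" "y 0"]
      by (elim disjE conjE) (simp_all add: Transposition.transpose_def)
  qed
  have tr': "wedge22 f f (y (Transposition.transpose a b 0)) (y (Transposition.transpose a b 1)) (y (Transposition.transpose a b 2)) (y (Transposition.transpose a b 3)) =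
      - wedge22 f f (y 0) (y 1) (y 2) (y 3)" if "a \<noteq> b" "a < 4" "b < 4" for a b and y :: "nat \<Rightarrow> 'a"
    using tr[of a b y] tr[of b a y] that by (cases "a < b") (simp_all add: transpose_commute)
  have "permutation \<sigma> \<and> (\<forall>x :: nat \<Rightarrow> 'a. wedge22 f f (x (\<sigma> 0)) (x (\<sigma> 1)) (x (\<sigma> 2)) (x (\<sigma> 3)) =
    of_int (sign \<sigma>) * wedge22 f f (x 0) (x 1) (x 2) (x 3))"
    using assms(2) finite_lessThan
  proof (induction rule: permutes_induct)
    case id
    then show ?case by simp
  next
    case (swap a b p)
    have ab: "a \<noteq> b" "a < 4" "b < 4" using swap.hyps(1-3) by simp_all
    have p: "permutation p" using swap.IH by (rule conjunct1)
    have s: "sign (Transposition.transpose a b \<circ> p) = - sign p"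
      using ab p by (simp add: sign_compose permutation_swap_id sign_swap_id)
    show ?case
    proof (intro conjI allI)
      show "permutation (Transposition.transpose a b \<circ> p)"
        by (intro permutation_compose permutation_swap_id p)
      fix x :: "nat \<Rightarrow> 'a"
      note swap.IH[THEN conjunct2, rule_format, of "\<lambda>i. x (Transposition.transpose a b i)"]
      also note tr'[OF ab, of x]
      finally show "wedge22 f f (x ((Transposition.transpose a b \<circ> p) 0)) (x ((Transposition.transpose a b \<circ> p) 1))
            (x ((Transposition.transpose a b \<circ> p) 2)) (x ((Transposition.transpose a b \<circ> p) 3)) =
          of_int (sign (Transposition.transpose a b \<circ> p)) * wedge22 f f (x 0) (x 1) (x 2) (x 3)"
        unfolding s comp_apply by simp
    qed
  qed
  from this[THEN conjunct2, rule_format, of x] show ?thesis .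
qed

text \<open>Only the permutations that fix the last index contribute, and by \<open>wedge22_self_permutes\<close> each of these
  contributes the same amount. This avoids an expansion into 120 terms.\<close>

lemma wedge_4_1_last_factor:
  fixes \<alpha> \<beta> :: "('p, 'e, real) dform"
  assumes \<alpha>: "\<And>x y z w. {x, y, z, w} \<subseteq> set vs \<Longrightarrow> \<alpha> p [x, y, z, w] = wedge22 f f x y z w"
    and f: "\<And>v w. f w v = - f v w" and vs: "length vs = 5"
    and \<beta>: "\<And>i. i < 4 \<Longrightarrow> \<beta> p [vs ! i] = 0"
  shows "wedge 4 1 \<alpha> \<beta> p vs = wedge22 f f (vs ! 0) (vs ! 1) (vs ! 2) (vs ! 3) * \<beta> p [vs ! 4]"
proof -
  let ?g = "\<lambda>\<sigma>. of_int (sign \<sigma>) * \<alpha> p (map (\<lambda>i. vs ! \<sigma> i) [0..<4]) * \<beta> p (map (\<lambda>i. vs ! \<sigma> i) [4..<4 + 1])"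
  let ?w = "wedge22 f f (vs ! 0) (vs ! 1) (vs ! 2) (vs ! 3)"
  have l: "map h [0..<4] = [h 0, h 1, h 2, h 3]" "map h [4..<4 + 1] = [h 4]" for h :: "nat \<Rightarrow> 'c"
    by (simp_all add: eval_nat_numeral upt_rec)
  have fin: "finite {\<sigma>. \<sigma> permutes {..<Suc 4}}" by (simp add: finite_permutations)
  have z: "?g \<sigma> = 0" if "\<sigma> permutes {..<Suc 4}" "\<sigma> 4 \<noteq> 4" for \<sigma>
  proof -
    have "\<sigma> 4 < Suc 4" using permutes_in_image[OF that(1), of 4] by simp
    then have "\<sigma> 4 < 4" using that(2) by simp
    then show ?thesis unfolding l using \<beta> by simp
  qed
  have g: "?g \<sigma> = ?w * \<beta> p [vs ! 4]" if "\<sigma> permutes {..<4}" for \<sigma>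
  proof -
    have 4: "\<sigma> 4 = 4" by (rule permutes_not_in[OF that]) simp
    have r: "\<sigma> i < 5" if "i < 4" for i
      using permutes_in_image[OF \<open>\<sigma> permutes {..<4}\<close>, of i] that by simp
    have "\<alpha> p [vs ! \<sigma> 0, vs ! \<sigma> 1, vs ! \<sigma> 2, vs ! \<sigma> 3] = of_int (sign \<sigma>) * ?w"
    proof -
      have sub: "{vs ! \<sigma> 0, vs ! \<sigma> 1, vs ! \<sigma> 2, vs ! \<sigma> 3} \<subseteq> set vs"
        using r[of 0] r[of 1] r[of 2] r[of 3] by (simp add: vs)
      show ?thesis
        unfolding \<alpha>[OF sub] by (rule wedge22_self_permutes[where x = "\<lambda>i. vs ! i", OF f that])
    qed
    moreover have "(of_int (sign \<sigma>) :: real) * of_int (sign \<sigma>) = 1"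
      by (simp add: sign_def)
    ultimately show ?thesis
      unfolding l 4 by (simp only: mult.assoc[symmetric] mult_1_left)
  qed
  have "(\<Sum>\<sigma> | \<sigma> permutes {..<4 + 1}. ?g \<sigma>) = (\<Sum>\<sigma> | \<sigma> permutes {..<Suc 4}. ?g \<sigma>)"
    by (simp only: Suc_eq_plus1)
  also have "\<dots> = (\<Sum>\<sigma> | \<sigma> permutes {..<Suc 4} \<and> \<sigma> 4 = 4. ?g \<sigma>)"
  proof (rule sum.mono_neutral_right[OF fin])
    show "\<forall>\<sigma> \<in> {\<sigma>. \<sigma> permutes {..<Suc 4}} - {\<sigma>. \<sigma> permutes {..<Suc 4} \<and> \<sigma> 4 = 4}. ?g \<sigma> = 0"
      by (intro ballI z) simp_all
  qed blast
  also have "\<dots> = (\<Sum>\<sigma> | \<sigma> permutes {..<4::nat}. ?w * \<beta> p [vs ! 4])"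
    unfolding permutes_lessThan_Suc_fixed by (intro sum.cong refl g) (simp only: mem_Collect_eq)
  also have "\<dots> = fact 4 * (?w * \<beta> p [vs ! 4])"
    by (simp only: sum_constant card_permutations[OF card_lessThan finite_lessThan] of_nat_fact)
  finally show ?thesis unfolding wedge_def by simp
qed

lemma wedge_2_2_local_form:
  fixes \<alpha> :: "('p::{t2_space, second_countable_topology}, 'e::euclidean_space, real) dform"
  assumes M: "smooth_manifold M" and c: "c \<in> M" "p \<in> fst c" and X: "set Xs \<subseteq> tangent_space M p" "length Xs = 4"
    and alt: "alternating_multilinear 2 (local_form M c \<alpha> (snd c p))" "alternating_multilinear 2 (local_form M c \<beta> (snd c p))"
  shows "wedge 2 2 \<alpha> \<beta> p Xs = wedge22 (\<lambda>u v. local_form M c \<alpha> (snd c p) [u, v]) (\<lambda>u v. local_form M c \<beta> (snd c p) [u, v])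
    ((Xs ! 0) c) ((Xs ! 1) c) ((Xs ! 2) c) ((Xs ! 3) c)"
proof -
  obtain X Y Z W where Xs: "Xs = [X, Y, Z, W]" using X(2) unfolding length_4_conv by blast
  have l: "\<gamma> p [V, V'] = local_form M c \<gamma> (snd c p) [V c, V' c]" if "V \<in> {X, Y, Z, W}" "V' \<in> {X, Y, Z, W}"
    for V V' and \<gamma> :: "('p, 'e, real) dform"
    using form_eq_local_form[OF M c, of "[V, V']" \<gamma>] that X(1) unfolding Xs by auto
  have a: "\<alpha> p [V', V] = - \<alpha> p [V, V']" if "V \<in> {X, Y, Z, W}" "V' \<in> {X, Y, Z, W}" for V V'
    unfolding l[OF that] l[OF that(2,1)] by (rule alternating_multilinear_2_swap[OF alt(1)])
  have b: "\<beta> p [V', V] = - \<beta> p [V, V']" if "V \<in> {X, Y, Z, W}" "V' \<in> {X, Y, Z, W}" for V V'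
    unfolding l[OF that] l[OF that(2,1)] by (rule alternating_multilinear_2_swap[OF alt(2)])
  show ?thesis
    using wedge_2_2[where \<alpha> = \<alpha> and \<beta> = \<beta> and p = p and X = X and Y = Y and Z = Z and T = W, OF a b]
    unfolding Xs wedge22_def by (simp add: l)
qed

section \<open>The standard SU(3)-structure on complex three-space\<close>

type_synonym c3 = "complex \<times> complex \<times> complex"

text \<open>The pairs \<open>e\<^sup>1 + i e\<^sup>2\<close>, \<open>e\<^sup>3 + i e\<^sup>4\<close>, \<open>e\<^sup>5 + i e\<^sup>6\<close> of an adapted coframe identify a tangent space with \<open>\<complex>\<^sup>3\<close>. Then
  the metric is the real part and \<open>F\<close> the imaginary part of the Hermitian form, and \<open>\<Psi>\<^sub>+ + i \<Psi>\<^sub>-\<close> is the complex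
  determinant \<open>vol\<close>.\<close>

fun herm :: "c3 \<Rightarrow> c3 \<Rightarrow> complex" where
  "herm (a, b, c) (x, y, z) = cnj a * x + cnj b * y + cnj c * z"

fun vol :: "c3 \<Rightarrow> c3 \<Rightarrow> c3 \<Rightarrow> complex" where
  "vol (a, b, c) (x, y, z) (p, q, r) = a * (y * r - z * q) - b * (x * r - z * p) + c * (x * q - y * p)"

definition kform :: "c3 \<Rightarrow> c3 \<Rightarrow> real" where
  "kform v w = Im (herm v w)"

text \<open>The complex cross product of \<open>q\<close> with the conjugate of \<open>v\<close>. These maps are the skew endomorphisms that are
  complex antilinear.\<close>

fun twist :: "c3 \<Rightarrow> c3 \<Rightarrow> c3" where
  "twist (a, b, c) (x, y, z) = (b * cnj z - c * cnj y, c * cnj x - a * cnj z, a * cnj y - b * cnj x)"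

lemma Re_herm: "Re (herm v w) = v \<bullet> w"
  by (cases v; cases w) (simp add: inner_complex_def)

lemma herm_add_left: "herm (v + v') w = herm v w + herm v' w"
  by (cases v; cases v'; cases w) (simp add: algebra_simps)

lemma herm_add_right: "herm v (w + w') = herm v w + herm v w'"
  by (cases v; cases w'; cases w) (simp add: algebra_simps)

lemma herm_scale_left: "herm (r *\<^sub>R v) w = of_real r * herm v w"
  by (cases v; cases w) (simp add: scaleR_conv_of_real algebra_simps)

lemma herm_scale_right: "herm v (r *\<^sub>R w) = of_real r * herm v w"
  by (cases v; cases w) (simp add: scaleR_conv_of_real algebra_simps)

lemma herm_commute: "herm w v = cnj (herm v w)"
  by (cases v; cases w) (simp add: algebra_simps)

lemma kform_commute: "kform w v = - kform v w"
  by (simp add: kform_def herm_commute[of w v])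

lemma kform_self [simp]: "kform v v = 0"
  using kform_commute[of v v] by simp

lemma bilinear_kform: "bilinear kform"
  unfolding bilinear_def
  by (intro conjI allI linearI)
    (simp_all add: kform_def herm_add_left herm_add_right herm_scale_left herm_scale_right)

lemmas bounded_bilinear_kform = bilinear_kform[unfolded bilinear_conv_bounded_bilinear]

lemma kform_add: "kform (v + v') w = kform v w + kform v' w" "kform v (w + w') = kform v w + kform v w'"
  by (simp_all add: kform_def herm_add_left herm_add_right)

lemma linear_vol:
  "linear (\<lambda>u. vol u v w)" "linear (\<lambda>v. vol u v w)" "linear (\<lambda>w. vol u v w)"
  by (rule linearI; cases u; cases v; cases w; force simp: scaleR_conv_of_real algebra_simps)+

lemma vol_swap: "vol v u w = - vol u v w" "vol u w v = - vol u v w"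
  by (cases u; cases v; cases w; simp add: algebra_simps)+

lemma vol_eq_0 [simp]: "vol u u w = 0" "vol u w u = 0" "vol w u u = 0"
  by (cases u; cases w; simp add: algebra_simps)+

fun crossc :: "c3 \<Rightarrow> c3 \<Rightarrow> c3" where
  "crossc (x, y, z) (p, q, r) = (y * r - z * q, z * p - x * r, x * q - y * p)"

fun dotc :: "c3 \<Rightarrow> c3 \<Rightarrow> complex" where
  "dotc (a, b, c) (x, y, z) = a * x + b * y + c * z"

text \<open>Written in this way, \<open>vol\<close> inherits the rules for derivatives and smoothness of bilinear maps.\<close>

lemma vol_dotc: "vol u v w = dotc u (crossc v w)"
  by (cases u; cases v; cases w) (simp add: algebra_simps)

lemma bilinear_dotc: "bilinear dotc"
  unfolding bilinear_def
  by (safe; rule linearI) (auto simp: scaleR_conv_of_real algebra_simps)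

lemma bilinear_crossc: "bilinear crossc"
  unfolding bilinear_def
  by (safe; rule linearI) (auto simp: scaleR_conv_of_real algebra_simps)

lemmas bounded_bilinear_dotc = bilinear_dotc[unfolded bilinear_conv_bounded_bilinear]

lemmas bounded_bilinear_crossc = bilinear_crossc[unfolded bilinear_conv_bounded_bilinear]

lemma has_derivative_vol:
  assumes "(f has_derivative f') (at x)" "(g has_derivative g') (at x)" "(h has_derivative h') (at x)"
  shows "((\<lambda>x. vol (f x) (g x) (h x)) has_derivative
    (\<lambda>u. vol (f' u) (g x) (h x) + vol (f x) (g' u) (h x) + vol (f x) (g x) (h' u))) (at x)"
  unfolding vol_dotc
  by (rule has_derivative_eq_rhs[OF bounded_bilinear.FDERIV[OF bounded_bilinear_dotc assms(1)
        bounded_bilinear.FDERIV[OF bounded_bilinear_crossc assms(2,3)]]])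
     (simp add: fun_eq_iff bounded_bilinear.add_right[OF bounded_bilinear_dotc])

lemma smooth_on_vol:
  assumes "open S" "smooth_on S f" "smooth_on S g" "smooth_on S h"
  shows "smooth_on S (\<lambda>x. vol (f x) (g x) (h x))"
  using assms unfolding vol_dotc smooth_on_def
  by (simp add: bounded_bilinear.Ck_on[OF bounded_bilinear_dotc]
      bounded_bilinear.Ck_on[OF bounded_bilinear_crossc])

lemma smooth_on_kform:
  assumes "open S" "smooth_on S f" "smooth_on S g"
  shows "smooth_on S (\<lambda>x. kform (f x) (g x))"
  using assms unfolding smooth_on_def
  by (simp add: bounded_bilinear.Ck_on[OF bounded_bilinear_kform])

section \<open>Intrinsic torsion\<close>

text \<open>The vector \<open>q\<close> for which \<open>twist q\<close> is the complex antilinear part of a skew \<open>S\<close>. The antilinear part maps \<open>v\<close> to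
  \<open>(S v + i S (i v)) / 2\<close>, and its values on the basis vectors display the components of \<open>q\<close>.\<close>

definition twist_part :: "(c3 \<Rightarrow> c3) \<Rightarrow> c3" where
  "twist_part S =
    ((snd (snd (S (0, 1, 0))) + \<i> * snd (snd (S (0, \<i>, 0)))) / 2,
     - (snd (snd (S (1, 0, 0))) + \<i> * snd (snd (S (\<i>, 0, 0)))) / 2,
     (fst (snd (S (1, 0, 0))) + \<i> * fst (snd (S (\<i>, 0, 0)))) / 2)"

text \<open>For a skew \<open>S\<close>, the complex linear part has trace \<open>i\<close> times this number.\<close>

definition trace_part :: "(c3 \<Rightarrow> c3) \<Rightarrow> real" where
  "trace_part S = Im (fst (S (1, 0, 0))) + Im (fst (snd (S (0, 1, 0)))) + Im (snd (snd (S (0, 0, 1))))"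

fun skew_hermitian :: "real \<Rightarrow> real \<Rightarrow> real \<Rightarrow> complex \<Rightarrow> complex \<Rightarrow> complex \<Rightarrow> c3 \<Rightarrow> c3" where
  "skew_hermitian a b c k l m (x, y, z) =
     (\<i> * a * x + m * y - cnj l * z, - cnj m * x + \<i> * b * y + k * z, l * x - cnj k * y + \<i> * c * z)"

lemma Basis_c3: "(Basis :: c3 set) =
  {(1, 0, 0), (\<i>, 0, 0), (0, 1, 0), (0, \<i>, 0), (0, 0, 1), (0, 0, \<i>)}"
  by (simp add: Basis_prod_def Basis_complex_def zero_prod_def insert_commute)

lemma linear_c3_eqI:
  fixes f g :: "c3 \<Rightarrow> 'a::real_vector"
  assumes "linear f" "linear g"
    and "f (1, 0, 0) = g (1, 0, 0)" "f (\<i>, 0, 0) = g (\<i>, 0, 0)"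
    and "f (0, 1, 0) = g (0, 1, 0)" "f (0, \<i>, 0) = g (0, \<i>, 0)"
    and "f (0, 0, 1) = g (0, 0, 1)" "f (0, 0, \<i>) = g (0, 0, \<i>)"
  shows "f = g"
  by (rule linear_eq_stdbasis[OF assms(1,2)]) (use assms in \<open>auto simp: Basis_c3\<close>)

text \<open>The decomposition of \<open>so(6)\<close> into \<open>u(3)\<close> and a copy of \<open>\<complex>\<^sup>3\<close>. Both sides are real linear, so they are compared on
  the six basis vectors, where skewness relates the coefficients.\<close>

lemma skew_decomposition:
  fixes S :: "c3 \<Rightarrow> c3"
  assumes "linear S" and skew: "\<And>v w. S v \<bullet> w + v \<bullet> S w = 0"
  obtains a b c k l m where "\<And>v. S v = skew_hermitian a b c k l m v + twist (twist_part S) v"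
    "trace_part S = a + b + c"
proof -
  define a b c where "a = Im (fst (S (1,0,0)))" and "b = Im (fst (snd (S (0,1,0))))" and "c = Im (snd (snd (S (0,0,1))))"
  define k l m where "k = (fst (snd (S (0,0,1))) - \<i> * fst (snd (S (0,0,\<i>)))) / 2"
    and "l = (snd (snd (S (1,0,0))) - \<i> * snd (snd (S (\<i>,0,0)))) / 2"
    and "m = (fst (S (0,1,0)) - \<i> * fst (S (0,\<i>,0))) / 2"
  define T where "T v = skew_hermitian a b c k l m v + twist (twist_part S) v" for v
  obtain q1 q2 q3 where q: "twist_part S = (q1, q2, q3)" by (metis prod_cases3)
  have lT: "linear T"
    by (rule linearI) (auto simp: T_def q scaleR_conv_of_real algebra_simps)
  note sk = skew[of "(1,0,0)" "(1,0,0)"] skew[of "(\<i>,0,0)" "(\<i>,0,0)"] skew[of "(1,0,0)" "(\<i>,0,0)"]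
    skew[of "(0,1,0)" "(0,1,0)"] skew[of "(0,\<i>,0)" "(0,\<i>,0)"] skew[of "(0,1,0)" "(0,\<i>,0)"]
    skew[of "(0,0,1)" "(0,0,1)"] skew[of "(0,0,\<i>)" "(0,0,\<i>)"] skew[of "(0,0,1)" "(0,0,\<i>)"]
    skew[of "(1,0,0)" "(0,1,0)"] skew[of "(\<i>,0,0)" "(0,1,0)"] skew[of "(1,0,0)" "(0,\<i>,0)"] skew[of "(\<i>,0,0)" "(0,\<i>,0)"]
    skew[of "(1,0,0)" "(0,0,1)"] skew[of "(\<i>,0,0)" "(0,0,1)"] skew[of "(1,0,0)" "(0,0,\<i>)"] skew[of "(\<i>,0,0)" "(0,0,\<i>)"]
    skew[of "(0,1,0)" "(0,0,1)"] skew[of "(0,\<i>,0)" "(0,0,1)"] skew[of "(0,1,0)" "(0,0,\<i>)"] skew[of "(0,\<i>,0)" "(0,0,\<i>)"]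
  have "S = T"
  proof (rule linear_c3_eqI[OF assms(1) lT])
    obtain x1 x2 x3 where x: "S (1,0,0) = (x1,x2,x3)" by (metis prod_cases3)
    obtain y1 y2 y3 where y: "S (0,1,0) = (y1,y2,y3)" by (metis prod_cases3)
    obtain z1 z2 z3 where z: "S (0,0,1) = (z1,z2,z3)" by (metis prod_cases3)
    obtain x1' x2' x3' where x': "S (\<i>,0,0) = (x1',x2',x3')" by (metis prod_cases3)
    obtain y1' y2' y3' where y': "S (0,\<i>,0) = (y1',y2',y3')" by (metis prod_cases3)
    obtain z1' z2' z3' where z': "S (0,0,\<i>) = (z1',z2',z3')" by (metis prod_cases3)
    note d = x y z x' y' z'
    note sk' = sk[unfolded d, simplified inner_complex_def inner_Pair, simplified]
    have qq: "q1 = (y3 + \<i> * y3') / 2" "q2 = - (x3 + \<i> * x3') / 2" "q3 = (x2 + \<i> * x2') / 2"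
      using q unfolding twist_part_def d by simp_all
    note defs = T_def q skew_hermitian.simps a_def b_def c_def k_def l_def m_def
    show "S (1,0,0) = T (1,0,0)"
      unfolding defs using sk' by (simp add: d qq complex_eq_iff; (intro conjI)?; argo)
    show "S (\<i>,0,0) = T (\<i>,0,0)"
      unfolding defs using sk' by (simp add: d qq complex_eq_iff; (intro conjI)?; argo)
    show "S (0,1,0) = T (0,1,0)"
      unfolding defs using sk' by (simp add: d qq complex_eq_iff; (intro conjI)?; argo)
    show "S (0,\<i>,0) = T (0,\<i>,0)"
      unfolding defs using sk' by (simp add: d qq complex_eq_iff; (intro conjI)?; argo)
    show "S (0,0,1) = T (0,0,1)"
      unfolding defs using sk' by (simp add: d qq complex_eq_iff; (intro conjI)?; argo)
    show "S (0,0,\<i>) = T (0,0,\<i>)"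
      unfolding defs using sk' by (simp add: d qq complex_eq_iff; (intro conjI)?; argo)
  qed
  then have "S v = skew_hermitian a b c k l m v + twist (twist_part S) v" for v
    by (simp add: T_def)
  moreover have "trace_part S = a + b + c" by (simp add: trace_part_def a_def b_def c_def)
  ultimately show thesis by (rule that)
qed

lemma herm_skew_hermitian:
  "herm (skew_hermitian a b c k l m v) w + herm v (skew_hermitian a b c k l m w) = 0"
  by (cases v; cases w) (simp add: ring_distribs)

lemma herm_twist:
  "herm (twist q v) w + herm v (twist q w) = herm q (crossc v w) - cnj (herm q (crossc v w))"
  by (cases v; cases w; cases q) (simp add: algebra_simps)

lemma vol_skew_hermitian:
  "vol (skew_hermitian a b c k l m u) v w + vol u (skew_hermitian a b c k l m v) w
     + vol u v (skew_hermitian a b c k l m w) = \<i> * complex_of_real (a + b + c) * vol u v w"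
proof -
  have "vol (A * x1 + m * y1 - l' * z1, - m' * x1 + B * y1 + k * z1, l * x1 - k' * y1 + C * z1) (x2,y2,z2) (x3,y3,z3) +
     vol (x1,y1,z1) (A * x2 + m * y2 - l' * z2, - m' * x2 + B * y2 + k * z2, l * x2 - k' * y2 + C * z2) (x3,y3,z3) +
     vol (x1,y1,z1) (x2,y2,z2) (A * x3 + m * y3 - l' * z3, - m' * x3 + B * y3 + k * z3, l * x3 - k' * y3 + C * z3) =
    (A + B + C) * vol (x1,y1,z1) (x2,y2,z2) (x3,y3,z3)"
    for A B C k l m k' l' m' x1 y1 z1 x2 y2 z2 x3 y3 z3
    unfolding vol.simps by algebra
  note key = this
  show ?thesis
    by (cases u; cases v; cases w) (simp only: skew_hermitian.simps key of_real_add distrib_left)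
qed

text \<open>The skew-Hermitian part of \<open>S\<close> preserves the Hermitian form, so that only the antilinear part contributes.\<close>

lemma skew_derivative_kform:
  assumes "linear S" "\<And>v w. S v \<bullet> w + v \<bullet> S w = 0"
  shows "kform (S v) w + kform v (S w) = 2 * Im (herm (twist_part S) (crossc v w))"
proof -
  obtain a b c k l m where S: "\<And>v. S v = skew_hermitian a b c k l m v + twist (twist_part S) v"
    and "trace_part S = a + b + c"
    by (rule skew_decomposition[OF assms]) (rule that)
  let ?H = "skew_hermitian a b c k l m" and ?q = "twist_part S"
  have "herm (S v) w + herm v (S w) =
      (herm (?H v) w + herm v (?H w)) + (herm (twist ?q v) w + herm v (twist ?q w))"
    unfolding S[of v] S[of w] by (simp only: herm_add_left herm_add_right add_ac)
  also have "\<dots> = herm ?q (crossc v w) - cnj (herm ?q (crossc v w))"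
    by (simp only: herm_skew_hermitian herm_twist add_0)
  finally have "Im (herm (S v) w + herm v (S w)) = 2 * Im (herm ?q (crossc v w))" by simp
  then show ?thesis by (simp add: kform_def)
qed

text \<open>The skew-Hermitian part of \<open>S\<close> acts on the determinant by its trace.\<close>

lemma skew_derivative_vol:
  assumes "linear S" "\<And>v w. S v \<bullet> w + v \<bullet> S w = 0"
  shows "vol (S u) v w + vol u (S v) w + vol u v (S w) = \<i> * trace_part S * vol u v w +
    (vol (twist (twist_part S) u) v w + vol u (twist (twist_part S) v) w + vol u v (twist (twist_part S) w))"
proof -
  obtain a b c k l m where S: "\<And>v. S v = skew_hermitian a b c k l m v + twist (twist_part S) v"
    and t: "trace_part S = a + b + c"
    by (rule skew_decomposition[OF assms]) (rule that)
  have tr: "\<i> * trace_part S * vol u v w = vol (skew_hermitian a b c k l m u) v w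
      + vol u (skew_hermitian a b c k l m v) w + vol u v (skew_hermitian a b c k l m w)"
    by (simp only: t vol_skew_hermitian)
  show ?thesis
    unfolding tr S[of u] S[of v] S[of w]
    by (simp only: linear_add[OF linear_vol(1)] linear_add[OF linear_vol(2)] linear_add[OF linear_vol(3)] add_ac)
qed

lemma twist_part_add: "twist_part (\<lambda>v. S v + T v) = twist_part S + twist_part T"
  by (simp add: twist_part_def field_simps)

lemma twist_part_scale: "twist_part (\<lambda>v. r *\<^sub>R S v) = r *\<^sub>R twist_part S"
  by (simp add: twist_part_def scaleR_conv_of_real field_simps)

text \<open>Here \<open>K u\<close> is the connection form in the direction \<open>u\<close>; the assumptions on \<open>F\<close> and \<open>V\<close> are
  \<open>dF = 3 \<Psi>\<^sub>+\<close>, \<open>d\<Psi>\<^sub>+ = 0\<close> and \<open>d\<Psi>\<^sub>- = - 2 F \<and> F\<close> (the last two being the real and the imaginary part of one equation),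
  with exterior derivatives expressed by the torsion-free connection. They form a linear system for the \<open>su(3)\<close>-free
  part of \<open>K\<close>, whose only solution is the stated one.\<close>

lemma intrinsic_torsion:
  fixes K :: "c3 \<Rightarrow> c3 \<Rightarrow> c3"
  assumes K: "bilinear K" and skew: "\<And>u v w. K u v \<bullet> w + v \<bullet> K u w = 0"
    and F: "\<And>u v w. (kform (K u v) w + kform v (K u w)) - (kform (K v u) w + kform u (K v w))
      + (kform (K w u) v + kform u (K w v)) = 3 * Re (vol u v w)"
    and V: "\<And>u v w z.
      (vol (K u v) w z + vol v (K u w) z + vol v w (K u z))
      - (vol (K v u) w z + vol u (K v w) z + vol u w (K v z))
      + (vol (K w u) v z + vol u (K w v) z + vol u v (K w z))
      - (vol (K z u) v w + vol u (K z v) w + vol u v (K z w))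
      = - 4 * \<i> * (kform u v * kform w z - kform u w * kform v z + kform u z * kform v w)"
  shows "twist_part (K (x, y, z)) = (- \<i> / 2 * cnj x, - \<i> / 2 * cnj y, - \<i> / 2 * cnj z)"
    and "trace_part (K u) = 0"
proof -
  have lK: "linear (K u)" for u using K unfolding bilinear_def by blast
  have K_add: "K (u + v) = (\<lambda>w. K u w + K v w)" and K_scale: "K (r *\<^sub>R u) = (\<lambda>w. r *\<^sub>R K u w)" for u v r
    using K by (simp_all add: fun_eq_iff bilinear_ladd bilinear_lmul)
  have lq: "linear (\<lambda>u. twist_part (K u))"
    by (rule linearI) (simp_all only: K_add K_scale twist_part_add twist_part_scale)
  have lt: "linear (\<lambda>u. trace_part (K u))"
    by (rule linearI) (simp_all add: K_add K_scale trace_part_def distrib_left)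
  define q where "q u = twist_part (K u)" for u
  define t where "t u = trace_part (K u)" for u
  note F = F[unfolded skew_derivative_kform[OF lK skew], folded q_def]
  note V = V[unfolded skew_derivative_vol[OF lK skew], folded q_def t_def]
  let ?e = "(1, 0, 0) :: c3" and ?f = "(\<i>, 0, 0) :: c3" and ?g = "(0, 1, 0) :: c3"
    and ?h = "(0, \<i>, 0) :: c3" and ?k = "(0, 0, 1) :: c3" and ?l = "(0, 0, \<i>) :: c3"
  obtain e1 e2 e3 where e: "q ?e = (e1, e2, e3)" by (metis prod_cases3)
  obtain f1 f2 f3 where f: "q ?f = (f1, f2, f3)" by (metis prod_cases3)
  obtain g1 g2 g3 where g: "q ?g = (g1, g2, g3)" by (metis prod_cases3)
  obtain h1 h2 h3 where h: "q ?h = (h1, h2, h3)" by (metis prod_cases3)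
  obtain k1 k2 k3 where k: "q ?k = (k1, k2, k3)" by (metis prod_cases3)
  obtain l1 l2 l3 where l: "q ?l = (l1, l2, l3)" by (metis prod_cases3)

  note Fs = F[of ?e ?f ?g]
    F[of ?e ?f ?h]
    F[of ?e ?f ?k]
    F[of ?e ?f ?l]
    F[of ?e ?g ?h]
    F[of ?e ?g ?k]
    F[of ?e ?g ?l]
    F[of ?e ?h ?k]
    F[of ?e ?h ?l]
    F[of ?e ?k ?l]
    F[of ?f ?g ?h]
    F[of ?f ?g ?k]
    F[of ?f ?g ?l]
    F[of ?f ?h ?k]
    F[of ?f ?h ?l]
    F[of ?f ?k ?l]
    F[of ?g ?h ?k]
    F[of ?g ?h ?l]
    F[of ?g ?k ?l]
    F[of ?h ?k ?l]
  note Vs = V[of ?e ?f ?g ?h]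
    V[of ?e ?f ?g ?k]
    V[of ?e ?f ?g ?l]
    V[of ?e ?f ?h ?k]
    V[of ?e ?f ?h ?l]
    V[of ?e ?f ?k ?l]
    V[of ?e ?g ?h ?k]
    V[of ?e ?g ?h ?l]
    V[of ?e ?g ?k ?l]
    V[of ?e ?h ?k ?l]
    V[of ?f ?g ?h ?k]
    V[of ?f ?g ?h ?l]
    V[of ?f ?g ?k ?l]
    V[of ?f ?h ?k ?l]
    V[of ?g ?h ?k ?l]
  \<comment> \<open>The twenty triples of basis vectors yield one real equation each, the fifteen quadruples one complex equation each.\<close>
  note Fe = Fs[simplified e f g h k l kform_def, simplified]
  note Ve = Vs[simplified e f g h k l kform_def, simplified, simplified complex_eq_iff, simplified]
  have "Re e1 = 0 \<and> Im e1 = -1/2 \<and> Re e2 = 0 \<and> Im e2 = 0 \<and> Re e3 = 0 \<and> Im e3 = 0 \<and> t ?e = 0"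
    by (intro conjI) (use Fe Ve in linarith)+
  then have q_e: "q ?e = (- \<i> / 2, 0, 0)" and t_e: "t ?e = 0"
    by (simp_all add: e complex_eq_iff)
  have "Re f1 = -1/2 \<and> Im f1 = 0 \<and> Re f2 = 0 \<and> Im f2 = 0 \<and> Re f3 = 0 \<and> Im f3 = 0 \<and> t ?f = 0"
    by (intro conjI) (use Fe Ve in linarith)+
  then have q_f: "q ?f = (- 1 / 2, 0, 0)" and t_f: "t ?f = 0"
    by (simp_all add: f complex_eq_iff)
  have "Re g1 = 0 \<and> Im g1 = 0 \<and> Re g2 = 0 \<and> Im g2 = -1/2 \<and> Re g3 = 0 \<and> Im g3 = 0 \<and> t ?g = 0"
    by (intro conjI) (use Fe Ve in linarith)+
  then have q_g: "q ?g = (0, - \<i> / 2, 0)" and t_g: "t ?g = 0"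
    by (simp_all add: g complex_eq_iff)
  have "Re h1 = 0 \<and> Im h1 = 0 \<and> Re h2 = -1/2 \<and> Im h2 = 0 \<and> Re h3 = 0 \<and> Im h3 = 0 \<and> t ?h = 0"
    by (intro conjI) (use Fe Ve in linarith)+
  then have q_h: "q ?h = (0, - 1 / 2, 0)" and t_h: "t ?h = 0"
    by (simp_all add: h complex_eq_iff)
  have "Re k1 = 0 \<and> Im k1 = 0 \<and> Re k2 = 0 \<and> Im k2 = 0 \<and> Re k3 = 0 \<and> Im k3 = -1/2 \<and> t ?k = 0"
    by (intro conjI) (use Fe Ve in linarith)+
  then have q_k: "q ?k = (0, 0, - \<i> / 2)" and t_k: "t ?k = 0"
    by (simp_all add: k complex_eq_iff)
  have "Re l1 = 0 \<and> Im l1 = 0 \<and> Re l2 = 0 \<and> Im l2 = 0 \<and> Re l3 = -1/2 \<and> Im l3 = 0 \<and> t ?l = 0"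
    by (intro conjI) (use Fe Ve in linarith)+
  then have q_l: "q ?l = (0, 0, - 1 / 2)" and t_l: "t ?l = 0"
    by (simp_all add: l complex_eq_iff)
  have "linear (\<lambda>u. case u of (x, y, z) \<Rightarrow> (- \<i> / 2 * cnj x, - \<i> / 2 * cnj y, - \<i> / 2 * cnj z))"
    by (rule linearI) (auto simp: scaleR_conv_of_real algebra_simps)
  then have "q = (\<lambda>u. case u of (x, y, z) \<Rightarrow> (- \<i> / 2 * cnj x, - \<i> / 2 * cnj y, - \<i> / 2 * cnj z))"
    by (intro linear_c3_eqI lq[folded q_def]) (simp_all add: q_e q_f q_g q_h q_k q_l)
  from fun_cong[OF this, of "(x, y, z)"]
  show "twist_part (K (x, y, z)) = (- \<i> / 2 * cnj x, - \<i> / 2 * cnj y, - \<i> / 2 * cnj z)"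
    by (simp add: q_def)
  have "t = (\<lambda>u. 0)"
    by (intro linear_c3_eqI lt[folded t_def] linear_zero) (simp_all add: t_e t_f t_g t_h t_k t_l)
  from fun_cong[OF this, of u] show "trace_part (K u) = 0" by (simp add: t_def)
qed

text \<open>The identity \<open>(a \<times> b) \<cdot> (c \<times> d) = (a \<cdot> c) (b \<cdot> d) - (a \<cdot> d) (b \<cdot> c)\<close>.\<close>

lemma vol_twist:
  "vol (twist (s * cnj x, s * cnj y, s * cnj z) u) v w =
    s * (herm (x, y, z) v * herm u w - herm (x, y, z) w * herm u v)"
  by (cases u; cases v; cases w) (simp add: algebra_simps)

text \<open>These are \<open>\<nabla>\<^sub>u F = u \<rfloor> \<Psi>\<^sub>+\<close> and \<open>\<nabla>\<^sub>u \<Psi>\<^sub>- = - 1/2 u \<rfloor> (F \<and> F)\<close>: the torsion found in \<open>intrinsic_torsion\<close> is inserted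
  into \<open>skew_derivative_kform\<close> and \<open>skew_derivative_vol\<close>.\<close>

lemma nearly_Kaehler_covariant_derivatives:
  fixes K :: "c3 \<Rightarrow> c3 \<Rightarrow> c3"
  assumes K: "bilinear K" and skew: "\<And>u v w. K u v \<bullet> w + v \<bullet> K u w = 0"
    and F: "\<And>u v w. (kform (K u v) w + kform v (K u w)) - (kform (K v u) w + kform u (K v w))
      + (kform (K w u) v + kform u (K w v)) = 3 * Re (vol u v w)"
    and V: "\<And>u v w z.
      (vol (K u v) w z + vol v (K u w) z + vol v w (K u z))
      - (vol (K v u) w z + vol u (K v w) z + vol u w (K v z))
      + (vol (K w u) v z + vol u (K w v) z + vol u v (K w z))
      - (vol (K z u) v w + vol u (K z v) w + vol u v (K z w))
      = - 4 * \<i> * (kform u v * kform w z - kform u w * kform v z + kform u z * kform v w)"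
  shows "kform (K u v) w + kform v (K u w) = Re (vol u v w)"
    and "Im (vol (K u v) w z + vol v (K u w) z + vol v w (K u z)) =
      - (kform u v * kform w z - kform u w * kform v z + kform u z * kform v w)"
proof -
  have lK: "linear (K u)" using K unfolding bilinear_def by blast
  obtain x y z' where u: "u = (x, y, z')" by (metis prod_cases3)
  note q = intrinsic_torsion(1)[OF K skew F V, of x y z', folded u]
  have "Im (herm (- \<i> / 2 * cnj x, - \<i> / 2 * cnj y, - \<i> / 2 * cnj z') (crossc v w)) = Re (vol u v w) / 2"
    by (cases v; cases w) (simp add: u, argo)
  then show "kform (K u v) w + kform v (K u w) = Re (vol u v w)"
    unfolding skew_derivative_kform[OF lK skew] q by simp
  let ?T = "twist (- \<i> / 2 * cnj x, - \<i> / 2 * cnj y, - \<i> / 2 * cnj z')"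
  have T: "vol (?T a) b c = - \<i> / 2 * (herm u b * herm a c - herm u c * herm a b)" for a b c
    unfolding u by (rule vol_twist)
  have h: "herm a b - herm b a = 2 * \<i> * kform a b" for a b
    by (simp add: kform_def complex_eq_iff herm_commute[of b a])
  have "vol (?T v) w z + vol v (?T w) z + vol v w (?T z) = vol (?T v) w z - vol (?T w) v z + vol (?T z) v w"
    using vol_swap(1)[of v "?T w" z] vol_swap(2)[of v "?T z" w] vol_swap(1)[of v "?T z" w] by simp
  also have "\<dots> = - \<i> / 2 * (herm u w * (herm v z - herm z v) - herm u z * (herm v w - herm w v)
      - herm u v * (herm w z - herm z w))"
    unfolding T by (simp add: algebra_simps)
  also have "\<dots> = herm u w * kform v z - herm u z * kform v w - herm u v * kform w z"
    unfolding h by (simp add: algebra_simps)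
  finally have "Im (vol (?T v) w z + vol v (?T w) z + vol v w (?T z)) =
      kform u w * kform v z - kform u z * kform v w - kform u v * kform w z"
    by (simp add: kform_def)
  then show "Im (vol (K u v) w z + vol v (K u w) z + vol v w (K u z)) =
      - (kform u v * kform w z - kform u w * kform v z + kform u z * kform v w)"
    unfolding skew_derivative_vol[OF lK skew] q intrinsic_torsion(2)[OF K skew F V] by simp
qed

section \<open>Forms on a hyperplane of complex three-space\<close>

text \<open>For \<open>|a|\<^sup>2 + |b|\<^sup>2 = 1\<close>, the element of \<open>SU(2)\<close> acting on the first and the third coordinate that sends \<open>(a, b)\<close> to
  \<open>(0, i)\<close>; \<open>rot'\<close> acts on the second and the third one.\<close>

fun rot :: "complex \<Rightarrow> complex \<Rightarrow> c3 \<Rightarrow> c3" where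
  "rot a b (x, y, z) = (- \<i> * b * x + \<i> * a * z, y, \<i> * cnj a * x + \<i> * cnj b * z)"

fun rot' :: "complex \<Rightarrow> complex \<Rightarrow> c3 \<Rightarrow> c3" where
  "rot' a b (x, y, z) = (x, - \<i> * b * y + \<i> * a * z, \<i> * cnj a * y + \<i> * cnj b * z)"

lemma linear_rot: "linear (rot a b)" "linear (rot' a b)"
  by (rule linearI; auto simp: scaleR_conv_of_real algebra_simps)+

lemma herm_rot:
  assumes "a * cnj a + b * cnj b = 1"
  shows "herm (rot a b v) (rot a b w) = herm v w" "herm (rot' a b v) (rot' a b w) = herm v w"
proof -
  have "cnj (- \<i> * b * x + \<i> * a * y) * (- \<i> * b * z + \<i> * a * t) + cnj (\<i> * cnj a * x + \<i> * cnj b * y) * (\<i> * cnj a * z + \<i> * cnj b * t) =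
    cnj x * z + cnj y * t" for x y z t
  proof -
    have "cnj (- \<i> * b * x + \<i> * a * y) * (- \<i> * b * z + \<i> * a * t) + cnj (\<i> * cnj a * x + \<i> * cnj b * y) * (\<i> * cnj a * z + \<i> * cnj b * t) =
      (a * cnj a + b * cnj b) * (cnj x * z + cnj y * t)"
      by (simp add: algebra_simps)
    then show ?thesis using assms by simp
  qed
  note key = this
  show "herm (rot a b v) (rot a b w) = herm v w"
  proof (cases v, cases w)
    fix x1 y1 z1 x2 y2 z2 assume "v = (x1, y1, z1)" "w = (x2, y2, z2)"
    then show ?thesis using key[of x1 z1 x2 z2] by (simp del: complex_cnj_add complex_cnj_diff, algebra?)
  qed
  show "herm (rot' a b v) (rot' a b w) = herm v w"
  proof (cases v, cases w)
    fix x1 y1 z1 x2 y2 z2 assume "v = (x1, y1, z1)" "w = (x2, y2, z2)"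
    then show ?thesis using key[of y1 z1 y2 z2] by (simp del: complex_cnj_add complex_cnj_diff, algebra?)
  qed
qed

lemma vol_rot:
  assumes "a * cnj a + b * cnj b = 1"
  shows "vol (rot a b u) (rot a b v) (rot a b w) = vol u v w"
    "vol (rot' a b u) (rot' a b v) (rot' a b w) = vol u v w"
proof -
  have key: "vol (- j * b * x1 + j * a * z1, y1, j * a' * x1 + j * b' * z1)
      (- j * b * x2 + j * a * z2, y2, j * a' * x2 + j * b' * z2)
      (- j * b * x3 + j * a * z3, y3, j * a' * x3 + j * b' * z3) =
    - (j * j) * (a * a' + b * b') * vol (x1, y1, z1) (x2, y2, z2) (x3, y3, z3)"
    for j a b a' b' x1 y1 z1 x2 y2 z2 x3 y3 z3
    unfolding vol.simps by algebra
  have key': "vol (x1, - j * b * y1 + j * a * z1, j * a' * y1 + j * b' * z1)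
      (x2, - j * b * y2 + j * a * z2, j * a' * y2 + j * b' * z2)
      (x3, - j * b * y3 + j * a * z3, j * a' * y3 + j * b' * z3) =
    - (j * j) * (a * a' + b * b') * vol (x1, y1, z1) (x2, y2, z2) (x3, y3, z3)"
    for j a b a' b' x1 y1 z1 x2 y2 z2 x3 y3 z3
    unfolding vol.simps by algebra
  show "vol (rot a b u) (rot a b v) (rot a b w) = vol u v w"
    by (cases u; cases v; cases w) (simp only: rot.simps key assms, simp)
  show "vol (rot' a b u) (rot' a b v) (rot' a b w) = vol u v w"
    by (cases u; cases v; cases w) (simp only: rot'.simps key' assms, simp)
qed

text \<open>Two rotations suffice: \<open>rot'\<close> makes the second coordinate of \<open>m\<close> vanish and the third one purely imaginary, and
  then \<open>rot\<close> makes the first one vanish. The vector \<open>(0, 0, i)\<close> is \<open>e\<^sub>6\<close>.\<close>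

lemma SU3_transitive:
  assumes "m \<bullet> m = 1"
  obtains R where "linear R" "\<And>v w. herm (R v) (R w) = herm v w"
    "\<And>u v w. vol (R u) (R v) (R w) = vol u v w" "R m = (0, 0, \<i>)"
proof -
  obtain x y z where m: "m = (x, y, z)" by (metis prod_cases3)
  have n: "x * cnj x + y * cnj y + z * cnj z = 1"
  proof -
    have "herm m m = 1" using Re_herm[of m m] kform_self[of m] assms
      by (simp add: complex_eq_iff kform_def del: kform_self)
    then show ?thesis by (simp add: m mult.commute)
  qed
  define r where "r = sqrt ((cmod y)\<^sup>2 + (cmod z)\<^sup>2)"
  have r2: "complex_of_real r * complex_of_real r = y * cnj y + z * cnj z"
  proof -
    have "complex_of_real r * complex_of_real r = complex_of_real ((cmod y)\<^sup>2 + (cmod z)\<^sup>2)"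
      by (simp add: r_def flip: of_real_mult)
    then show ?thesis by (simp only: of_real_add complex_norm_square)
  qed
  \<comment> \<open>The case distinction only serves to normalise \<open>(y, z)\<close>; for \<open>y = z = 0\<close> any rotation will do.\<close>
  obtain a b :: complex where ab: "a * cnj a + b * cnj b = 1" "y = r * a" "z = r * b"
  proof (cases "r = 0")
    case True
    then have "y = 0" "z = 0" by (simp_all add: r_def add_nonneg_eq_0_iff)
    then show thesis using that[of 0 1] True by simp
  next
    case False
    have "(y / r) * cnj (y / r) + (z / r) * cnj (z / r) = (y * cnj y + z * cnj z) / (complex_of_real r * complex_of_real r)"
      by (simp add: add_divide_distrib)
    also have "\<dots> = 1" unfolding r2[symmetric] using False by simp
    finally show thesis using that[of "y / of_real r" "z / of_real r"] False by simp
  qed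
  have n': "x * cnj x + (\<i> * r) * cnj (\<i> * r) = 1" using n r2 by (simp add: algebra_simps)
  define R where "R v = rot x (\<i> * r) (rot' a b v)" for v
  have "linear R" unfolding R_def
    using linear_compose[OF linear_rot(2) linear_rot(1)] by (simp add: comp_def)
  moreover have rm: "rot' a b m = (x, 0, \<i> * r)"
  proof -
    have "\<i> * cnj a * y + \<i> * cnj b * z = \<i> * r * (a * cnj a + b * cnj b)"
      unfolding ab(2,3) by (simp add: algebra_simps)
    then show ?thesis unfolding m using ab by simp
  qed
  have "R m = (0, 0, \<i>)"
  proof -
    have "\<i> * cnj x * x + \<i> * cnj (\<i> * r) * (\<i> * r) = \<i> * (x * cnj x + (\<i> * r) * cnj (\<i> * r))"
      by (simp add: algebra_simps)
    moreover have "- \<i> * (\<i> * r) * x + \<i> * x * (\<i> * r) = 0" by (simp add: algebra_simps)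
    ultimately show ?thesis
      by (simp only: R_def rm rot.simps n' mult_1_right)
  qed
  ultimately show thesis
    using that[of R] herm_rot[OF ab(1)] herm_rot[OF n'] vol_rot[OF ab(1)] vol_rot[OF n']
    by (simp add: R_def)
qed

text \<open>With \<open>m\<close> moved to \<open>e\<^sub>6\<close>, the orthogonal complement of \<open>m\<close> consists of the vectors with real third
  coordinate. This reduces the following three lemmas to identities between polynomials.\<close>

lemma hyperplane_normal_form:
  assumes "m \<bullet> m = 1"
  obtains R where "linear R" "inj R" "\<And>v w. kform (R v) (R w) = kform v w" "\<And>v w. R v \<bullet> R w = v \<bullet> w"
    "\<And>u v w. vol (R u) (R v) (R w) = vol u v w" "R m = (0, 0, \<i>)"
    "\<And>v. v \<bullet> m = 0 \<Longrightarrow> \<exists>x y r. R v = (x, y, complex_of_real r)"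
proof -
  obtain R where R: "linear R" "\<And>v w. herm (R v) (R w) = herm v w"
    "\<And>u v w. vol (R u) (R v) (R w) = vol u v w" "R m = (0, 0, \<i>)"
    using SU3_transitive[OF assms] by metis
  have i: "R v \<bullet> R w = v \<bullet> w" for v w by (simp only: Re_herm[symmetric] R(2))
  have "\<exists>x y r. R v = (x, y, complex_of_real r)" if "v \<bullet> m = 0" for v
  proof -
    obtain x y z where v: "R v = (x, y, z)" by (metis prod_cases3)
    have "R v \<bullet> R m = 0" using that i by simp
    then have "Im z = 0" by (simp add: v R(4) inner_complex_def)
    then have "z = of_real (Re z)" by (simp add: complex_eq_iff)
    then show ?thesis using v by metis
  qed
  moreover have "inj R"
    unfolding linear_injective_0[OF R(1)]
  proof (intro allI impI)
    fix v assume "R v = 0"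
    then have "v \<bullet> v = 0" using i[of v v] by simp
    then show "v = 0" by simp
  qed
  ultimately show thesis using that[of R] R i by (simp add: kform_def)
qed

text \<open>The restriction of \<open>\<Psi>\<^sub>+\<close> to the hyperplane is \<open>\<eta> \<and> \<omega>\<^sub>2\<close>.\<close>

lemma hyperplane_vol:
  assumes "m \<bullet> m = 1" "x \<bullet> m = 0" "y \<bullet> m = 0" "z \<bullet> m = 0"
  shows "Re (vol x y z) = - kform m x * Im (vol m y z) + kform m y * Im (vol m x z) - kform m z * Im (vol m x y)"
proof -
  obtain R where R: "\<And>v w. kform (R v) (R w) = kform v w"
    "\<And>u v w. vol (R u) (R v) (R w) = vol u v w" "R m = (0, 0, \<i>)"
    "\<And>v. v \<bullet> m = 0 \<Longrightarrow> \<exists>x y r. R v = (x, y, complex_of_real r)"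
    using hyperplane_normal_form[OF assms(1)] by metis
  obtain x1 x2 x3 y1 y2 y3 z1 z2 z3 where v: "R x = (x1, x2, complex_of_real x3)"
    "R y = (y1, y2, complex_of_real y3)" "R z = (z1, z2, complex_of_real z3)"
    using R(4)[OF assms(2)] R(4)[OF assms(3)] R(4)[OF assms(4)] by blast
  have "Re (vol (R x) (R y) (R z)) = - kform (R m) (R x) * Im (vol (R m) (R y) (R z))
      + kform (R m) (R y) * Im (vol (R m) (R x) (R z)) - kform (R m) (R z) * Im (vol (R m) (R x) (R y))"
    unfolding v R(3) by (simp add: kform_def algebra_simps)
  then show ?thesis unfolding R(1,2) .
qed

lemma hyperplane_SU2_relations:
  assumes "m \<bullet> m = 1" "x \<bullet> m = 0" "y \<bullet> m = 0" "z \<bullet> m = 0" "w \<bullet> m = 0"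
  shows "wedge22 (\<lambda>v w. Re (vol m v w)) (\<lambda>v w. Re (vol m v w)) x y z w = wedge22 kform kform x y z w"
    and "wedge22 (\<lambda>v w. Im (vol m v w)) (\<lambda>v w. Im (vol m v w)) x y z w = wedge22 kform kform x y z w"
    and "wedge22 (\<lambda>v w. Re (vol m v w)) (\<lambda>v w. Im (vol m v w)) x y z w = 0"
    and "wedge22 kform (\<lambda>v w. Re (vol m v w)) x y z w = 0"
    and "wedge22 kform (\<lambda>v w. Im (vol m v w)) x y z w = 0"
proof -
  obtain R where R: "\<And>v w. kform (R v) (R w) = kform v w"
    "\<And>u v w. vol (R u) (R v) (R w) = vol u v w" "R m = (0, 0, \<i>)"
    "\<And>v. v \<bullet> m = 0 \<Longrightarrow> \<exists>x y r. R v = (x, y, complex_of_real r)"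
    using hyperplane_normal_form[OF assms(1)] by metis
  obtain x1 x2 x3 y1 y2 y3 z1 z2 z3 w1 w2 w3 where v: "R x = (x1, x2, complex_of_real x3)"
    "R y = (y1, y2, complex_of_real y3)" "R z = (z1, z2, complex_of_real z3)"
    "R w = (w1, w2, complex_of_real w3)"
    using R(4)[OF assms(2)] R(4)[OF assms(3)] R(4)[OF assms(4)] R(4)[OF assms(5)] by blast
  have "wedge22 (\<lambda>v w. Re (vol (R m) v w)) (\<lambda>v w. Re (vol (R m) v w)) (R x) (R y) (R z) (R w) =
      wedge22 kform kform (R x) (R y) (R z) (R w)"
    "wedge22 (\<lambda>v w. Im (vol (R m) v w)) (\<lambda>v w. Im (vol (R m) v w)) (R x) (R y) (R z) (R w) =
      wedge22 kform kform (R x) (R y) (R z) (R w)"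
    "wedge22 (\<lambda>v w. Re (vol (R m) v w)) (\<lambda>v w. Im (vol (R m) v w)) (R x) (R y) (R z) (R w) = 0"
    "wedge22 kform (\<lambda>v w. Re (vol (R m) v w)) (R x) (R y) (R z) (R w) = 0"
    "wedge22 kform (\<lambda>v w. Im (vol (R m) v w)) (R x) (R y) (R z) (R w) = 0"
    unfolding v R(3) by (simp_all add: wedge22_def kform_def, algebra+)
  then show "wedge22 (\<lambda>v w. Re (vol m v w)) (\<lambda>v w. Re (vol m v w)) x y z w = wedge22 kform kform x y z w"
    "wedge22 (\<lambda>v w. Im (vol m v w)) (\<lambda>v w. Im (vol m v w)) x y z w = wedge22 kform kform x y z w"
    "wedge22 (\<lambda>v w. Re (vol m v w)) (\<lambda>v w. Im (vol m v w)) x y z w = 0"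
    "wedge22 kform (\<lambda>v w. Re (vol m v w)) x y z w = 0"
    "wedge22 kform (\<lambda>v w. Im (vol m v w)) x y z w = 0"
    by (simp_all only: wedge22_def R(1,2))
qed

text \<open>The frame corresponds to \<open>e\<^sub>1, \<dots>, e\<^sub>5\<close>. For the last property, testing \<open>x \<rfloor> \<omega>\<^sub>1 = y \<rfloor> \<omega>\<^sub>2\<close> on the first four of them
  determines the components of \<open>y\<close> along these vectors from those of \<open>x\<close>, and \<open>\<omega>\<^sub>3(x,y)\<close> becomes the sum of the
  squares of the latter.\<close>

lemma hyperplane_adapted_frame:
  assumes "m \<bullet> m = 1"
  obtains a b c d e where "a \<bullet> m = 0" "b \<bullet> m = 0" "c \<bullet> m = 0" "d \<bullet> m = 0" "e \<bullet> m = 0"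
    "kform m a = 0" "kform m b = 0" "kform m c = 0" "kform m d = 0" "kform m e \<noteq> 0"
    "wedge22 kform kform a b c d \<noteq> 0"
    "\<And>x y. x \<bullet> m = 0 \<Longrightarrow> y \<bullet> m = 0 \<Longrightarrow> (\<And>z. z \<in> {a, b, c, d} \<Longrightarrow> kform x z = Im (vol m y z)) \<Longrightarrow> - Re (vol m x y) \<ge> 0"
proof -
  obtain R where R: "linear R" "inj R" "\<And>v w. kform (R v) (R w) = kform v w" "\<And>v w. R v \<bullet> R w = v \<bullet> w"
    "\<And>u v w. vol (R u) (R v) (R w) = vol u v w" "R m = (0, 0, \<i>)"
    "\<And>v. v \<bullet> m = 0 \<Longrightarrow> \<exists>x y r. R v = (x, y, complex_of_real r)"
    using hyperplane_normal_form[OF assms(1)] by metis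
  have "surj R" by (intro linear_injective_imp_surjective R(1,2) refl)
  note ex = surjD[OF this]
  from ex[of "(1, 0, 0)"] obtain a where a: "R a = (1, 0, 0)" by auto
  from ex[of "(\<i>, 0, 0)"] obtain b where b: "R b = (\<i>, 0, 0)" by auto
  from ex[of "(0, 1, 0)"] obtain c where c: "R c = (0, 1, 0)" by auto
  from ex[of "(0, \<i>, 0)"] obtain d where d: "R d = (0, \<i>, 0)" by auto
  from ex[of "(0, 0, 1)"] obtain e where e: "R e = (0, 0, 1)" by auto
  note f = a b c d e
  show thesis
  proof (rule that[of a b c d e])
    show "a \<bullet> m = 0" "b \<bullet> m = 0" "c \<bullet> m = 0" "d \<bullet> m = 0" "e \<bullet> m = 0"
      using R(4)[of a m] R(4)[of b m] R(4)[of c m] R(4)[of d m] R(4)[of e m]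
      by (simp_all add: f R(6) inner_complex_def)
    show "kform m a = 0" "kform m b = 0" "kform m c = 0" "kform m d = 0" "kform m e \<noteq> 0"
      using R(3)[of m a] R(3)[of m b] R(3)[of m c] R(3)[of m d] R(3)[of m e]
      unfolding f R(6) by (simp_all add: kform_def[of "(_, _)"])
    show "wedge22 kform kform a b c d \<noteq> 0"
    proof -
      have "wedge22 kform kform (R a) (R b) (R c) (R d) \<noteq> 0"
        unfolding f by (simp add: wedge22_def kform_def)
      then show ?thesis by (simp only: wedge22_def R(3) not_False_eq_True)
    qed
  next
    fix x y assume xy: "x \<bullet> m = 0" "y \<bullet> m = 0" and z: "\<And>z. z \<in> {a, b, c, d} \<Longrightarrow> kform x z = Im (vol m y z)"
    obtain x1 x2 x3 y1 y2 y3 where v: "R x = (x1, x2, complex_of_real x3)" "R y = (y1, y2, complex_of_real y3)"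
      using R(7)[OF xy(1)] R(7)[OF xy(2)] by blast
    have "kform (R x) (R z) = Im (vol (R m) (R y) (R z))" if "z \<in> {a, b, c, d}" for z
      using z[OF that] by (simp only: R(3,5))
    from this[of a] this[of b] this[of c] this[of d]
    have "Im x1 = Re y2" "Re x1 = Im y2" "Im x2 = - Re y1" "Re x2 = - Im y1"
      unfolding v f R(6) by (simp_all add: kform_def)
    then have "- Re (vol (R m) (R x) (R y)) = (Re x1)\<^sup>2 + (Im x1)\<^sup>2 + (Re x2)\<^sup>2 + (Im x2)\<^sup>2"
      unfolding v R(6) by (simp add: power2_eq_square algebra_simps)
    then show "- Re (vol m x y) \<ge> 0" by (simp add: R(5))
  qed
qed

section \<open>Frames and the Levi-Civita connection\<close>

text \<open>The vector described by the Koszul formula exists and is unique, because the linear isomorphism \<open>L\<close> turns the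
  metric at \<open>x\<close> into the Euclidean inner product, for which every linear functional is represented by a vector.\<close>

lemma christoffel_eqI:
  fixes h :: "'e::euclidean_space \<Rightarrow> 'e \<Rightarrow> 'e \<Rightarrow> real" and L :: "'e \<Rightarrow> 'c::euclidean_space"
  assumes L: "linear L" "inj L" "surj L" and h: "\<And>a b. h x a b = L a \<bullet> L b"
    and r: "linear (\<lambda>z. frechet_derivative (\<lambda>y. h y b z) (at x) a + frechet_derivative (\<lambda>y. h y a z) (at x) b
        - frechet_derivative (\<lambda>y. h y a b) (at x) z)" (is "linear ?r")
  shows "2 * (L (christoffel h x a b) \<bullet> L z) = ?r z"
proof -
  obtain L' where L': "linear L'" "L \<circ> L' = id"
    using linear_surjective_right_inverse[OF L(1,3)] by blast
  \<comment> \<open>the vector representing the functional on the right-hand side, transported by \<open>L\<close>\<close>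
  define s where "s = (\<Sum>i\<in>Basis. ?r (L' i) *\<^sub>R i)"
  have s: "s \<bullet> L z = ?r z" for z
  proof -
    have l: "linear (\<lambda>v. ?r (L' v))" using linear_compose[OF L'(1) r] by (simp add: comp_def)
    have "L (L' (L z)) = L z" using L'(2) by (metis comp_apply id_apply)
    then have "L' (L z) = z" using L(2) by (simp add: inj_eq)
    then have "?r z = ?r (L' (L z))" by simp
    also have "\<dots> = (\<Sum>i\<in>Basis. (L z \<bullet> i) *\<^sub>R ?r (L' i))"
      by (rule linear_Basis_expansion[OF l])
    also have "\<dots> = s \<bullet> L z"
      by (simp add: s_def inner_sum_left inner_commute[of "L z"] mult.commute)
    finally show ?thesis by simp
  qed
  obtain w where w: "L w = s /\<^sub>R 2" using L(3) by (metis surjD)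
  have "christoffel h x a b = w"
    unfolding christoffel_def
  proof (rule the_equality)
    show "\<forall>z. 2 * h x w z = ?r z" by (simp add: h w s)
    fix w' assume w': "\<forall>z. 2 * h x w' z = ?r z"
    have "L (w' - w) \<bullet> L (w' - w) = h x w' (w' - w) - h x w (w' - w)"
      by (simp add: h linear_diff[OF L(1)] inner_diff_left)
    also have "\<dots> = 0" using w'[rule_format, of "w' - w"] s[of "w' - w"] by (simp add: h w)
    finally have "L w' = L w" by (simp add: linear_diff[OF L(1)])
    then show "w' = w" using L(2) by (simp add: inj_eq)
  qed
  then show ?thesis by (simp add: w s)
qed

text \<open>\<open>K\<close> is the covariant derivative of the coframe \<open>\<theta>\<close>, with both arguments expressed in the coframe. That it is skew
  says that the connection is metric, and the symmetry of the Christoffel symbols is the absence of torsion; both come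
  from the Koszul formula.\<close>

lemma frame_connection:
  fixes \<theta> :: "'e::euclidean_space \<Rightarrow> 'e \<Rightarrow> 'c::euclidean_space"
  assumes V: "open V" "x \<in> V" and dim: "DIM('e) = DIM('c)"
    and lin: "\<And>y. y \<in> V \<Longrightarrow> linear (\<theta> y)" and inj: "inj (\<theta> x)"
    and sm: "\<And>a. smooth_on V (\<lambda>y. \<theta> y a)"
    and h: "\<And>y a b. y \<in> V \<Longrightarrow> h y a b = \<theta> y a \<bullet> \<theta> y b"
  obtains K where "bilinear K" "\<And>u v w. K u v \<bullet> w + v \<bullet> K u w = 0"
    "\<And>a u. frechet_derivative (\<lambda>y. \<theta> y a) (at x) u = K (\<theta> x u) (\<theta> x a) + \<theta> x (christoffel h x u a)"
    "\<And>a u. christoffel h x u a = christoffel h x a u"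
proof -
  define D where "D a u = frechet_derivative (\<lambda>y. \<theta> y a) (at x) u" for a u
  define \<Gamma> where "\<Gamma> = christoffel h x"
  have DD: "((\<lambda>y. \<theta> y a) has_derivative D a) (at x)" for a
    unfolding D_def by (rule smooth_on_has_derivative[OF sm V(2)])
  have D_lin: "linear (D a)" for a by (rule has_derivative_linear[OF DD])
  have D_add: "D (a + b) u = D a u + D b u" for a b u
  proof -
    have "((\<lambda>y. \<theta> y a + \<theta> y b) has_derivative (\<lambda>u. D a u + D b u)) (at x)"
      by (intro has_derivative_add DD)
    then have "((\<lambda>y. \<theta> y (a + b)) has_derivative (\<lambda>u. D a u + D b u)) (at x)"
      by (rule has_derivative_transform_within_open[OF _ V]) (simp add: linear_add[OF lin])
    from has_derivative_unique[OF DD this] show ?thesis by metis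
  qed
  have D_scale: "D (r *\<^sub>R a) u = r *\<^sub>R D a u" for a r u
  proof -
    have "((\<lambda>y. r *\<^sub>R \<theta> y a) has_derivative (\<lambda>u. r *\<^sub>R D a u)) (at x)"
      by (intro has_derivative_scaleR_right DD)
    then have "((\<lambda>y. \<theta> y (r *\<^sub>R a)) has_derivative (\<lambda>u. r *\<^sub>R D a u)) (at x)"
      by (rule has_derivative_transform_within_open[OF _ V]) (simp add: linear_scale[OF lin])
    from has_derivative_unique[OF DD this] show ?thesis by metis
  qed
  let ?L = "\<theta> x"
  have L: "linear ?L" by (rule lin[OF V(2)])
  have Dh: "frechet_derivative (\<lambda>y. h y a b) (at x) u = D a u \<bullet> ?L b + ?L a \<bullet> D b u" for a b u
  proof -
    have "((\<lambda>y. \<theta> y a \<bullet> \<theta> y b) has_derivative (\<lambda>u. ?L a \<bullet> D b u + D a u \<bullet> ?L b)) (at x)"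
      by (intro has_derivative_inner DD)
    then have "((\<lambda>y. h y a b) has_derivative (\<lambda>u. ?L a \<bullet> D b u + D a u \<bullet> ?L b)) (at x)"
      by (rule has_derivative_transform_within_open[OF _ V]) (simp add: h)
    from frechet_derivativeI[OF this] show ?thesis by simp
  qed
  have surj: "surj ?L"
    by (rule linear_injective_imp_surjective[OF L inj]) (simp add: dim)
  have \<Gamma>: "2 * (?L (\<Gamma> a b) \<bullet> ?L z) = (D b a \<bullet> ?L z + ?L b \<bullet> D z a) + (D a b \<bullet> ?L z + ?L a \<bullet> D z b)
      - (D a z \<bullet> ?L b + ?L a \<bullet> D b z)" for a b z
    unfolding \<Gamma>_def
    by (subst christoffel_eqI[where h = h and L = ?L, OF L inj surj h[OF V(2)]])
      (auto intro!: linearI simp: Dh D_add D_scale linear_add[OF L] linear_scale[OF L]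
        linear_add[OF D_lin] linear_scale[OF D_lin] inner_add_left inner_add_right algebra_simps)
  have eqI: "a = b" if "\<And>z. ?L a \<bullet> ?L z = ?L b \<bullet> ?L z" for a b
  proof -
    have "?L (a - b) \<bullet> ?L (a - b) = 0" using that[of "a - b"] by (simp add: linear_diff[OF L] inner_diff_left)
    then have "?L a = ?L b" by (simp add: linear_diff[OF L])
    then show ?thesis using inj by (simp add: inj_eq)
  qed
  have \<Gamma>_sym: "\<Gamma> a b = \<Gamma> b a" for a b
  proof (rule eqI)
    fix z show "?L (\<Gamma> a b) \<bullet> ?L z = ?L (\<Gamma> b a) \<bullet> ?L z"
      using \<Gamma>[of a b z] \<Gamma>[of b a z] by (simp add: inner_commute)
  qed
  have \<Gamma>_add: "\<Gamma> a (b + b') = \<Gamma> a b + \<Gamma> a b'" for a b b'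
  proof (rule eqI)
    fix z show "?L (\<Gamma> a (b + b')) \<bullet> ?L z = ?L (\<Gamma> a b + \<Gamma> a b') \<bullet> ?L z"
      using \<Gamma>[of a b z] \<Gamma>[of a b' z] \<Gamma>[of a "b + b'" z]
      by (simp add: linear_add[OF L] linear_add[OF D_lin] D_add inner_add_left inner_add_right)
  qed
  have \<Gamma>_scale: "\<Gamma> a (r *\<^sub>R b) = r *\<^sub>R \<Gamma> a b" for a b r
  proof (rule eqI)
    fix z
    have "2 * (?L (\<Gamma> a (r *\<^sub>R b)) \<bullet> ?L z) = r * (2 * (?L (\<Gamma> a b) \<bullet> ?L z))"
      unfolding \<Gamma> by (simp add: linear_scale[OF L] linear_scale[OF D_lin] D_scale algebra_simps)
    then show "?L (\<Gamma> a (r *\<^sub>R b)) \<bullet> ?L z = ?L (r *\<^sub>R \<Gamma> a b) \<bullet> ?L z"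
      by (simp add: linear_scale[OF L])
  qed
  obtain L' where L': "linear L'" "L' \<circ> ?L = id" "?L \<circ> L' = id"
  proof -
    obtain L' where L': "linear L'" "L' \<circ> ?L = id" using linear_injective_left_inverse[OF L inj] by blast
    have "?L \<circ> L' = id"
    proof
      fix v
      obtain a where "v = ?L a" using surj by (metis surjD)
      then show "(?L \<circ> L') v = id v" using fun_cong[OF L'(2), of a] by simp
    qed
    then show thesis using that L' by blast
  qed
  have L'L: "L' (?L a) = a" and LL': "?L (L' v) = v" for a v
    using L'(2,3) by (metis comp_apply id_apply)+
  define K where "K v w = D (L' w) (L' v) - ?L (\<Gamma> (L' v) (L' w))" for v w
  have "bilinear K"
    unfolding bilinear_def
  proof (intro conjI allI linearI)
    show "K v (w + w') = K v w + K v w'" for v w w'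
      by (simp add: K_def linear_add[OF L'(1)] D_add \<Gamma>_add linear_add[OF L])
    show "K v (r *\<^sub>R w) = r *\<^sub>R K v w" for v w r
      by (simp add: K_def linear_scale[OF L'(1)] D_scale \<Gamma>_scale linear_scale[OF L] scaleR_diff_right)
    show "K (v + v') w = K v w + K v' w" for v v' w
      by (simp add: K_def linear_add[OF L'(1)] linear_add[OF D_lin] \<Gamma>_sym[of _ "L' w"] \<Gamma>_add linear_add[OF L])
    show "K (r *\<^sub>R v) w = r *\<^sub>R K v w" for v w r
      by (simp add: K_def linear_scale[OF L'(1)] linear_scale[OF D_lin] \<Gamma>_sym[of _ "L' w"] \<Gamma>_scale
          linear_scale[OF L] scaleR_diff_right)
  qed
  moreover have "K u v \<bullet> w + v \<bullet> K u w = 0" for u v w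
    using \<Gamma>[of "L' u" "L' v" "L' w"] \<Gamma>[of "L' u" "L' w" "L' v"]
    by (simp add: K_def LL' inner_diff_left inner_diff_right inner_commute)
  moreover have "D a u = K (?L u) (?L a) + ?L (\<Gamma> u a)" for a u
    by (simp add: K_def L'L)
  ultimately show thesis using that[of K] \<Gamma>_sym by (simp add: D_def \<Gamma>_def)
qed

section \<open>Nearly Kaehler structures in a frame\<close>

text \<open>In the alternating sums of the exterior derivatives the symmetric Christoffel symbols \<open>\<Gamma>\<close> cancel, and the
  hypotheses of \<open>nearly_Kaehler_covariant_derivatives\<close> for the connection form \<open>K\<close> remain. The equation for \<open>\<Psi>\<^sub>-\<close>
  is only required at \<open>x\<close>, but the one for \<open>F\<close> around \<open>x\<close>, since \<open>d\<Psi>\<^sub>+ = 0\<close> is obtained by differentiating it.\<close>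

lemma nearly_Kaehler_frame:
  fixes \<theta> :: "'e::euclidean_space \<Rightarrow> 'e \<Rightarrow> c3" and A P Q :: "'e \<Rightarrow> 'e list \<Rightarrow> real"
  assumes V: "open V" "x \<in> V" and surj: "surj (\<theta> x)"
    and sm: "\<And>a. smooth_on V (\<lambda>y. \<theta> y a)"
    and K: "bilinear K" and skew: "\<And>u v w. K u v \<bullet> w + v \<bullet> K u w = 0"
    and D: "\<And>a u. frechet_derivative (\<lambda>y. \<theta> y a) (at x) u = K (\<theta> x u) (\<theta> x a) + \<theta> x (\<Gamma> u a)"
    and \<Gamma>: "\<And>a u. \<Gamma> u a = \<Gamma> a u"
    and A: "\<And>y a b. y \<in> V \<Longrightarrow> A y [a, b] = kform (\<theta> y a) (\<theta> y b)"
    and P: "\<And>y a b c. y \<in> V \<Longrightarrow> P y [a, b, c] = Re (vol (\<theta> y a) (\<theta> y b) (\<theta> y c))"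
    and Q: "\<And>y a b c. y \<in> V \<Longrightarrow> Q y [a, b, c] = Im (vol (\<theta> y a) (\<theta> y b) (\<theta> y c))"
    and dA: "\<And>y a b c. y \<in> V \<Longrightarrow> local_ext_deriv A y [a, b, c] = 3 * P y [a, b, c]"
    and dQ: "\<And>a b c d. local_ext_deriv Q x [a, b, c, d] =
      - 2 * wedge22 kform kform (\<theta> x a) (\<theta> x b) (\<theta> x c) (\<theta> x d)"
  shows "kform (K u v) w + kform v (K u w) = Re (vol u v w)"
    and "Im (vol (K u v) w z + vol v (K u w) z + vol v w (K u z)) =
      - (kform u v * kform w z - kform u w * kform v z + kform u z * kform v w)"
proof -
  define T where "T = \<theta> x"
  define G where "G u a = T (\<Gamma> u a)" for u a
  have G: "G u a = G a u" for u a unfolding G_def using \<Gamma> by metis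
  have D\<theta>: "((\<lambda>y. \<theta> y a) has_derivative (\<lambda>u. K (T u) (T a) + G u a)) (at x)" for a
    using smooth_on_has_derivative[OF sm V(2), of a] unfolding D T_def G_def
    by (metis (no_types, lifting) D ext)
  have DA: "frechet_derivative (\<lambda>y. A y [a, b]) (at x) u =
      kform (K (T u) (T a) + G u a) (T b) + kform (T a) (K (T u) (T b) + G u b)" for a b u
  proof -
    have "((\<lambda>y. kform (\<theta> y a) (\<theta> y b)) has_derivative
        (\<lambda>u. kform (T a) (K (T u) (T b) + G u b) + kform (K (T u) (T a) + G u a) (T b))) (at x)"
      unfolding T_def[symmetric]
      using bounded_bilinear.FDERIV[OF bounded_bilinear_kform D\<theta> D\<theta>, of a b] by (simp add: T_def)
    then have "((\<lambda>y. A y [a, b]) has_derivative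
        (\<lambda>u. kform (T a) (K (T u) (T b) + G u b) + kform (K (T u) (T a) + G u a) (T b))) (at x)"
      by (rule has_derivative_transform_within_open[OF _ V]) (simp add: A)
    from frechet_derivativeI[OF this] show ?thesis by simp
  qed
  define E where "E a b c u = vol (K (T u) (T a) + G u a) (T b) (T c) + vol (T a) (K (T u) (T b) + G u b) (T c)
      + vol (T a) (T b) (K (T u) (T c) + G u c)" for a b c u
  have DV: "((\<lambda>y. vol (\<theta> y a) (\<theta> y b) (\<theta> y c)) has_derivative E a b c) (at x)" for a b c
    using has_derivative_vol[OF D\<theta> D\<theta> D\<theta>, of a b c] unfolding E_def T_def by simp
  have DP: "((\<lambda>y. P y [a, b, c]) has_derivative (\<lambda>u. Re (E a b c u))) (at x)" for a b c
    by (rule has_derivative_transform_within_open[OF bounded_linear.has_derivative[OF bounded_linear_Re DV] V])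
      (simp add: P)
  have DQ: "((\<lambda>y. Q y [a, b, c]) has_derivative (\<lambda>u. Im (E a b c u))) (at x)" for a b c
    by (rule has_derivative_transform_within_open[OF bounded_linear.has_derivative[OF bounded_linear_Im DV] V])
      (simp add: Q)
  have smA: "smooth_on V (\<lambda>y. A y [a, b])" for a b
    using smooth_on_cong[OF V(1), of "\<lambda>y. A y [a, b]"] A smooth_on_kform[OF V(1) sm sm] by simp
  have dP: "local_ext_deriv P x [a, b, c, d] = 0" for a b c d
  proof -
    \<comment> \<open>\<open>dF = 3 \<Psi>\<^sub>+\<close> holds around \<open>x\<close>, so it may be differentiated.\<close>
    have e: "frechet_derivative (\<lambda>y. local_ext_deriv A y [a, b, c]) (at x) u = 3 * Re (E a b c u)" for a b c u
    proof -
      have "((\<lambda>y. 3 * P y [a, b, c]) has_derivative (\<lambda>u. 3 * Re (E a b c u))) (at x)"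
        by (intro has_derivative_mult_right DP)
      then have "((\<lambda>y. local_ext_deriv A y [a, b, c]) has_derivative (\<lambda>u. 3 * Re (E a b c u))) (at x)"
        by (rule has_derivative_transform_within_open[OF _ V]) (simp add: dA)
      from frechet_derivativeI[OF this] show ?thesis by simp
    qed
    have "local_ext_deriv (\<lambda>y. local_ext_deriv A y) x [a, b, c, d] = 0"
      by (rule local_ext_deriv_local_ext_deriv_2[where A = A, OF V smA])
    then show ?thesis
      unfolding local_ext_deriv_3 e frechet_derivativeI[OF DP] by simp
  qed
  have F: "(kform (K u v) w + kform v (K u w)) - (kform (K v u) w + kform u (K v w))
      + (kform (K w u) v + kform u (K w v)) = 3 * Re (vol u v w)" for u v w
  proof -
    obtain a b c where abc: "u = T a" "v = T b" "w = T c"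
      using surjD[OF surj] unfolding T_def by metis
    have "local_ext_deriv A x [a, b, c] = 3 * Re (vol (T a) (T b) (T c))"
      using dA[OF V(2)] P[OF V(2)] by (simp add: T_def)
    then show ?thesis
      unfolding local_ext_deriv_2 DA abc kform_add
      using kform_commute[of "G c a" "T b"] kform_commute[of "G a b" "T c"] kform_commute[of "G b c" "T a"]
        G[of a b] G[of a c] G[of b c] by simp
  qed
  have Vol: "(vol (K u v) w z + vol v (K u w) z + vol v w (K u z))
      - (vol (K v u) w z + vol u (K v w) z + vol u w (K v z))
      + (vol (K w u) v z + vol u (K w v) z + vol u v (K w z))
      - (vol (K z u) v w + vol u (K z v) w + vol u v (K z w))
      = - 4 * \<i> * (kform u v * kform w z - kform u w * kform v z + kform u z * kform v w)" for u v w z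
  proof -
    obtain a b c d where abc: "u = T a" "v = T b" "w = T c" "z = T d"
      using surjD[OF surj] unfolding T_def by metis
    have "E b c d a - E a c d b + E a b d c - E a b c d =
        - 4 * \<i> * (kform u v * kform w z - kform u w * kform v z + kform u z * kform v w)"
      using dP[of a b c d] dQ[of a b c d]
      unfolding local_ext_deriv_3 frechet_derivativeI[OF DP] frechet_derivativeI[OF DQ] T_def[symmetric]
        abc[symmetric] wedge22_def
      by (simp add: complex_eq_iff)
    then show ?thesis
      unfolding E_def abc linear_add[OF linear_vol(1)] linear_add[OF linear_vol(2)] linear_add[OF linear_vol(3)]
      using vol_swap(1)[of "T b" "G a c" "T d"] vol_swap(1)[of "T a" "G b c" "T d"]
        vol_swap(2)[of "T b" "G a d" "T c"] vol_swap(1)[of "G a d" "T b" "T c"]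
        vol_swap(2)[of "T a" "G b d" "T c"] vol_swap(2)[of "T a" "G c d" "T b"]
        G[of b a] G[of c a] G[of c b] G[of d a] G[of d b] G[of d c]
      by (simp add: algebra_simps)
  qed
  show "kform (K u v) w + kform v (K u w) = Re (vol u v w)"
    by (rule nearly_Kaehler_covariant_derivatives(1)[OF K skew F Vol])
  show "Im (vol (K u v) w z + vol v (K u w) z + vol v w (K u z)) =
      - (kform u v * kform w z - kform u w * kform v z + kform u z * kform v w)"
    by (rule nearly_Kaehler_covariant_derivatives(2)[OF K skew F Vol])
qed

section \<open>Totally geodesic hypersurfaces in a frame\<close>

lemma range_eq_hyperplane:
  fixes T :: "'d::euclidean_space \<Rightarrow> 'c::euclidean_space"
  assumes T: "linear T" "inj T" and dim: "DIM('d) + 1 = DIM('c)" and m: "m \<noteq> 0" "\<And>w. m \<bullet> T w = 0"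
  shows "range T = {v. m \<bullet> v = 0}"
proof (rule subspace_dim_equal)
  show "subspace (range T)" by (rule linear_subspace_image[OF T(1) subspace_UNIV])
  show "subspace {v. m \<bullet> v = 0}" by (rule subspace_hyperplane)
  show "range T \<subseteq> {v. m \<bullet> v = 0}" using m by auto
  show "dim (range T) \<ge> dim {v. m \<bullet> v = 0}"
    using dim_hyperplane[OF m(1)] dim_image_eq[OF T(1), of UNIV] T(2) dim by (simp add: inj_on_def inj_def)
qed

text \<open>Let \<open>q u\<close> be the covariant derivative of the unit normal in the direction \<open>u\<close>, in frame components. It is orthogonal
  to the normal since the normal has constant length. It is orthogonal to the tangent vectors since these are
  orthogonal to the normal and the second fundamental form, which pairs the normal with their covariant
  derivatives \<open>s u w\<close>, vanishes. As these vectors span, \<open>q = 0\<close>.\<close>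

lemma totally_geodesic_frame_derivatives:
  fixes \<theta> :: "'e::euclidean_space \<Rightarrow> 'e \<Rightarrow> 'c::euclidean_space" and \<phi> :: "'d::euclidean_space \<Rightarrow> 'e"
  assumes V: "open V" and lin: "\<And>y. y \<in> V \<Longrightarrow> linear (\<theta> y)" and inj: "inj (\<theta> (\<phi> x))"
    and sm: "\<And>a. smooth_on V (\<lambda>y. \<theta> y a)"
    and skew: "\<And>u v w. K u v \<bullet> w + v \<bullet> K u w = 0"
    and D: "\<And>a u. frechet_derivative (\<lambda>y. \<theta> y a) (at (\<phi> x)) u = K (\<theta> (\<phi> x) u) (\<theta> (\<phi> x) a) + \<theta> (\<phi> x) (\<Gamma> u a)"
    and \<Gamma>: "\<And>a u. \<Gamma> u a = \<Gamma> a u"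
    and W: "open W" "x \<in> W" and \<phi>: "smooth_on W \<phi>" "\<phi> ` W \<subseteq> V" and n: "smooth_on W n"
    and T_def: "\<And>y w. T y w = \<theta> (\<phi> y) (frechet_derivative \<phi> (at y) w)"
    and m_def: "\<And>y. m y = \<theta> (\<phi> y) (n y)"
    and unit: "\<And>y. y \<in> W \<Longrightarrow> m y \<bullet> m y = 1" and normal: "\<And>y w. y \<in> W \<Longrightarrow> m y \<bullet> T y w = 0"
    and range: "range (T x) = {v. m x \<bullet> v = 0}"
    and geodesic: "\<And>u w. \<theta> (\<phi> x) (frechet_derivative (\<lambda>y. frechet_derivative \<phi> (at y) w) (at x) u
        + \<Gamma> (frechet_derivative \<phi> (at x) u) (frechet_derivative \<phi> (at x) w)) \<bullet> m x = 0"
  shows "(m has_derivative (\<lambda>u. K (T x u) (m x))) (at x)"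
    and "\<exists>s. (\<forall>u w. s u w = s w u) \<and> (\<forall>w. ((\<lambda>y. T y w) has_derivative (\<lambda>u. K (T x u) (T x w) + s u w)) (at x))"
proof -
  define \<phi>' where "\<phi>' = frechet_derivative \<phi> (at x)"
  define H where "H w = frechet_derivative (\<lambda>y. frechet_derivative \<phi> (at y) w) (at x)" for w
  define n' where "n' = frechet_derivative n (at x)"
  define L where "L = \<theta> (\<phi> x)"
  define s where "s u w = L (H w u + \<Gamma> (\<phi>' u) (\<phi>' w))" for u w
  define q where "q u = L (n' u + \<Gamma> (\<phi>' u) (n x))" for u
  have Vx: "\<phi> x \<in> V" using \<phi>(2) W(2) by blast
  have L: "linear L" unfolding L_def by (rule lin[OF Vx])
  have D\<phi>: "(\<phi> has_derivative \<phi>') (at x)" unfolding \<phi>'_def by (rule smooth_on_has_derivative[OF \<phi>(1) W(2)])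
  have DH: "((\<lambda>y. frechet_derivative \<phi> (at y) w) has_derivative H w) (at x)" for w
    unfolding H_def by (rule smooth_on_has_derivative[OF smooth_on_deriv[OF \<phi>(1)] W(2)])
  have Dn: "(n has_derivative n') (at x)" unfolding n'_def by (rule smooth_on_has_derivative[OF n W(2)])
  have D\<theta>: "((\<lambda>y. \<theta> y a) has_derivative frechet_derivative (\<lambda>y. \<theta> y a) (at (\<phi> x))) (at (\<phi> x))" for a
    by (rule smooth_on_has_derivative[OF sm Vx])
  have field: "((\<lambda>y. \<theta> (\<phi> y) (X y)) has_derivative
      (\<lambda>u. K (L (\<phi>' u)) (L (X x)) + L (X' u + \<Gamma> (\<phi>' u) (X x)))) (at x)"
    if "(X has_derivative X') (at x)" for X X'
    using has_derivative_linear_form_field[OF V Vx lin D\<theta> D\<phi> that]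
    unfolding D L_def[symmetric] by (simp add: linear_add[OF L] algebra_simps)
  have Tx: "T x w = L (\<phi>' w)" for w by (simp add: T_def L_def \<phi>'_def)
  have mx: "m x = L (n x)" by (simp add: m_def L_def)
  have DT: "((\<lambda>y. T y w) has_derivative (\<lambda>u. K (T x u) (T x w) + s u w)) (at x)" for w
    using field[OF DH[of w]] unfolding T_def[of _ w, symmetric] Tx s_def \<phi>'_def[symmetric] .
  have Dm: "(m has_derivative (\<lambda>u. K (T x u) (m x) + q u)) (at x)"
    using field[OF Dn] unfolding m_def[symmetric] Tx mx q_def by simp
  have s_sym: "s u w = s w u" for u w
    using second_derivative_symmetric[OF W(1) \<phi>(1) W(2), of u w] \<Gamma>[of "\<phi>' u" "\<phi>' w"]
    by (simp add: s_def H_def)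
  have sm0: "s u w \<bullet> m x = 0" for u w
    using geodesic[of w u] unfolding s_def L_def H_def \<phi>'_def .
  have skew': "K u v \<bullet> v = 0" for u v
    using skew[of u v v] by (simp add: inner_commute)
  have q1: "m x \<bullet> q u = 0" for u
  proof -
    have "((\<lambda>y. m y \<bullet> m y) has_derivative (\<lambda>u. m x \<bullet> (K (T x u) (m x) + q u) + (K (T x u) (m x) + q u) \<bullet> m x)) (at x)"
      by (intro has_derivative_inner Dm)
    then have "((\<lambda>y. 1) has_derivative (\<lambda>u. m x \<bullet> (K (T x u) (m x) + q u) + (K (T x u) (m x) + q u) \<bullet> m x)) (at x)"
      by (rule has_derivative_transform_within_open[OF _ W]) (simp add: unit)
    from has_derivative_unique[OF this has_derivative_const]
    have "m x \<bullet> (K (T x u) (m x) + q u) + (K (T x u) (m x) + q u) \<bullet> m x = 0" by metis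
    then show ?thesis using skew'[of "T x u" "m x"] by (simp add: inner_add_left inner_add_right inner_commute)
  qed
  have q2: "T x w \<bullet> q u = 0" for u w
  proof -
    have "((\<lambda>y. m y \<bullet> T y w) has_derivative
        (\<lambda>u. m x \<bullet> (K (T x u) (T x w) + s u w) + (K (T x u) (m x) + q u) \<bullet> T x w)) (at x)"
      by (intro has_derivative_inner Dm DT)
    then have "((\<lambda>y. 0) has_derivative
        (\<lambda>u. m x \<bullet> (K (T x u) (T x w) + s u w) + (K (T x u) (m x) + q u) \<bullet> T x w)) (at x)"
      by (rule has_derivative_transform_within_open[OF _ W]) (simp add: normal)
    from has_derivative_unique[OF this has_derivative_const]
    have "m x \<bullet> (K (T x u) (T x w) + s u w) + (K (T x u) (m x) + q u) \<bullet> T x w = 0" by metis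
    then show ?thesis using skew[of "T x u" "m x" "T x w"] sm0[of u w]
      by (simp add: inner_add_left inner_add_right inner_commute)
  qed
  have q0: "q u = 0" for u
  proof -
    have "q u \<in> range (T x)" unfolding range using q1 by simp
    then obtain w where "q u = T x w" by blast
    then have "q u \<bullet> q u = 0" using q2[of w u] by simp
    then show ?thesis by simp
  qed
  show "(m has_derivative (\<lambda>u. K (T x u) (m x))) (at x)" using Dm by (simp add: q0)
  show "\<exists>s. (\<forall>u w. s u w = s w u) \<and> (\<forall>w. ((\<lambda>y. T y w) has_derivative (\<lambda>u. K (T x u) (T x w) + s u w)) (at x))"
    using s_sym DT by blast
qed

text \<open>The symmetric terms \<open>s\<close> cancel in the alternating sums, and the covariant derivatives of the 2-form and the 3-form
  are inserted from \<open>nearly_Kaehler_covariant_derivatives\<close>.\<close>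

lemma hypersurface_structure_equations:
  fixes T :: "'d::euclidean_space \<Rightarrow> 'd \<Rightarrow> c3"
  assumes Dm: "(m has_derivative (\<lambda>u. K (T x u) (m x))) (at x)"
    and s: "\<And>u w. s u w = s w u"
    and DT: "\<And>w. ((\<lambda>y. T y w) has_derivative (\<lambda>u. K (T x u) (T x w) + s u w)) (at x)"
    and F: "\<And>u v w. kform (K u v) w + kform v (K u w) = Re (vol u v w)"
    and Q: "\<And>u v w z. Im (vol (K u v) w z + vol v (K u w) z + vol v w (K u z)) =
      - (kform u v * kform w z - kform u w * kform v z + kform u z * kform v w)"
    and W: "open W" "x \<in> W"
    and \<eta>: "\<And>y u. y \<in> W \<Longrightarrow> \<eta> y [u] = - kform (m y) (T y u)"
    and \<omega>: "\<And>y u v. y \<in> W \<Longrightarrow> \<omega> y [u, v] = Im (vol (m y) (T y u) (T y v))"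
  shows "local_ext_deriv \<eta> x [u, v] = 2 * Re (vol (m x) (T x u) (T x v))"
    and "local_ext_deriv \<omega> x [u, v, w] = 3 * (kform (m x) (T x u) * kform (T x v) (T x w)
      - kform (m x) (T x v) * kform (T x u) (T x w) + kform (m x) (T x w) * kform (T x u) (T x v))"
proof -
  define S where "S = T x"
  define M where "M = m x"
  have D\<eta>: "frechet_derivative (\<lambda>y. \<eta> y [b]) (at x) a = - (Re (vol (S a) M (S b)) + kform M (s a b))" for a b
  proof -
    have "((\<lambda>y. - kform (m y) (T y b)) has_derivative
        (\<lambda>a. - (kform M (K (S a) (S b) + s a b) + kform (K (S a) M) (S b)))) (at x)"
      unfolding S_def M_def
      by (intro has_derivative_minus bounded_bilinear.FDERIV[OF bounded_bilinear_kform Dm DT])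
    then have "((\<lambda>y. \<eta> y [b]) has_derivative
        (\<lambda>a. - (kform M (K (S a) (S b) + s a b) + kform (K (S a) M) (S b)))) (at x)"
      by (rule has_derivative_transform_within_open[OF _ W]) (simp add: \<eta>)
    from frechet_derivativeI[OF this] show ?thesis using F[of "S a" M "S b"] by (simp add: kform_add)
  qed
  have D\<omega>: "frechet_derivative (\<lambda>y. \<omega> y [b, c]) (at x) a =
      - (kform (S a) M * kform (S b) (S c) - kform (S a) (S b) * kform M (S c) + kform (S a) (S c) * kform M (S b))
      + Im (vol M (s a b) (S c)) + Im (vol M (S b) (s a c))" for a b c
  proof -
    have "((\<lambda>y. Im (vol (m y) (T y b) (T y c))) has_derivative
        (\<lambda>a. Im (vol (K (S a) M) (S b) (S c) + vol M (K (S a) (S b) + s a b) (S c) + vol M (S b) (K (S a) (S c) + s a c)))) (at x)"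
      unfolding S_def M_def
      by (intro bounded_linear.has_derivative[OF bounded_linear_Im] has_derivative_vol Dm DT)
    then have "((\<lambda>y. \<omega> y [b, c]) has_derivative
        (\<lambda>a. Im (vol (K (S a) M) (S b) (S c) + vol M (K (S a) (S b) + s a b) (S c) + vol M (S b) (K (S a) (S c) + s a c)))) (at x)"
      by (rule has_derivative_transform_within_open[OF _ W]) (simp add: \<omega>)
    from frechet_derivativeI[OF this] show ?thesis
      using Q[of "S a" M "S b" "S c"] by (simp add: linear_add[OF linear_vol(2)] linear_add[OF linear_vol(3)])
  qed
  show "local_ext_deriv \<eta> x [u, v] = 2 * Re (vol (m x) (T x u) (T x v))"
    unfolding local_ext_deriv_1 D\<eta> S_def[symmetric] M_def[symmetric]
    using s[of u v] vol_swap(1)[of M "S u" "S v"] vol_swap(1)[of M "S v" "S u"] vol_swap(2)[of M "S v" "S u"] by simp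
  show "local_ext_deriv \<omega> x [u, v, w] = 3 * (kform (m x) (T x u) * kform (T x v) (T x w)
      - kform (m x) (T x v) * kform (T x u) (T x w) + kform (m x) (T x w) * kform (T x u) (T x v))"
    unfolding local_ext_deriv_2 D\<omega> S_def[symmetric] M_def[symmetric]
    using s[of u v] s[of u w] s[of v w] vol_swap(2)[of M "S v" "s u w"] vol_swap(2)[of M "S u" "s v w"] 
      vol_swap(2)[of M "s u v" "S w"]
      kform_commute[of "S u" M] kform_commute[of "S v" M] kform_commute[of "S w" M]
      kform_commute[of "S u" "S v"] kform_commute[of "S u" "S w"] kform_commute[of "S v" "S w"]
    by (simp add: algebra_simps)
qed

section \<open>Adapted coframes in a chart\<close>

definition frame :: "('p, real^6) chart set \<Rightarrow> ('p, real^6) chart \<Rightarrow> (nat \<Rightarrow> ('p, real^6, real) dform) \<Rightarrow>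
    real^6 \<Rightarrow> real^6 \<Rightarrow> c3" where
  "frame M c e y a =
     (Complex (local_form M c (e 1) y [a]) (local_form M c (e 2) y [a]),
      Complex (local_form M c (e 3) y [a]) (local_form M c (e 4) y [a]),
      Complex (local_form M c (e 5) y [a]) (local_form M c (e 6) y [a]))"

lemma sum_1_6: "(\<Sum>i = 1..6. f i) = f 1 + f 2 + f 3 + f 4 + f 5 + f (6::nat)"
  by (simp add: eval_nat_numeral)

context
  fixes M :: "('p::{t2_space, second_countable_topology}, real^6) chart set"
    and F \<Psi>p \<Psi>m :: "('p, real^6, real) dform" and U e c
  assumes M: "smooth_manifold M" and cof: "SU3_coframe M F \<Psi>p \<Psi>m U e" and c: "c \<in> M"
begin

lemma coframe_smooth_form: "i \<in> {1..6} \<Longrightarrow> smooth_form_on M U 1 (e i)"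
  using cof by (auto simp: SU3_coframe_def coframe_on_def)

lemma open_coframe_domain: "open (snd c ` (fst c \<inter> U))"
  using cof by (intro open_chart_image[OF M c] open_Int open_chart[OF M c]) (simp add: SU3_coframe_def)

lemma linear_coframe:
  assumes "y \<in> snd c ` (fst c \<inter> U)" "i \<in> {1..6}"
  shows "linear (\<lambda>a. local_form M c (e i) y [a])"
  using coframe_smooth_form[OF assms(2)] assms(1) c unfolding smooth_form_on_def alternating_multilinear_1_iff by blast

lemma linear_frame:
  assumes "y \<in> snd c ` (fst c \<inter> U)"
  shows "linear (frame M c e y)"
proof (rule linearI)
  note l = linear_coframe[OF assms]
  show "frame M c e y (a + b) = frame M c e y a + frame M c e y b" for a b
    by (simp add: frame_def linear_add[OF l] complex_eq_iff)
  show "frame M c e y (r *\<^sub>R a) = r *\<^sub>R frame M c e y a" for r a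
    by (simp add: frame_def linear_scale[OF l] complex_eq_iff)
qed

lemma smooth_frame: "smooth_on (snd c ` (fst c \<inter> U)) (\<lambda>y. frame M c e y a)"
proof -
  let ?E = "\<lambda>i y. local_form M c (e i) y [a]"
  have s: "smooth_on (snd c ` (fst c \<inter> U)) (\<lambda>y. ?E i y *\<^sub>R v)" if "i \<in> {1..6}" for i and v :: c3
    by (rule smooth_on_bounded_linear[OF bounded_linear_scaleR_left open_coframe_domain])
      (use coframe_smooth_form[OF that] c in \<open>simp add: smooth_form_on_def\<close>)
  have "frame M c e y a = ?E 1 y *\<^sub>R (1, 0, 0) + ?E 2 y *\<^sub>R (\<i>, 0, 0) + ?E 3 y *\<^sub>R (0, 1, 0)
      + ?E 4 y *\<^sub>R (0, \<i>, 0) + ?E 5 y *\<^sub>R (0, 0, 1) + ?E 6 y *\<^sub>R (0, 0, \<i>)" for y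
    by (simp add: frame_def complex_eq_iff)
  then show ?thesis
    by (simp only:) (intro smooth_on_add open_coframe_domain s; simp)
qed

lemma local_form_in_frame:
  assumes "y \<in> snd c ` (fst c \<inter> U)"
  shows "local_form M c F y [a, b] = kform (frame M c e y a) (frame M c e y b)"
    and "local_form M c \<Psi>p y [a, b, d] = Re (vol (frame M c e y a) (frame M c e y b) (frame M c e y d))"
    and "local_form M c \<Psi>m y [a, b, d] = Im (vol (frame M c e y a) (frame M c e y b) (frame M c e y d))"
proof -
  obtain p where p: "p \<in> fst c" "p \<in> U" "y = snd c p" using assms by blast
  note lf = local_form_at[OF M c p(1), folded p(3)]
  let ?X = "tvec_of M c p"
  have T: "?X u \<in> tangent_space M p" for u by (rule tvec_of_in_tangent_space[OF M c p(1)])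
  have "F p [?X a, ?X b] = wedge 1 1 (e 1) (e 2) p [?X a, ?X b] + wedge 1 1 (e 3) (e 4) p [?X a, ?X b]
      + wedge 1 1 (e 5) (e 6) p [?X a, ?X b]"
    using cof p(2) T unfolding SU3_coframe_def form_eq_def by simp
  then show "local_form M c F y [a, b] = kform (frame M c e y a) (frame M c e y b)"
    unfolding wedge_1_1 by (simp add: lf frame_def kform_def)
  let ?\<theta> = "\<lambda>i j u. complex_form (e i) (e j) p [?X u]"
  have sw: "wedge 1 1 \<alpha> \<beta> p [W, V] = - wedge 1 1 \<alpha> \<beta> p [V, W]"
    for \<alpha> \<beta> :: "('p, real^6, complex) dform" and V W
    by (simp only: wedge_1_1 minus_diff_eq)
  have "complex_form \<Psi>p \<Psi>m p [?X a, ?X b, ?X d] =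
      wedge 2 1 (wedge 1 1 (complex_form (e 1) (e 2)) (complex_form (e 3) (e 4))) (complex_form (e 5) (e 6))
        p [?X a, ?X b, ?X d]"
    using cof p(2) T unfolding SU3_coframe_def form_eq_def by simp
  also have "\<dots> = (?\<theta> 1 2 a * ?\<theta> 3 4 b - ?\<theta> 1 2 b * ?\<theta> 3 4 a) * ?\<theta> 5 6 d
      - (?\<theta> 1 2 a * ?\<theta> 3 4 d - ?\<theta> 1 2 d * ?\<theta> 3 4 a) * ?\<theta> 5 6 b
      + (?\<theta> 1 2 b * ?\<theta> 3 4 d - ?\<theta> 1 2 d * ?\<theta> 3 4 b) * ?\<theta> 5 6 a"
    unfolding wedge_2_1[where \<alpha> = "wedge 1 1 (complex_form (e 1) (e 2)) (complex_form (e 3) (e 4))", OF sw]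
      wedge_1_1 by (rule refl)
  also have "\<dots> = vol (?\<theta> 1 2 a, ?\<theta> 3 4 a, ?\<theta> 5 6 a) (?\<theta> 1 2 b, ?\<theta> 3 4 b, ?\<theta> 5 6 b) (?\<theta> 1 2 d, ?\<theta> 3 4 d, ?\<theta> 5 6 d)"
    unfolding vol.simps by algebra
  finally have "complex_form \<Psi>p \<Psi>m p [?X a, ?X b, ?X d] = vol (?\<theta> 1 2 a, ?\<theta> 3 4 a, ?\<theta> 5 6 a)
      (?\<theta> 1 2 b, ?\<theta> 3 4 b, ?\<theta> 5 6 b) (?\<theta> 1 2 d, ?\<theta> 3 4 d, ?\<theta> 5 6 d)" .
  moreover have fr: "(?\<theta> 1 2 u, ?\<theta> 3 4 u, ?\<theta> 5 6 u) = frame M c e y u" for u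
    by (simp add: frame_def complex_form_def lf complex_eq_iff)
  ultimately have v: "complex_form \<Psi>p \<Psi>m p [?X a, ?X b, ?X d] = vol (frame M c e y a) (frame M c e y b) (frame M c e y d)"
    by (simp only: fr)
  show "local_form M c \<Psi>p y [a, b, d] = Re (vol (frame M c e y a) (frame M c e y b) (frame M c e y d))"
    and "local_form M c \<Psi>m y [a, b, d] = Im (vol (frame M c e y a) (frame M c e y b) (frame M c e y d))"
    unfolding v[symmetric] by (simp_all add: lf complex_form_def)
qed

lemma local_metric_in_frame:
  assumes "SU3_metric M F \<Psi>p \<Psi>m g" "y \<in> snd c ` (fst c \<inter> U)"
  shows "local_metric M g c y a b = frame M c e y a \<bullet> frame M c e y b"
proof -
  obtain p where p: "p \<in> fst c" "p \<in> U" "y = snd c p" using assms by blast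
  note lf = local_form_at[OF M c p(1), folded p(3)]
  have ci: "coord_inv c y = p" unfolding p(3) by (rule coord_inv_coord[OF M c p(1)])
  have "g p (tvec_of M c p a) (tvec_of M c p b) =
      (\<Sum>i=1..6. e i p [tvec_of M c p a] * e i p [tvec_of M c p b])"
    using assms(1) cof p(2) tvec_of_in_tangent_space[OF M c p(1)] unfolding SU3_metric_def by blast
  then show ?thesis
    unfolding local_metric_def ci sum_1_6 by (simp add: frame_def lf inner_complex_def)
qed

text \<open>Were the image of the frame contained in a hyperplane, a normal vector of that hyperplane would provide the coefficients of
  a linear relation between \<open>e\<^sup>1, \<dots>, e\<^sup>6\<close>.\<close>

lemma inj_frame:
  assumes "y \<in> snd c ` (fst c \<inter> U)"
  shows "inj (frame M c e y)"
proof -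
  obtain p where p: "p \<in> fst c" "p \<in> U" "y = snd c p" using assms by blast
  note lf = local_form_at[OF M c p(1), folded p(3)]
  have L: "linear (frame M c e y)" by (rule linear_frame[OF assms])
  have "surj (frame M c e y)"
  proof (rule ccontr)
    assume "\<not> surj (frame M c e y)"
    then have "range (frame M c e y) \<noteq> UNIV" by simp
    moreover have "subspace (range (frame M c e y))" by (rule linear_subspace_image[OF L subspace_UNIV])
    ultimately have "span (range (frame M c e y)) \<noteq> UNIV" by (simp add: span_eq_iff[THEN iffD2])
    then obtain n where n: "n \<noteq> 0" "\<And>v. v \<in> span (range (frame M c e y)) \<Longrightarrow> n \<bullet> v = 0"
      using span_not_univ_subset_hyperplane by blast
    obtain n1 n2 n3 where n': "n = (n1, n2, n3)" by (metis prod_cases3)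
    \<comment> \<open>The list starts with a dummy, as coframes are indexed from 1.\<close>
    define r where "r i = [0, Re n1, Im n1, Re n2, Im n2, Re n3, Im n3] ! i" for i :: nat
    have "\<forall>X\<in>tangent_space M p. (\<Sum>i=1..6. r i * e i p [X]) = 0"
    proof
      fix X assume "X \<in> tangent_space M p"
      then have X: "X = tvec_of M c p (X c)" by (rule tangent_vector_eq_tvec_of[OF M c p(1)])
      have "n \<bullet> frame M c e y (X c) = 0" by (rule n(2)[OF span_base]) simp
      then show "(\<Sum>i=1..6. r i * e i p [X]) = 0"
        unfolding sum_1_6 by (subst (1 2 3 4 5 6) X) (simp add: n' r_def frame_def lf inner_complex_def eval_nat_numeral)
    qed
    then have "\<forall>i\<in>{1..6}. r i = 0" using cof p(2) unfolding SU3_coframe_def coframe_on_def by blast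
    then have "r 1 = 0" "r 2 = 0" "r 3 = 0" "r 4 = 0" "r 5 = 0" "r 6 = 0" by simp_all
    then have "n = 0" by (simp add: n' r_def eval_nat_numeral complex_eq_iff zero_prod_def)
    then show False using n(1) by simp
  qed
  then show ?thesis by (intro linear_surjective_imp_injective L) simp_all
qed

end

section \<open>Totally geodesic hypersurfaces of nearly Kaehler manifolds\<close>

locale nearly_Kaehler_hypersurface =
  fixes M :: "('p::{t2_space, second_countable_topology}, real^6) chart set"
    and N :: "('q::{t2_space, second_countable_topology}, real^5) chart set"
    and F \<Psi>p \<Psi>m :: "('p, real^6, real) dform"
    and g :: "('p, real^6) metric"
    and f :: "'q \<Rightarrow> 'p"
    and \<nu> :: "'q \<Rightarrow> ('p, real^6) tvec"
  assumes M: "smooth_manifold M" and N: "smooth_manifold N"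
    and nK: "nearly_Kaehler M F \<Psi>p \<Psi>m"
    and g: "SU3_metric M F \<Psi>p \<Psi>m g"
    and hyp: "oriented_hypersurface N M g f \<nu>"
begin

sublocale smooth_map_between N M f
  using M N hyp by (simp add: smooth_map_between_def oriented_hypersurface_def immersion_def)

definition \<eta> where "\<eta> = (-1) \<odot> contract_along N M f \<nu> F"

definition \<omega>1 where "\<omega>1 = pullback N M f F"

definition \<omega>2 where "\<omega>2 = contract_along N M f \<nu> \<Psi>m"

definition \<omega>3 where "\<omega>3 = (-1) \<odot> contract_along N M f \<nu> \<Psi>p"

lemma \<nu>_tangent: "p \<in> carrier N \<Longrightarrow> \<nu> p \<in> tangent_space M (f p)"
  using hyp by (simp add: oriented_hypersurface_def)

lemma F_smooth: "smooth_form_on M (carrier M) 2 F"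
  using nK by (simp add: nearly_Kaehler_def SU3_structure_def)

definition normal_frame where
  "normal_frame c c' e y = frame M c' e (coord_rep c c' y) (\<nu> (coord_inv c y) c')"

definition tangent_frame where
  "tangent_frame c c' e y u = frame M c' e (coord_rep c c' y) (frechet_derivative (coord_rep c c') (at y) u)"

end

text \<open>A chart \<open>c\<close> of the hypersurface, a chart \<open>c'\<close> of the ambient manifold and an adapted coframe \<open>e\<close> on \<open>U\<close>. Below, \<open>m\<close> and
  \<open>T\<close> are the components of the unit normal and of the pushed-forward tangent vectors in the coframe; all forms are
  expressed by them on the open set \<open>W\<close> of coordinates at which both charts and the coframe are available.\<close>

locale hypersurface_chart = nearly_Kaehler_hypersurface M N F \<Psi>p \<Psi>m g f \<nu>
  for M :: "('p::{t2_space, second_countable_topology}, real^6) chart set"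
    and N :: "('q::{t2_space, second_countable_topology}, real^5) chart set"
    and F \<Psi>p \<Psi>m g f \<nu> +
  fixes c c' U e
  assumes c: "c \<in> N" and c': "c' \<in> M" and cof: "SU3_coframe M F \<Psi>p \<Psi>m U e"
begin

abbreviation "m \<equiv> normal_frame c c' e"

abbreviation "T \<equiv> tangent_frame c c' e"

abbreviation "\<phi> \<equiv> coord_rep c c'"

abbreviation "\<theta> \<equiv> frame M c' e"

definition W where "W = snd c ` (fst c \<inter> f -` (fst c' \<inter> U))"

definition V where "V = snd c' ` (fst c' \<inter> U)"

lemma open_W: "open W" unfolding W_def
  using cof by (intro open_coord_preimage[OF c] open_Int open_chart[OF M c']) (simp add: SU3_coframe_def)

lemma open_V: "open V" unfolding V_def by (rule open_coframe_domain[OF M cof c'])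

lemma W_cases:
  assumes "y \<in> W"
  obtains p where "p \<in> fst c" "f p \<in> fst c'" "f p \<in> U" "y = snd c p" "coord_inv c y = p" "p \<in> carrier N"
    "\<phi> y = snd c' (f p)"
proof -
  obtain p where p: "p \<in> fst c" "f p \<in> fst c'" "f p \<in> U" "y = snd c p" using assms unfolding W_def by auto
  have "coord_inv c y = p" unfolding p(4) by (rule coord_inv_coord[OF N c p(1)])
  moreover have "p \<in> carrier N" using p(1) c unfolding carrier_def by blast
  ultimately show thesis using that p by simp
qed

lemma W_sub: "W \<subseteq> snd c ` (fst c \<inter> f -` fst c')" unfolding W_def by blast

lemma \<phi>_V: "\<phi> ` W \<subseteq> V"
proof
  fix x assume "x \<in> \<phi> ` W"
  then obtain y where y: "y \<in> W" "x = \<phi> y" by blast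
  obtain p where "f p \<in> fst c'" "f p \<in> U" "\<phi> y = snd c' (f p)" by (rule W_cases[OF y(1)])
  then show "x \<in> V" unfolding y(2) V_def by blast
qed

lemma \<phi>_in_V: "y \<in> W \<Longrightarrow> \<phi> y \<in> V" using \<phi>_V by blast

lemma smooth_\<phi>: "smooth_on W \<phi>"
  by (rule smooth_on_subset[OF smooth_coord_rep[OF c c'] W_sub])

lemmas linear_\<theta> = linear_frame[OF M cof c', folded V_def]

lemmas smooth_\<theta> = smooth_frame[OF M cof c', folded V_def]

lemmas inj_\<theta> = inj_frame[OF M cof c', folded V_def]

lemma smooth_normal: "smooth_on W m"
  unfolding normal_frame_def
proof (rule smooth_on_linear_field[OF open_W smooth_\<phi> \<phi>_V _ linear_\<theta> smooth_\<theta>])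
  have "smooth_on (snd c ` (fst c \<inter> f -` fst c')) (\<lambda>y. \<nu> (coord_inv c y) c')"
    using hyp c c' unfolding oriented_hypersurface_def by blast
  then show "smooth_on W (\<lambda>y. \<nu> (coord_inv c y) c')" by (rule smooth_on_subset[OF _ W_sub])
qed

lemma smooth_tangent: "smooth_on W (\<lambda>y. T y w)"
  unfolding tangent_frame_def
  by (rule smooth_on_linear_field[OF open_W smooth_\<phi> \<phi>_V smooth_on_deriv[OF smooth_\<phi>] linear_\<theta> smooth_\<theta>])

lemma linear_T: "y \<in> W \<Longrightarrow> linear (T y)"
  using linear_compose[OF linear_frechet_derivative[OF smooth_on_differentiable[OF smooth_\<phi>]] linear_\<theta>[OF \<phi>_in_V]]
  unfolding tangent_frame_def comp_def by blast

lemma local_forms: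
  assumes y: "y \<in> W"
  shows "local_form N c \<eta> y [u] = - kform (m y) (T y u)"
    and "local_form N c \<omega>1 y [u, v] = kform (T y u) (T y v)"
    and "local_form N c \<omega>2 y [u, v] = Im (vol (m y) (T y u) (T y v))"
    and "local_form N c \<omega>3 y [u, v] = - Re (vol (m y) (T y u) (T y v))"
proof -
  have y': "y \<in> snd c ` (fst c \<inter> f -` fst c')" using y W_sub by blast
  have lc: "local_form N c (contract_along N M f \<nu> \<alpha>) y us = local_form M c' \<alpha> (\<phi> y)
      (\<nu> (coord_inv c y) c' # map (frechet_derivative \<phi> (at y)) us)" for \<alpha> us
    by (rule local_form_contract_along[OF c c' y']) (rule \<nu>_tangent)
  note lf = local_form_in_frame[OF M cof c' \<phi>_in_V[OF y, unfolded V_def]]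
  have sc: "local_form N c ((-1) \<odot> \<alpha>) y us = - local_form N c \<alpha> y us" for \<alpha> us
    by (simp add: local_form_def scale_form_def)
  show "local_form N c \<eta> y [u] = - kform (m y) (T y u)"
    unfolding \<eta>_def sc lc list.map lf normal_frame_def tangent_frame_def by (rule refl)
  show "local_form N c \<omega>1 y [u, v] = kform (T y u) (T y v)"
    unfolding \<omega>1_def local_form_pullback[OF c c' y'] list.map lf tangent_frame_def by (rule refl)
  show "local_form N c \<omega>2 y [u, v] = Im (vol (m y) (T y u) (T y v))"
    unfolding \<omega>2_def lc list.map lf normal_frame_def tangent_frame_def by (rule refl)
  show "local_form N c \<omega>3 y [u, v] = - Re (vol (m y) (T y u) (T y v))"
    unfolding \<omega>3_def sc lc list.map lf normal_frame_def tangent_frame_def by (rule refl)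
qed

lemma metric_tvec:
  assumes "q \<in> fst c'" "q \<in> U"
  shows "g q (tvec_of M c' q a) (tvec_of M c' q b) = \<theta> (snd c' q) a \<bullet> \<theta> (snd c' q) b"
proof -
  have "local_metric M g c' (snd c' q) a b = \<theta> (snd c' q) a \<bullet> \<theta> (snd c' q) b"
    by (rule local_metric_in_frame[OF M cof c' g]) (use assms in blast)
  then show ?thesis unfolding local_metric_def coord_inv_coord[OF M c' assms(1)] .
qed

lemma unit_normal:
  assumes y: "y \<in> W"
  shows "m y \<bullet> m y = 1" and "m y \<bullet> T y w = 0"
proof -
  obtain p where p: "p \<in> fst c" "f p \<in> fst c'" "f p \<in> U" "y = snd c p" "coord_inv c y = p" "p \<in> carrier N"
    "\<phi> y = snd c' (f p)" by (rule W_cases[OF y])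
  have nu: "\<nu> p = tvec_of M c' (f p) (\<nu> p c')"
    by (rule tangent_vector_eq_tvec_of[OF M c' p(2) \<nu>_tangent[OF p(6)]])
  have push: "pushforward N M f p (tvec_of N c p w) = tvec_of M c' (f p) (frechet_derivative \<phi> (at y) w)"
    unfolding p(4) by (rule pushforward_tvec_of[OF c c' p(1,2)])
  have h: "g (f p) (\<nu> p) (\<nu> p) = 1" "g (f p) (\<nu> p) (pushforward N M f p (tvec_of N c p w)) = 0"
    using hyp p(6) tvec_of_in_tangent_space[OF N c p(1), of w] unfolding oriented_hypersurface_def by blast+
  have "g (f p) (tvec_of M c' (f p) (\<nu> p c')) (tvec_of M c' (f p) (\<nu> p c')) = 1" using h(1) unfolding nu[symmetric] .
  then show "m y \<bullet> m y = 1"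
    unfolding metric_tvec[OF p(2,3)] normal_frame_def p(5,7) .
  have "g (f p) (tvec_of M c' (f p) (\<nu> p c')) (tvec_of M c' (f p) (frechet_derivative \<phi> (at y) w)) = 0"
    using h(2) unfolding nu[symmetric] push .
  then show "m y \<bullet> T y w = 0"
    unfolding metric_tvec[OF p(2,3)] normal_frame_def tangent_frame_def p(5,7) .
qed

lemma inj_T:
  assumes y: "y \<in> W"
  shows "inj (T y)"
proof -
  obtain p where p: "p \<in> fst c" "f p \<in> fst c'" "f p \<in> U" "y = snd c p" "coord_inv c y = p" "p \<in> carrier N"
    "\<phi> y = snd c' (f p)" by (rule W_cases[OF y])
  have push: "pushforward N M f p (tvec_of N c p w) = tvec_of M c' (f p) (frechet_derivative \<phi> (at y) w)" for w
    unfolding p(4) by (rule pushforward_tvec_of[OF c c' p(1,2)])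
  have i: "inj_on (pushforward N M f p) (tangent_space N p)"
    using hyp p(6) unfolding oriented_hypersurface_def immersion_def by blast
  show ?thesis
  proof (rule injI)
    fix u w assume "T y u = T y w"
    then have "frechet_derivative \<phi> (at y) u = frechet_derivative \<phi> (at y) w"
      using inj_\<theta>[OF \<phi>_in_V[OF y]] unfolding tangent_frame_def by (simp add: inj_eq)
    then have "pushforward N M f p (tvec_of N c p u) = pushforward N M f p (tvec_of N c p w)"
      unfolding push by simp
    then have "tvec_of N c p u = tvec_of N c p w"
      using inj_onD[OF i] tvec_of_in_tangent_space[OF N c p(1)] by blast
    then show "u = w" using tvec_of_coord[OF N c p(1)] by metis
  qed
qed

lemma range_T:
  assumes y: "y \<in> W"
  shows "range (T y) = {v. m y \<bullet> v = 0}"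
  by (rule range_eq_hyperplane[OF linear_T[OF y] inj_T[OF y]]) (use unit_normal[OF y] in auto)

lemma alternating_local_forms:
  assumes y: "y \<in> W"
  shows "alternating_multilinear 1 (local_form N c \<eta> y)"
    and "\<omega> \<in> {\<omega>1, \<omega>2, \<omega>3} \<Longrightarrow> alternating_multilinear 2 (local_form N c \<omega> y)"
proof -
  have Tl: "linear (T y)" by (rule linear_T[OF y])
  have bk: "bilinear kform" by (rule bilinear_kform)
  have lk: "linear (\<lambda>u. kform (T y u) v)" "linear (\<lambda>u. kform v (T y u))" for v
    by (rule linearI;
        simp add: linear_add[OF Tl] linear_scale[OF Tl] bilinear_ladd[OF bk] bilinear_radd[OF bk]
          bilinear_lmul[OF bk] bilinear_rmul[OF bk])+
  have lv: "linear (\<lambda>u. vol (m y) (T y u) v)" "linear (\<lambda>u. vol (m y) v (T y u))" for v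
    using linear_compose[OF Tl linear_vol(2)] linear_compose[OF Tl linear_vol(3)] by (simp_all add: comp_def)
  note lIm = linear_compose[OF _ bounded_linear.linear[OF bounded_linear_Im], unfolded comp_def]
  note lRe = linear_compose[OF _ bounded_linear.linear[OF bounded_linear_Re], unfolded comp_def]
  show "alternating_multilinear 1 (local_form N c \<eta> y)"
    unfolding alternating_multilinear_1_iff local_forms[OF y] by (rule linear_compose_neg[OF lk(2)])
  show "alternating_multilinear 2 (local_form N c \<omega> y)" if "\<omega> \<in> {\<omega>1, \<omega>2, \<omega>3}"
    using that
  proof (elim insertE emptyE; hypsubst)
    show "alternating_multilinear 2 (local_form N c \<omega>1 y)"
      by (rule alternating_multilinear_2I) (simp_all add: local_forms[OF y] lk)
    show "alternating_multilinear 2 (local_form N c \<omega>2 y)"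
      by (rule alternating_multilinear_2I) (simp_all add: local_forms[OF y] lIm[OF lv(1)] lIm[OF lv(2)])
    show "alternating_multilinear 2 (local_form N c \<omega>3 y)"
      by (rule alternating_multilinear_2I)
        (simp_all add: local_forms[OF y] linear_compose_neg[OF lRe[OF lv(1)]] linear_compose_neg[OF lRe[OF lv(2)]])
  qed
qed

lemma smooth_local_forms:
  shows "smooth_on W (\<lambda>y. local_form N c \<eta> y [u])"
    and "smooth_on W (\<lambda>y. local_form N c \<omega>1 y [u, v])"
    and "smooth_on W (\<lambda>y. local_form N c \<omega>2 y [u, v])"
    and "smooth_on W (\<lambda>y. local_form N c \<omega>3 y [u, v])"
proof -
  note I = smooth_on_kform[OF open_W] smooth_normal smooth_tangent smooth_on_vol[OF open_W]
    smooth_on_minus[OF open_W] smooth_on_bounded_linear[OF bounded_linear_Im open_W]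
    smooth_on_bounded_linear[OF bounded_linear_Re open_W]
  show "smooth_on W (\<lambda>y. local_form N c \<eta> y [u])"
    by (rule iffD2[OF smooth_on_cong[OF open_W local_forms(1)]], assumption) (intro I)
  show "smooth_on W (\<lambda>y. local_form N c \<omega>1 y [u, v])"
    by (rule iffD2[OF smooth_on_cong[OF open_W local_forms(2)]], assumption) (intro I)
  show "smooth_on W (\<lambda>y. local_form N c \<omega>2 y [u, v])"
    by (rule iffD2[OF smooth_on_cong[OF open_W local_forms(3)]], assumption) (intro I)
  show "smooth_on W (\<lambda>y. local_form N c \<omega>3 y [u, v])"
    by (rule iffD2[OF smooth_on_cong[OF open_W local_forms(4)]], assumption) (intro I)
qed

lemma forms_at:
  assumes "p \<in> fst c" "snd c p \<in> W" "X \<in> tangent_space N p" "Y \<in> tangent_space N p"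
  shows "\<eta> p [X] = - kform (m (snd c p)) (T (snd c p) (X c))"
    and "\<omega>1 p [X, Y] = kform (T (snd c p) (X c)) (T (snd c p) (Y c))"
    and "\<omega>2 p [X, Y] = Im (vol (m (snd c p)) (T (snd c p) (X c)) (T (snd c p) (Y c)))"
    and "\<omega>3 p [X, Y] = - Re (vol (m (snd c p)) (T (snd c p) (X c)) (T (snd c p) (Y c)))"
proof -
  have 1: "\<alpha> p [X] = local_form N c \<alpha> (snd c p) [X c]" for \<alpha> :: "('q, real^5, real) dform"
    using form_eq_local_form[OF N c assms(1), of "[X]"] assms(3) by simp
  have 2: "\<alpha> p [X, Y] = local_form N c \<alpha> (snd c p) [X c, Y c]" for \<alpha> :: "('q, real^5, real) dform"
    using form_eq_local_form[OF N c assms(1), of "[X, Y]"] assms(3,4) by simp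
  show "\<eta> p [X] = - kform (m (snd c p)) (T (snd c p) (X c))"
    unfolding 1 local_forms[OF assms(2)] by (rule refl)
  show "\<omega>1 p [X, Y] = kform (T (snd c p) (X c)) (T (snd c p) (Y c))"
    unfolding 2 local_forms[OF assms(2)] by (rule refl)
  show "\<omega>2 p [X, Y] = Im (vol (m (snd c p)) (T (snd c p) (X c)) (T (snd c p) (Y c)))"
    unfolding 2 local_forms[OF assms(2)] by (rule refl)
  show "\<omega>3 p [X, Y] = - Re (vol (m (snd c p)) (T (snd c p) (X c)) (T (snd c p) (Y c)))"
    unfolding 2 local_forms[OF assms(2)] by (rule refl)
qed

end

context hypersurface_chart
begin

lemma wedge_forms_local:
  assumes y: "y \<in> W" and \<alpha>\<beta>: "\<alpha> \<in> {\<omega>1, \<omega>2, \<omega>3}" "\<beta> \<in> {\<omega>1, \<omega>2, \<omega>3}"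
  shows "local_form N c (wedge 2 2 \<alpha> \<beta>) y [a1, a2, a3, a4] =
    wedge22 (\<lambda>u v. local_form N c \<alpha> y [u, v]) (\<lambda>u v. local_form N c \<beta> y [u, v]) a1 a2 a3 a4"
proof -
  obtain p where p: "p \<in> fst c" "y = snd c p" using y unfolding W_def by blast
  note lf = local_form_at[OF N c p(1), folded p(2)]
  have co: "tvec_of N c p a c = a" for a by (rule tvec_of_coord[OF N c p(1)])
  have T: "set (map (tvec_of N c p) [a1, a2, a3, a4]) \<subseteq> tangent_space N p"
    using tvec_of_in_tangent_space[OF N c p(1)] by auto
  have "wedge 2 2 \<alpha> \<beta> p (map (tvec_of N c p) [a1, a2, a3, a4]) =
      wedge22 (\<lambda>u v. local_form N c \<alpha> y [u, v]) (\<lambda>u v. local_form N c \<beta> y [u, v])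
       ((map (tvec_of N c p) [a1, a2, a3, a4] ! 0) c) ((map (tvec_of N c p) [a1, a2, a3, a4] ! 1) c)
       ((map (tvec_of N c p) [a1, a2, a3, a4] ! 2) c) ((map (tvec_of N c p) [a1, a2, a3, a4] ! 3) c)"
    unfolding p(2)
    by (rule wedge_2_2_local_form[OF N c p(1) T])
      (use alternating_local_forms(2)[OF y] \<alpha>\<beta> in \<open>simp_all add: p(2)\<close>)
  then show ?thesis unfolding lf by (simp add: co)
qed

text \<open>All three squares equal \<open>\<omega>\<^sub>1 \<and> \<omega>\<^sub>1\<close>, which therefore serves as the 4-form \<open>v\<close> of the SU(2)-structure.\<close>

lemma wedge_forms_local_eq:
  assumes y: "y \<in> W" and ij: "i < 3" "j < 3"
  shows "local_form N c (wedge 2 2 ([\<omega>1, \<omega>2, \<omega>3] ! i) ([\<omega>1, \<omega>2, \<omega>3] ! j)) y [a1, a2, a3, a4] =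
    (if i = j then 1 else 0) * wedge22 (\<lambda>u v. kform (T y u) (T y v)) (\<lambda>u v. kform (T y u) (T y v)) a1 a2 a3 a4"
proof -
  have perp: "T y a \<bullet> m y = 0" for a using unit_normal(2)[OF y] by (simp add: inner_commute)
  note rel = hyperplane_SU2_relations[OF unit_normal(1)[OF y] perp perp perp perp, of a1 a2 a3 a4]
  note comp = wedge22_comp[where h = "T y"]
  have in3: "i = 0 \<or> i = 1 \<or> i = 2" "j = 0 \<or> j = 1 \<or> j = 2" using ij by arith+
  have "wedge22 (\<lambda>u v. local_form N c ([\<omega>1, \<omega>2, \<omega>3] ! i) y [u, v]) (\<lambda>u v. local_form N c ([\<omega>1, \<omega>2, \<omega>3] ! j) y [u, v]) a1 a2 a3 a4
     = (if i = j then 1 else 0) * wedge22 kform kform (T y a1) (T y a2) (T y a3) (T y a4)"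
    using in3
    by (elim disjE; hypsubst)
      (simp_all add: local_forms[OF y] wedge22_uminus comp[where \<alpha> = kform and \<beta> = kform]
        comp[where \<alpha> = kform and \<beta> = "\<lambda>u v. Re (vol (m y) u v)"] comp[where \<alpha> = kform and \<beta> = "\<lambda>u v. Im (vol (m y) u v)"]
        comp[where \<beta> = kform and \<alpha> = "\<lambda>u v. Re (vol (m y) u v)"] comp[where \<beta> = kform and \<alpha> = "\<lambda>u v. Im (vol (m y) u v)"]
        comp[where \<alpha> = "\<lambda>u v. Re (vol (m y) u v)" and \<beta> = "\<lambda>u v. Re (vol (m y) u v)"]
        comp[where \<alpha> = "\<lambda>u v. Re (vol (m y) u v)" and \<beta> = "\<lambda>u v. Im (vol (m y) u v)"]
        comp[where \<alpha> = "\<lambda>u v. Im (vol (m y) u v)" and \<beta> = "\<lambda>u v. Re (vol (m y) u v)"]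
        comp[where \<alpha> = "\<lambda>u v. Im (vol (m y) u v)" and \<beta> = "\<lambda>u v. Im (vol (m y) u v)"]
        rel wedge22_commute[of "\<lambda>u v. Re (vol (m y) u v)" kform] wedge22_commute[of "\<lambda>u v. Im (vol (m y) u v)" kform]
        wedge22_commute[of "\<lambda>u v. Im (vol (m y) u v)" "\<lambda>u v. Re (vol (m y) u v)"])
  moreover have "[\<omega>1, \<omega>2, \<omega>3] ! i \<in> {\<omega>1, \<omega>2, \<omega>3}" "[\<omega>1, \<omega>2, \<omega>3] ! j \<in> {\<omega>1, \<omega>2, \<omega>3}"
    using in3 by auto
  ultimately show ?thesis
    by (simp only: wedge_forms_local[OF y] comp[where \<alpha> = kform and \<beta> = kform])
qed

lemma volume_form_local:
  shows "y \<in> W \<Longrightarrow> alternating_multilinear 4 (local_form N c (wedge 2 2 \<omega>1 \<omega>1) y)"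
    and "smooth_on W (\<lambda>y. local_form N c (wedge 2 2 \<omega>1 \<omega>1) y [a1, a2, a3, a4])"
proof -
  have e: "local_form N c (wedge 2 2 \<omega>1 \<omega>1) y [a1, a2, a3, a4] =
      wedge22 (\<lambda>u v. kform (T y u) (T y v)) (\<lambda>u v. kform (T y u) (T y v)) a1 a2 a3 a4"
    if "y \<in> W" for y a1 a2 a3 a4
    using wedge_forms_local_eq[OF that, of 0 0] by simp
  show "alternating_multilinear 4 (local_form N c (wedge 2 2 \<omega>1 \<omega>1) y)" if y: "y \<in> W"
  proof (rule alternating_multilinear_wedge22[OF _ _ _ e[OF y]])
    note a = alternating_multilinear_2_linear[OF alternating_local_forms(2)[OF y, of \<omega>1, simplified]]
    show "linear (\<lambda>v. kform (T y v) (T y w))" "linear (\<lambda>v. kform (T y w) (T y v))" for w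
      using a[of w] by (simp_all add: local_forms[OF y])
    show "kform (T y w) (T y v) = - kform (T y v) (T y w)" for v w by (rule kform_commute)
  qed
  have k: "smooth_on W (\<lambda>y. kform (T y u) (T y v))" for u v
    by (intro smooth_on_kform open_W smooth_tangent)
  show "smooth_on W (\<lambda>y. local_form N c (wedge 2 2 \<omega>1 \<omega>1) y [a1, a2, a3, a4])"
    by (rule iffD2[OF smooth_on_cong[OF open_W e]], assumption)
      (unfold wedge22_def, intro smooth_on_add smooth_on_diff smooth_on_mult open_W k)
qed

lemma pointwise_nondegenerate:
  assumes p: "p \<in> fst c" "snd c p \<in> W"
  shows "\<exists>vs. length vs = 5 \<and> set vs \<subseteq> tangent_space N p \<and> wedge 4 1 (wedge 2 2 \<omega>1 \<omega>1) \<eta> p vs \<noteq> 0"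
    and "\<lbrakk>X \<in> tangent_space N p; Y \<in> tangent_space N p; \<And>Z. Z \<in> tangent_space N p \<Longrightarrow> \<omega>1 p [X, Z] = \<omega>2 p [Y, Z]\<rbrakk>
      \<Longrightarrow> \<omega>3 p [X, Y] \<ge> 0"
proof -
  define x where "x = snd c p"
  have x: "x \<in> W" using p(2) by (simp add: x_def)
  have range: "\<exists>u. v = T x u" if "v \<bullet> m x = 0" for v
    using range_T[OF x] that by (auto simp: inner_commute)
  have perp: "T x a \<bullet> m x = 0" for a using unit_normal(2)[OF x] by (simp add: inner_commute)
  obtain a b d e h where fr: "a \<bullet> m x = 0" "b \<bullet> m x = 0" "d \<bullet> m x = 0" "e \<bullet> m x = 0" "h \<bullet> m x = 0"
    "kform (m x) a = 0" "kform (m x) b = 0" "kform (m x) d = 0" "kform (m x) e = 0" "kform (m x) h \<noteq> 0"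
    "wedge22 kform kform a b d e \<noteq> 0"
    and pos: "\<And>u v. u \<bullet> m x = 0 \<Longrightarrow> v \<bullet> m x = 0 \<Longrightarrow> (\<And>z. z \<in> {a, b, d, e} \<Longrightarrow> kform u z = Im (vol (m x) v z)) \<Longrightarrow> - Re (vol (m x) u v) \<ge> 0"
  proof (rule hyperplane_adapted_frame[OF unit_normal(1)[OF x]], goal_cases)
    case (1 a b d e h)
    show ?case by (rule 1(1)[OF 1(2-12)]) (rule 1(13))
  qed
  obtain a' where a': "a = T x a'" using range[OF fr(1)] by blast
  obtain b' where b': "b = T x b'" using range[OF fr(2)] by blast
  obtain d' where d': "d = T x d'" using range[OF fr(3)] by blast
  obtain e' where e': "e = T x e'" using range[OF fr(4)] by blast
  obtain h' where h': "h = T x h'" using range[OF fr(5)] by blast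
  note pre = a' b' d' e' h'
  let ?t = "tvec_of N c p"
  have t: "?t u \<in> tangent_space N p" for u by (rule tvec_of_in_tangent_space[OF N c p(1)])
  have co: "?t u c = u" for u by (rule tvec_of_coord[OF N c p(1)])
  note at = forms_at[OF p, folded x_def]
  show "\<exists>vs. length vs = 5 \<and> set vs \<subseteq> tangent_space N p \<and> wedge 4 1 (wedge 2 2 \<omega>1 \<omega>1) \<eta> p vs \<noteq> 0"
  proof (intro exI conjI)
    let ?vs = "map ?t [a', b', d', e', h']"
    let ?f = "\<lambda>X Y. kform (T x (X c)) (T x (Y c))"
    show "length ?vs = 5" by simp
    show sub: "set ?vs \<subseteq> tangent_space N p" using t by auto
    have "wedge 4 1 (wedge 2 2 \<omega>1 \<omega>1) \<eta> p ?vs =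
        wedge22 ?f ?f (?vs ! 0) (?vs ! 1) (?vs ! 2) (?vs ! 3) * \<eta> p [?vs ! 4]"
    proof (rule wedge_4_1_last_factor)
      show "wedge 2 2 \<omega>1 \<omega>1 p [X, Y, Z, Z'] = wedge22 ?f ?f X Y Z Z'" if "{X, Y, Z, Z'} \<subseteq> set ?vs" for X Y Z Z'
      proof -
        have i: "set [X, Y, Z, Z'] \<subseteq> tangent_space N p"
          by (rule subset_trans[OF _ sub]) (use that in \<open>simp only: list.set\<close>)
        have "wedge 2 2 \<omega>1 \<omega>1 p [X, Y, Z, Z'] = local_form N c (wedge 2 2 \<omega>1 \<omega>1) x [X c, Y c, Z c, Z' c]"
          using form_eq_local_form[OF N c p(1) i] by (simp add: x_def)
        also have "\<dots> = wedge22 (\<lambda>u v. kform (T x u) (T x v)) (\<lambda>u v. kform (T x u) (T x v)) (X c) (Y c) (Z c) (Z' c)"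
          using wedge_forms_local_eq[OF x, of 0 0] by simp
        finally show ?thesis by (simp add: wedge22_def)
      qed
      show "?f w v = - ?f v w" for v w by (rule kform_commute)
      show "length ?vs = 5" by simp
      fix i :: nat assume "i < 4"
      then have "i = 0 \<or> i = 1 \<or> i = 2 \<or> i = 3" by arith
      then show "\<eta> p [?vs ! i] = 0"
        by (elim disjE) (simp_all add: at(1)[OF t t] co pre[symmetric] fr)
    qed
    also have "\<dots> = wedge22 kform kform a b d e * (- kform (m x) h)"
      by (simp add: wedge22_def at(1)[OF t t] co pre[symmetric])
    finally show "wedge 4 1 (wedge 2 2 \<omega>1 \<omega>1) \<eta> p ?vs \<noteq> 0" using fr(10,11) by simp
  qed
  show "\<omega>3 p [X, Y] \<ge> 0" if X: "X \<in> tangent_space N p" and Y: "Y \<in> tangent_space N p"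
    and Z: "\<And>Z. Z \<in> tangent_space N p \<Longrightarrow> \<omega>1 p [X, Z] = \<omega>2 p [Y, Z]"
    unfolding at(4)[OF X Y]
  proof (rule pos[OF perp perp])
    fix z assume "z \<in> {a, b, d, e}"
    then obtain u where u: "z = T x u" using pre by blast
    show "kform (T x (X c)) z = Im (vol (m x) (T x (Y c)) z)"
      using Z[OF t[of u]] unfolding at(2)[OF X t] at(3)[OF Y t] co u .
  qed
qed

text \<open>The chart \<open>c'\<close> has to be the one that \<open>ext_deriv\<close> chooses at \<open>f p\<close>, because this is where the equation for \<open>d\<Psi>\<^sub>-\<close>
  is read off.\<close>

lemma structure_equations_local:
  assumes tg: "totally_geodesic N M g f \<nu>" and p: "p \<in> fst c" "snd c p \<in> W" and c'_def: "c' = chart_at M (f p)"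
  shows "local_ext_deriv (local_form N c \<eta>) (snd c p) [u, v] =
      2 * Re (vol (m (snd c p)) (T (snd c p) u) (T (snd c p) v))"
    and "local_ext_deriv (local_form N c \<omega>2) (snd c p) [u, v, w] =
      3 * (kform (m (snd c p)) (T (snd c p) u) * kform (T (snd c p) v) (T (snd c p) w)
        - kform (m (snd c p)) (T (snd c p) v) * kform (T (snd c p) u) (T (snd c p) w)
        + kform (m (snd c p)) (T (snd c p) w) * kform (T (snd c p) u) (T (snd c p) v))"
proof -
  define x where "x = snd c p"
  have x: "x \<in> W" using p(2) by (simp add: x_def)
  have fp: "f p \<in> fst c'" "f p \<in> U" "\<phi> x = snd c' (f p)"
  proof -
    obtain p' where p': "p' \<in> fst c" "f p' \<in> fst c'" "f p' \<in> U" "x = snd c p'" "coord_inv c x = p'"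
      "p' \<in> carrier N" "\<phi> x = snd c' (f p')"
      by (rule W_cases[OF x])
    have "p' = p" using p'(5) coord_inv_coord[OF N c p(1)] by (simp add: x_def)
    then show "f p \<in> fst c'" "f p \<in> U" "\<phi> x = snd c' (f p)" using p' by simp_all
  qed
  have Vx: "\<phi> x \<in> V" by (rule \<phi>_in_V[OF x])
  let ?h = "local_metric M g c'"
  note lfV = local_form_in_frame[OF M cof c', folded V_def]
  obtain K where K: "bilinear K" "\<And>u v w. K u v \<bullet> w + v \<bullet> K u w = 0"
    "\<And>a u. frechet_derivative (\<lambda>y. \<theta> y a) (at (\<phi> x)) u = K (\<theta> (\<phi> x) u) (\<theta> (\<phi> x) a) + \<theta> (\<phi> x) (christoffel ?h (\<phi> x) u a)"
    "\<And>a u. christoffel ?h (\<phi> x) u a = christoffel ?h (\<phi> x) a u"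
  proof (rule frame_connection[OF open_V Vx _ linear_\<theta> inj_\<theta>[OF Vx] smooth_\<theta>])
    show "?h y a b = \<theta> y a \<bullet> \<theta> y b" if "y \<in> V" for y a b
      using local_metric_in_frame[OF M cof c' g] that unfolding V_def by blast
  qed (use that in auto)
  have surj: "surj (\<theta> (\<phi> x))"
    by (rule linear_injective_imp_surjective[OF linear_\<theta>[OF Vx] inj_\<theta>[OF Vx]]) simp
  have dF: "local_ext_deriv (local_form M c' F) y [a, b, d] = 3 * local_form M c' \<Psi>p y [a, b, d]" if "y \<in> V" for y a b d
  proof -
    obtain q where q: "q \<in> fst c'" "y = snd c' q" using \<open>y \<in> V\<close> unfolding V_def by blast
    have qM: "q \<in> carrier M" using q(1) c' unfolding carrier_def by blast
    have "set (map (tvec_of M c' q) [a, b, d]) \<subseteq> tangent_space M q"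
      using tvec_of_in_tangent_space[OF M c' q(1)] by auto
    then have "ext_deriv M F q (map (tvec_of M c' q) [a, b, d]) = (3 \<odot> \<Psi>p) q (map (tvec_of M c' q) [a, b, d])"
      using nK qM unfolding nearly_Kaehler_def form_eq_def by simp
    then show ?thesis
      unfolding q(2) ext_deriv_2_in_chart[OF M c' q(1) F_smooth] local_form_at[OF M c' q(1)] scale_form_def .
  qed
  have dQ: "local_ext_deriv (local_form M c' \<Psi>m) (\<phi> x) [a1, a2, a3, a4] =
      - 2 * wedge22 kform kform (\<theta> (\<phi> x) a1) (\<theta> (\<phi> x) a2) (\<theta> (\<phi> x) a3) (\<theta> (\<phi> x) a4)" for a1 a2 a3 a4
  proof -
    let ?t = "tvec_of M c' (f p)"
    let ?Xs = "map ?t [a1, a2, a3, a4]"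
    have qM: "f p \<in> carrier M" using fp(1) c' unfolding carrier_def by blast
    have sub: "set ?Xs \<subseteq> tangent_space M (f p)"
      using tvec_of_in_tangent_space[OF M c' fp(1)] by auto
    have co: "?t a c' = a" for a by (rule tvec_of_coord[OF M c' fp(1)])
    have "ext_deriv M \<Psi>m (f p) ?Xs = ((-2) \<odot> wedge 2 2 F F) (f p) ?Xs"
      using nK qM sub unfolding nearly_Kaehler_def form_eq_def by simp
    moreover have "ext_deriv M \<Psi>m (f p) ?Xs = local_ext_deriv (local_form M c' \<Psi>m) (\<phi> x) [a1, a2, a3, a4]"
      unfolding ext_deriv_def Let_def c'_def[symmetric] fp(3) by (simp add: co)
    moreover have "wedge 2 2 F F (f p) ?Xs =
        wedge22 (\<lambda>u v. local_form M c' F (\<phi> x) [u, v]) (\<lambda>u v. local_form M c' F (\<phi> x) [u, v]) a1 a2 a3 a4"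
    proof -
      have "snd c' (f p) \<in> snd c' ` (fst c' \<inter> carrier M)" using qM fp(1) by blast
      then have "alternating_multilinear 2 (local_form M c' F (snd c' (f p)))"
        using F_smooth c' unfolding smooth_form_on_def by blast
      from wedge_2_2_local_form[OF M c' fp(1) sub _ this this] show ?thesis
        unfolding fp(3) by (simp add: co)
    qed
    moreover have "\<dots> = wedge22 kform kform (\<theta> (\<phi> x) a1) (\<theta> (\<phi> x) a2) (\<theta> (\<phi> x) a3) (\<theta> (\<phi> x) a4)"
      unfolding lfV(1)[OF Vx] by (rule wedge22_comp)
    ultimately show ?thesis by (simp add: scale_form_def)
  qed
  note nkf = nearly_Kaehler_frame[where \<theta> = \<theta> and A = "local_form M c' F" and P = "local_form M c' \<Psi>p"
      and Q = "local_form M c' \<Psi>m" and \<Gamma> = "christoffel ?h (\<phi> x)" and K = K, OF open_V Vx surj smooth_\<theta> K lfV dF dQ]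
  have geodesic: "\<theta> (\<phi> x) (frechet_derivative (\<lambda>y. frechet_derivative \<phi> (at y) w) (at x) u
        + christoffel ?h (\<phi> x) (frechet_derivative \<phi> (at x) u) (frechet_derivative \<phi> (at x) w)) \<bullet> m x = 0" for u w
  proof -
    have ci: "coord_inv c x = p" unfolding x_def by (rule coord_inv_coord[OF N c p(1)])
    have pN: "p \<in> carrier N" using p(1) c unfolding carrier_def by blast
    have nu: "\<nu> p = tvec_of M c' (f p) (\<nu> p c')"
      by (rule tangent_vector_eq_tvec_of[OF M c' fp(1) \<nu>_tangent[OF pN]])
    have "second_fundamental_form M g f \<nu> c c' p u w = 0"
      using tg c c' p(1) fp(1) unfolding totally_geodesic_def by blast
    then have "g (f p) (tvec_of M c' (f p) (covariant_deriv_push M g f c c' p u w)) (tvec_of M c' (f p) (\<nu> p c')) = 0"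
      unfolding second_fundamental_form_def nu[symmetric] .
    then show ?thesis
      unfolding metric_tvec[OF fp(1,2)] covariant_deriv_push_def Let_def x_def[symmetric] normal_frame_def ci fp(3)[symmetric] .
  qed
  have smn: "smooth_on W (\<lambda>y. \<nu> (coord_inv c y) c')"
  proof (rule smooth_on_subset[OF _ W_sub])
    show "smooth_on (snd c ` (fst c \<inter> f -` fst c')) (\<lambda>y. \<nu> (coord_inv c y) c')"
      using hyp c c' unfolding oriented_hypersurface_def by blast
  qed
  note tgd = totally_geodesic_frame_derivatives[where \<theta> = \<theta> and \<phi> = \<phi> and K = K and T = T and m = m
      and \<Gamma> = "christoffel ?h (\<phi> x)" and n = "\<lambda>y. \<nu> (coord_inv c y) c'",
      OF open_V linear_\<theta> inj_\<theta>[OF Vx] smooth_\<theta> K(2-4) open_W x smooth_\<phi> \<phi>_V smn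
        tangent_frame_def normal_frame_def unit_normal range_T[OF x] geodesic]
  obtain s where s: "\<And>u w. s u w = s w u"
    "\<And>w. ((\<lambda>y. T y w) has_derivative (\<lambda>u. K (T x u) (T x w) + s u w)) (at x)"
    using tgd(2) by blast
  note eqs = hypersurface_structure_equations[where T = T and m = m and K = K and s = s, OF tgd(1) s nkf open_W x
      local_forms(1) local_forms(3)]
  show "local_ext_deriv (local_form N c \<eta>) (snd c p) [u, v] =
      2 * Re (vol (m (snd c p)) (T (snd c p) u) (T (snd c p) v))"
    unfolding x_def[symmetric] by (rule eqs(1))
  show "local_ext_deriv (local_form N c \<omega>2) (snd c p) [u, v, w] =
      3 * (kform (m (snd c p)) (T (snd c p) u) * kform (T (snd c p) v) (T (snd c p) w)
        - kform (m (snd c p)) (T (snd c p) v) * kform (T (snd c p) u) (T (snd c p) w)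
        + kform (m (snd c p)) (T (snd c p) w) * kform (T (snd c p) u) (T (snd c p) v))"
    unfolding x_def[symmetric] by (rule eqs(2))
qed

end

context nearly_Kaehler_hypersurface
begin

lemma hypersurface_chart_exists:
  assumes "c \<in> N" "p \<in> fst c"
  obtains U e where "hypersurface_chart M N F \<Psi>p \<Psi>m g f \<nu> c (chart_at M (f p)) U e"
    "snd c p \<in> hypersurface_chart.W f c (chart_at M (f p)) U"
proof -
  have "p \<in> carrier N" using assms unfolding carrier_def by blast
  then have fp: "f p \<in> carrier M" using f by (auto simp: smooth_map_def)
  obtain U e where U: "f p \<in> U" "SU3_coframe M F \<Psi>p \<Psi>m U e"
    using nK fp unfolding nearly_Kaehler_def SU3_structure_def by blast
  have h: "hypersurface_chart M N F \<Psi>p \<Psi>m g f \<nu> c (chart_at M (f p)) U e"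
    by unfold_locales (rule assms(1), rule chart_at_in(1)[OF fp], rule U(2))
  have "snd c p \<in> snd c ` (fst c \<inter> f -` (fst (chart_at M (f p)) \<inter> U))"
    using assms(2) chart_at_in(2)[OF fp] U(1) by blast
  then show thesis using that[OF h] unfolding hypersurface_chart.W_def[OF h] by blast
qed

text \<open>Smoothness is local, so it can be checked on the sets \<open>W\<close>.\<close>

lemma smooth_form_onI:
  fixes \<alpha> :: "('q, real^5, real) dform"
  assumes "\<And>c c' U e y. hypersurface_chart M N F \<Psi>p \<Psi>m g f \<nu> c c' U e \<Longrightarrow> y \<in> hypersurface_chart.W f c c' U \<Longrightarrow>
      alternating_multilinear k (local_form N c \<alpha> y)"
    and "\<And>c c' U e us. hypersurface_chart M N F \<Psi>p \<Psi>m g f \<nu> c c' U e \<Longrightarrow> length us = k \<Longrightarrow>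
      smooth_on (hypersurface_chart.W f c c' U) (\<lambda>y. local_form N c \<alpha> y us)"
  shows "smooth_form_on N (carrier N) k \<alpha>"
  unfolding smooth_form_on_def
proof (intro ballI conjI allI impI)
  fix c x assume c: "c \<in> N" and "x \<in> snd c ` (fst c \<inter> carrier N)"
  then obtain p where p: "p \<in> fst c" "x = snd c p" by blast
  obtain U e where h: "hypersurface_chart M N F \<Psi>p \<Psi>m g f \<nu> c (chart_at M (f p)) U e"
    "snd c p \<in> hypersurface_chart.W f c (chart_at M (f p)) U"
    by (rule hypersurface_chart_exists[OF c p(1)]) (rule that)
  show "alternating_multilinear k (local_form N c \<alpha> x)"
    unfolding p(2) by (rule assms(1)[OF h])
next
  fix c and us :: "(real^5) list" assume c: "c \<in> N" and us: "length us = k"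
  show "smooth_on (snd c ` (fst c \<inter> carrier N)) (\<lambda>x. local_form N c \<alpha> x us)"
  proof (rule smooth_on_local)
    fix x assume "x \<in> snd c ` (fst c \<inter> carrier N)"
    then obtain p where p: "p \<in> fst c" "x = snd c p" by blast
    obtain U e where h: "hypersurface_chart M N F \<Psi>p \<Psi>m g f \<nu> c (chart_at M (f p)) U e"
      "snd c p \<in> hypersurface_chart.W f c (chart_at M (f p)) U"
      by (rule hypersurface_chart_exists[OF c p(1)]) (rule that)
    show "\<exists>W. open W \<and> x \<in> W \<and> smooth_on W (\<lambda>x. local_form N c \<alpha> x us)"
      using hypersurface_chart.open_W[OF h(1)] h(2) assms(2)[OF h(1) us] p(2) by blast
  qed
qed

lemma induced_SU2_structure: "SU2_structure N \<eta> \<omega>1 \<omega>2 \<omega>3"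
  unfolding SU2_structure_def
proof (intro conjI)
  show "smooth_form_on N (carrier N) 1 \<eta>"
  proof (rule smooth_form_onI)
    fix c c' U e and us :: "(real^5) list" assume h: "hypersurface_chart M N F \<Psi>p \<Psi>m g f \<nu> c c' U e" and "length us = 1"
    then obtain u where "us = [u]" by (auto simp: length_Suc0_conv)
    then show "smooth_on (hypersurface_chart.W f c c' U) (\<lambda>y. local_form N c \<eta> y us)"
      using hypersurface_chart.smooth_local_forms(1)[OF h] by simp
  qed (rule hypersurface_chart.alternating_local_forms(1))
  show "\<forall>\<omega>\<in>{\<omega>1, \<omega>2, \<omega>3}. smooth_form_on N (carrier N) 2 \<omega>"
  proof
    fix \<omega> assume w: "\<omega> \<in> {\<omega>1, \<omega>2, \<omega>3}"
    show "smooth_form_on N (carrier N) 2 \<omega>"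
    proof (rule smooth_form_onI)
      fix c c' U e and us :: "(real^5) list" assume h: "hypersurface_chart M N F \<Psi>p \<Psi>m g f \<nu> c c' U e" and "length us = 2"
      then obtain u v where "us = [u, v]" unfolding length_2_conv by blast
      then show "smooth_on (hypersurface_chart.W f c c' U) (\<lambda>y. local_form N c \<omega> y us)"
        using w hypersurface_chart.smooth_local_forms(2-4)[OF h] by auto
    qed (rule hypersurface_chart.alternating_local_forms(2)[OF _ _ w])
  qed
  show "\<exists>v. smooth_form_on N (carrier N) 4 v \<and>
      (\<forall>i<3. \<forall>j<3. form_eq N (carrier N) 4 (wedge 2 2 ([\<omega>1, \<omega>2, \<omega>3] ! i) ([\<omega>1, \<omega>2, \<omega>3] ! j)) ((if i = j then 1 else 0) \<odot> v)) \<and>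
      (\<forall>p\<in>carrier N. \<exists>vs. length vs = 5 \<and> set vs \<subseteq> tangent_space N p \<and> wedge 4 1 v \<eta> p vs \<noteq> 0)"
  proof (intro exI[of _ "wedge 2 2 \<omega>1 \<omega>1"] conjI allI impI ballI)
    show "smooth_form_on N (carrier N) 4 (wedge 2 2 \<omega>1 \<omega>1)"
    proof (rule smooth_form_onI)
      fix c c' U e and us :: "(real^5) list" assume h: "hypersurface_chart M N F \<Psi>p \<Psi>m g f \<nu> c c' U e" and "length us = 4"
      then obtain a1 a2 a3 a4 where "us = [a1, a2, a3, a4]" unfolding length_4_conv by blast
      then show "smooth_on (hypersurface_chart.W f c c' U) (\<lambda>y. local_form N c (wedge 2 2 \<omega>1 \<omega>1) y us)"
        using hypersurface_chart.volume_form_local(2)[OF h] by simp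
    qed (rule hypersurface_chart.volume_form_local(1))
  next
    fix i j :: nat assume ij: "i < 3" "j < 3"
    show "form_eq N (carrier N) 4 (wedge 2 2 ([\<omega>1, \<omega>2, \<omega>3] ! i) ([\<omega>1, \<omega>2, \<omega>3] ! j)) ((if i = j then 1 else 0) \<odot> wedge 2 2 \<omega>1 \<omega>1)"
      unfolding form_eq_def
    proof (intro ballI allI impI)
      fix p vs assume p: "p \<in> carrier N" and vs: "length vs = 4 \<and> set vs \<subseteq> tangent_space N p"
      note c = chart_at_in[OF p]
      obtain X Y Z Z' where XY: "vs = [X, Y, Z, Z']" using vs unfolding length_4_conv by blast
      obtain U e where h: "hypersurface_chart M N F \<Psi>p \<Psi>m g f \<nu> (chart_at N p) (chart_at M (f p)) U e"
        "snd (chart_at N p) p \<in> hypersurface_chart.W f (chart_at N p) (chart_at M (f p)) U"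
        by (rule hypersurface_chart_exists[OF c]) (rule that)
      note lf = form_eq_local_form[OF N c conjunct2[OF vs]]
      note w = hypersurface_chart.wedge_forms_local_eq[OF h]
      show "wedge 2 2 ([\<omega>1, \<omega>2, \<omega>3] ! i) ([\<omega>1, \<omega>2, \<omega>3] ! j) p vs = ((if i = j then 1 else 0) \<odot> wedge 2 2 \<omega>1 \<omega>1) p vs"
        unfolding scale_form_def lf[of "wedge 2 2 ([\<omega>1, \<omega>2, \<omega>3] ! i) ([\<omega>1, \<omega>2, \<omega>3] ! j)"] lf[of "wedge 2 2 \<omega>1 \<omega>1"]
        unfolding XY list.map w[OF ij] using w[of 0 0] by simp
    qed
  next
    fix p assume p: "p \<in> carrier N"
    note c = chart_at_in[OF p]
    obtain U e where h: "hypersurface_chart M N F \<Psi>p \<Psi>m g f \<nu> (chart_at N p) (chart_at M (f p)) U e"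
      "snd (chart_at N p) p \<in> hypersurface_chart.W f (chart_at N p) (chart_at M (f p)) U"
      by (rule hypersurface_chart_exists[OF c]) (rule that)
    show "\<exists>vs. length vs = 5 \<and> set vs \<subseteq> tangent_space N p \<and> wedge 4 1 (wedge 2 2 \<omega>1 \<omega>1) \<eta> p vs \<noteq> 0"
      by (rule hypersurface_chart.pointwise_nondegenerate(1)[OF h(1) c(2) h(2)])
  qed
  show "\<forall>p\<in>carrier N. \<forall>X\<in>tangent_space N p. \<forall>Y\<in>tangent_space N p.
      (\<forall>Z\<in>tangent_space N p. \<omega>1 p [X, Z] = \<omega>2 p [Y, Z]) \<longrightarrow> 0 \<le> \<omega>3 p [X, Y]"
  proof (intro ballI impI)
    fix p X Y assume p: "p \<in> carrier N" and XY: "X \<in> tangent_space N p" "Y \<in> tangent_space N p"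
      and Z: "\<forall>Z\<in>tangent_space N p. \<omega>1 p [X, Z] = \<omega>2 p [Y, Z]"
    note c = chart_at_in[OF p]
    obtain U e where h: "hypersurface_chart M N F \<Psi>p \<Psi>m g f \<nu> (chart_at N p) (chart_at M (f p)) U e"
      "snd (chart_at N p) p \<in> hypersurface_chart.W f (chart_at N p) (chart_at M (f p)) U"
      by (rule hypersurface_chart_exists[OF c]) (rule that)
    show "0 \<le> \<omega>3 p [X, Y]"
      by (rule hypersurface_chart.pointwise_nondegenerate(2)[OF h(1) c(2) h(2) XY]) (use Z in blast)
  qed
qed

lemma structure_equations:
  assumes tg: "totally_geodesic N M g f \<nu>"
  shows "form_eq N (carrier N) 2 (ext_deriv N \<eta>) ((-2) \<odot> \<omega>3)"
    and "form_eq N (carrier N) 3 (ext_deriv N \<omega>1) (3 \<odot> wedge 1 2 \<eta> \<omega>2)"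
    and "form_eq N (carrier N) 3 (ext_deriv N \<omega>2) ((-3) \<odot> wedge 1 2 \<eta> \<omega>1)"
proof -
  have eqs: "ext_deriv N \<eta> p [X, Y] = - 2 * \<omega>3 p [X, Y]"
    "ext_deriv N \<omega>1 p [X, Y, Z] = 3 * wedge 1 2 \<eta> \<omega>2 p [X, Y, Z]"
    "ext_deriv N \<omega>2 p [X, Y, Z] = - 3 * wedge 1 2 \<eta> \<omega>1 p [X, Y, Z]"
    if p: "p \<in> carrier N" and X: "X \<in> tangent_space N p" "Y \<in> tangent_space N p" "Z \<in> tangent_space N p" for p X Y Z
  proof -
    define c where "c = chart_at N p"
    note c = chart_at_in[OF p, folded c_def]
    obtain U e where h: "hypersurface_chart M N F \<Psi>p \<Psi>m g f \<nu> c (chart_at M (f p)) U e"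
      and W: "snd c p \<in> hypersurface_chart.W f c (chart_at M (f p)) U"
      by (rule hypersurface_chart_exists[OF c]) (rule that)
    interpret h: hypersurface_chart M N F \<Psi>p \<Psi>m g f \<nu> c "chart_at M (f p)" U e by (rule h)
    let ?x = "snd c p"
    note at = h.forms_at[OF c(2) W]
    note eq = h.structure_equations_local[OF tg c(2) W refl]
    have fpc: "f p \<in> fst (chart_at M (f p))"
      using f p by (intro chart_at_in(2)) (auto simp: smooth_map_def)
    have perp: "h.T ?x a \<bullet> h.m ?x = 0" for a using h.unit_normal(2)[OF W] by (simp add: inner_commute)
    have w2: "\<omega>2 p [V', V] = - \<omega>2 p [V, V']" if "V \<in> {X, Y, Z}" "V' \<in> {X, Y, Z}" for V V'
    proof -
      have VT: "V \<in> tangent_space N p" "V' \<in> tangent_space N p" using that X by auto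
      show ?thesis
        unfolding at(3)[OF VT] at(3)[OF VT(2,1)]
        using vol_swap(2)[of "h.m ?x" "h.T ?x (V' c)" "h.T ?x (V c)"] by simp
    qed
    have w1: "\<omega>1 p [V', V] = - \<omega>1 p [V, V']" if "V \<in> {X, Y, Z}" "V' \<in> {X, Y, Z}" for V V'
    proof -
      have VT: "V \<in> tangent_space N p" "V' \<in> tangent_space N p" using that X by auto
      show ?thesis unfolding at(2)[OF VT] at(2)[OF VT(2,1)] by (rule kform_commute)
    qed
    have wd1: "wedge 1 2 \<eta> \<omega>1 p [X, Y, Z] = \<eta> p [X] * \<omega>1 p [Y, Z] - \<eta> p [Y] * \<omega>1 p [X, Z] + \<eta> p [Z] * \<omega>1 p [X, Y]"
      by (rule wedge_1_2) (rule w1)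
    have wd2: "wedge 1 2 \<eta> \<omega>2 p [X, Y, Z] = \<eta> p [X] * \<omega>2 p [Y, Z] - \<eta> p [Y] * \<omega>2 p [X, Z] + \<eta> p [Z] * \<omega>2 p [X, Y]"
      by (rule wedge_1_2) (rule w2)
    show "ext_deriv N \<eta> p [X, Y] = - 2 * \<omega>3 p [X, Y]"
      unfolding ext_deriv_def Let_def c_def[symmetric] list.map eq(1) at(4)[OF X(1,2)] by simp
    have "ext_deriv N \<omega>2 p [X, Y, Z] = 3 * (kform (h.m ?x) (h.T ?x (X c)) * kform (h.T ?x (Y c)) (h.T ?x (Z c))
        - kform (h.m ?x) (h.T ?x (Y c)) * kform (h.T ?x (X c)) (h.T ?x (Z c))
        + kform (h.m ?x) (h.T ?x (Z c)) * kform (h.T ?x (X c)) (h.T ?x (Y c)))"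
      unfolding ext_deriv_def Let_def c_def[symmetric] list.map eq(2) by (rule refl)
    then show "ext_deriv N \<omega>2 p [X, Y, Z] = - 3 * wedge 1 2 \<eta> \<omega>1 p [X, Y, Z]"
      unfolding wd1 at(1)[OF X(1) X(1)] at(1)[OF X(2) X(2)] at(1)[OF X(3) X(3)]
        at(2)[OF X(1,2)] at(2)[OF X(1,3)] at(2)[OF X(2,3)]
      by simp
    have xW: "?x \<in> snd c ` (fst c \<inter> f -` fst (chart_at M (f p)))" using W h.W_sub by blast
    have fp: "f p \<in> carrier M" using f p by (auto simp: smooth_map_def)
    let ?D = "frechet_derivative (coord_rep c (chart_at M (f p))) (at ?x)"
    have ci: "coord_rep c (chart_at M (f p)) ?x = snd (chart_at M (f p)) (f p)"
      using coord_inv_coord[OF N c] by simp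
    have "ext_deriv N \<omega>1 p [X, Y, Z] = local_ext_deriv (local_form N c \<omega>1) ?x [X c, Y c, Z c]"
      unfolding ext_deriv_def Let_def c_def[symmetric] list.map by (rule refl)
    also have "\<dots> = ext_deriv M F (f p) (map (tvec_of M (chart_at M (f p)) (f p)) [?D (X c), ?D (Y c), ?D (Z c)])"
      unfolding \<omega>1_def local_ext_deriv_pullback[OF c(1) h.c' c(2) fpc F_smooth] list.map
        ext_deriv_2_in_chart[OF M h.c' fpc F_smooth] by (rule refl)
    also have "\<dots> = 3 * \<Psi>p (f p) (map (tvec_of M (chart_at M (f p)) (f p)) [?D (X c), ?D (Y c), ?D (Z c)])"
    proof -
      have "set (map (tvec_of M (chart_at M (f p)) (f p)) [?D (X c), ?D (Y c), ?D (Z c)]) \<subseteq> tangent_space M (f p)"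
        using tvec_of_in_tangent_space[OF M h.c' fpc] by auto
      then show ?thesis using nK fp unfolding nearly_Kaehler_def form_eq_def scale_form_def by simp
    qed
    also have "\<dots> = 3 * Re (vol (h.T ?x (X c)) (h.T ?x (Y c)) (h.T ?x (Z c)))"
      unfolding local_form_at[OF M h.c' fpc, symmetric]
        local_form_in_frame(2)[OF M h.cof h.c' h.\<phi>_in_V[OF W, unfolded h.V_def ci]]
        tangent_frame_def ci by (rule refl)
    also have "\<dots> = 3 * wedge 1 2 \<eta> \<omega>2 p [X, Y, Z]"
      unfolding wd2 at(1)[OF X(1) X(1)] at(1)[OF X(2) X(2)] at(1)[OF X(3) X(3)]
        at(3)[OF X(1,2)] at(3)[OF X(1,3)] at(3)[OF X(2,3)]
        hyperplane_vol[OF h.unit_normal(1)[OF W] perp perp perp]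
      by simp
    finally show "ext_deriv N \<omega>1 p [X, Y, Z] = 3 * wedge 1 2 \<eta> \<omega>2 p [X, Y, Z]" .
  qed
  show "form_eq N (carrier N) 2 (ext_deriv N \<eta>) ((-2) \<odot> \<omega>3)"
    unfolding form_eq_def length_2_conv using eqs(1) by (auto simp: scale_form_def)
  show "form_eq N (carrier N) 3 (ext_deriv N \<omega>1) (3 \<odot> wedge 1 2 \<eta> \<omega>2)"
    unfolding form_eq_def length_3_conv using eqs(2) by (auto simp: scale_form_def)
  show "form_eq N (carrier N) 3 (ext_deriv N \<omega>2) ((-3) \<odot> wedge 1 2 \<eta> \<omega>1)"
    unfolding form_eq_def length_3_conv using eqs(3) by (auto simp: scale_form_def)
qed

end

theorem lemma2p1:
  fixes M :: "('p::{t2_space, second_countable_topology}, real^6) chart set"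
    and N :: "('q::{t2_space, second_countable_topology}, real^5) chart set"
    and F \<Psi>p \<Psi>m :: "('p, real^6, real) dform"
    and g :: "('p, real^6) metric"
    and f :: "'q \<Rightarrow> 'p"
    and \<nu> :: "'q \<Rightarrow> ('p, real^6) tvec"
    and \<eta> \<omega>1 \<omega>2 \<omega>3 :: "('q, real^5, real) dform"
  assumes "smooth_manifold M" and "smooth_manifold N"
    and "nearly_Kaehler M F \<Psi>p \<Psi>m"
    and "SU3_metric M F \<Psi>p \<Psi>m g"
    and "oriented_hypersurface N M g f \<nu>"
    and "totally_geodesic N M g f \<nu>"
    and "\<eta> = (-1) \<odot> contract_along N M f \<nu> F"
    and "\<omega>1 = pullback N M f F"
    and "\<omega>2 = contract_along N M f \<nu> \<Psi>m"
    and "\<omega>3 = (-1) \<odot> contract_along N M f \<nu> \<Psi>p"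
  shows "SU2_structure N \<eta> \<omega>1 \<omega>2 \<omega>3 \<and>
         form_eq N (carrier N) 2 (ext_deriv N \<eta>) ((-2) \<odot> \<omega>3) \<and>
         form_eq N (carrier N) 3 (ext_deriv N \<omega>1) (3 \<odot> wedge 1 2 \<eta> \<omega>2) \<and>
         form_eq N (carrier N) 3 (ext_deriv N \<omega>2) ((-3) \<odot> wedge 1 2 \<eta> \<omega>1)"
proof -
  interpret nearly_Kaehler_hypersurface M N F \<Psi>p \<Psi>m g f \<nu>
    by unfold_locales (fact assms)+
  show ?thesis
    unfolding assms(7-10) \<eta>_def[symmetric] \<omega>1_def[symmetric] \<omega>2_def[symmetric] \<omega>3_def[symmetric]
    using induced_SU2_structure structure_equations[OF assms(6)] by blast
qed

end
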